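(* Let $d\ge1$, $a,c>0$, $\beta:=a/c$, $r_t(y):=\sqrt{c^2t^2-y^2}$. For fixed $x_0=(x_0^1,\dots,x_0^d)\in\mathbb{R}^d$ let $\mathbf{X}_t:=x_0+\mathbf{K}(t)$, where $\mathbf{K}$ is a $d$-dimensional Kac process with parameters $(a,c)$ starting in $\mathbf{0}$. Then $\mu_t(\cdot|x_0):=P_{\mathbf{X}_t}$ satisfies the continuity equation $\partial_t\mu_t+\nabla_x\cdot(\mu_tv_t)=0$ in the sense of distributions with the velocity field $$v_t(x|x_0):=\big(v_t^1(x^1|x_0^1),\dots,v_t^d(x^d|x_0^d)\big)\quad\text{for all } x=(x^1,\dots,x^d),$$ where the univariate components are given by $$v_t^i(x^i|x_0^i):=\begin{cases}(x^i-x_0^i)\Big(t+\dfrac{r_t(x^i-x_0^i)}{c}\cdot\dfrac{I_0(\beta r_t(x^i-x_0^i))}{I_0'(\beta r_t(x^i-x_0^i))}\Big)^{-1} & \text{if } x^i\in(x_0^i-ct,x_0^i+ct),\\ c & \text{if } x^i=x_0^i+ct,\\ -c & \text{if } x^i=x_0^i-ct,\\ \text{arbitrary} & \text{otherwise.}\end{cases}$$ Furthermore, for each $i$, $$v_t^i(x^i|x_0^i)=\mathbb{E}\big[\dot X^i(t)\,\big|\,X_t^i=x^i,\ X_0^i=x_0^i\big].$$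
   Context: $I_0$ denotes the modified Bessel function of the first kind of order $0$, and $I_0'=I_1$ its derivative. The one-dimensional Kac process starting in $0$ with parameters $a>0$ and $c>0$ is $K(t)=B\,c\int_0^t(-1)^{N(s)}\,\mathrm{d}s$, where $(N(s))_{s\ge0}$ is a homogeneous Poisson process with rate $a$ and $B$ is an independent random variable taking the values $\pm1$ with probability $\tfrac12$ each. A $d$-dimensional Kac process starting in $\mathbf{0}$ is $\mathbf{K}(t)=(K^1(t),\dots,K^d(t))$ with i.i.d. copies $K^i$. $P_{\mathbf{X}_t}$ is the law of $\mathbf{X}_t$, and $X_t^i$ is the $i$-th component of $\mathbf{X}_t$; $\dot X^i(t)$ is its time derivative, which for each fixed $t>0$ exists almost surely. The continuity equation is meant on $(0,\infty)\times\mathbb{R}^d$: $\int_0^\infty\int_{\mathbb{R}^d}\big(\partial_t\psi+v_t\cdot\nabla_x\psi\big)\,\mathrm{d}\mu_t\,\mathrm{d}t=0$ for all $\psi\in C_c^\infty((0,\infty)\times\mathbb{R}^d)$. "Arbitrary" means any values making the field Borel measurable. The conditional-expectation identity is understood, as usual, for $t>0$ and almost every $x^i$ with respect to the law of $X_t^i$. *)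

theory Defs
  imports "HOL-Probability.Probability"
begin

definition bessel_I0 :: "real \<Rightarrow> real" where
  "bessel_I0 x = (\<Sum>k. (x / 2) ^ (2 * k) / (fact k)\<^sup>2)"

text \<open>Processes are families indexed by \<^typ>\<open>real\<close>, of which only the times \<open>t \<ge> 0\<close> matter.
  Paths of a Poisson process are counting paths: starting in 0, nondecreasing, right-continuous.
  The truncated subtraction is harmless because of monotonicity.\<close>

definition poisson_process :: "'w measure \<Rightarrow> real \<Rightarrow> (real \<Rightarrow> 'w \<Rightarrow> nat) \<Rightarrow> bool" where
  "poisson_process M a N \<longleftrightarrow>
     (\<forall>t\<ge>0. N t \<in> M \<rightarrow>\<^sub>M count_space UNIV) \<and>
     (\<forall>\<omega>\<in>space M. N 0 \<omega> = 0 \<and> mono_on {0..} (\<lambda>t. N t \<omega>) \<and>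
        (\<forall>t\<ge>0. continuous (at_right t) (\<lambda>s. N s \<omega>))) \<and>
     (\<forall>s t. 0 \<le> s \<and> s < t \<longrightarrow>
        distr M (count_space UNIV) (\<lambda>\<omega>. N t \<omega> - N s \<omega>) = measure_pmf (poisson_pmf (a * (t - s)))) \<and>
     (\<forall>n (\<tau> :: nat \<Rightarrow> real). 0 \<le> \<tau> 0 \<and> mono \<tau> \<longrightarrow>
        prob_space.indep_vars M (\<lambda>_. count_space UNIV)
          (\<lambda>j \<omega>. N (\<tau> (Suc j)) \<omega> - N (\<tau> j) \<omega>) {..<n})"

definition kac_process :: "'w measure \<Rightarrow> real \<Rightarrow> real \<Rightarrow> (real \<Rightarrow> 'w \<Rightarrow> real) \<Rightarrow> bool" where
  "kac_process M a c K \<longleftrightarrow>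
     (\<exists>N B. poisson_process M a N \<and> B \<in> borel_measurable M \<and>
        measure M {\<omega> \<in> space M. B \<omega> = 1} = 1 / 2 \<and>
        measure M {\<omega> \<in> space M. B \<omega> = - 1} = 1 / 2 \<and>
        prob_space.indep_set M
          (sets (vimage_algebra (space M) B borel))
          (sets (vimage_algebra (space M) (\<lambda>\<omega>. \<lambda>t\<in>{0..}. N t \<omega>)
            (PiM {0..} (\<lambda>_. count_space UNIV)))) \<and>
        (\<forall>t\<ge>0. \<forall>\<omega>\<in>space M. K t \<omega> = B \<omega> * c * integral {0..t} (\<lambda>s. (- 1) ^ N s \<omega>)))"

text \<open>The components are independent as processes, i.e. as random elements of the path space
  with the product sigma-algebra. Equality of their laws needs no clause of its own: it follows
  from all components being Kac processes with the same parameters.\<close>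

definition kac_process_vec ::
    "'w measure \<Rightarrow> real \<Rightarrow> real \<Rightarrow> (real \<Rightarrow> 'w \<Rightarrow> real ^ 'd) \<Rightarrow> bool" where
  "kac_process_vec M a c K \<longleftrightarrow>
     (\<forall>i. kac_process M a c (\<lambda>t \<omega>. K t \<omega> $ i)) \<and>
     prob_space.indep_vars M (\<lambda>_. PiM {0..} (\<lambda>_. borel))
       (\<lambda>i \<omega>. \<lambda>t\<in>{0..}. K t \<omega> $ i) UNIV"

definition kac_radius :: "real \<Rightarrow> real \<Rightarrow> real \<Rightarrow> real" where
  "kac_radius c t y = sqrt (c\<^sup>2 * t\<^sup>2 - y\<^sup>2)"

text \<open>The function \<open>g\<close> supplies the arbitrary values outside the closed light cone.\<close>

definition kac_velocity ::
    "real \<Rightarrow> real \<Rightarrow> (real \<Rightarrow> real \<Rightarrow> real) \<Rightarrow> real \<Rightarrow> real \<Rightarrow> real \<Rightarrow> real" where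
  "kac_velocity a c g x0 t x =
     (if x \<in> {x0 - c * t <..< x0 + c * t} then
        (let r = kac_radius c t (x - x0); \<beta> = a / c in
          (x - x0) * inverse (t + r / c * (bessel_I0 (\<beta> * r) / deriv bessel_I0 (\<beta> * r))))
      else if x = x0 + c * t then c
      else if x = x0 - c * t then - c
      else g t x)"

definition kac_velocity_field ::
    "real \<Rightarrow> real \<Rightarrow> ('d \<Rightarrow> real \<Rightarrow> real \<Rightarrow> real) \<Rightarrow> real ^ 'd \<Rightarrow> real \<Rightarrow> real ^ 'd \<Rightarrow> real ^ 'd" where
  "kac_velocity_field a c g x0 t x = (\<chi> i. kac_velocity a c (g i) (x0 $ i) t (x $ i))"

primrec Ck :: "nat \<Rightarrow> ('a::real_normed_vector \<Rightarrow> 'b::real_normed_vector) \<Rightarrow> bool" where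
  "Ck 0 f \<longleftrightarrow> continuous_on UNIV f"
| "Ck (Suc k) f \<longleftrightarrow> (\<forall>x. f differentiable (at x)) \<and>
     (\<forall>h. Ck k (\<lambda>x. frechet_derivative f (at x) h))"

text \<open>Functions in \<open>C\<^sub>c\<^sup>\<infinity>(\<Omega>)\<close>, for open \<open>\<Omega>\<close>, are identified with their extensions by zero.\<close>

definition test_function :: "'a::real_normed_vector set \<Rightarrow> ('a \<Rightarrow> real) \<Rightarrow> bool" where
  "test_function \<Omega> \<psi> \<longleftrightarrow> (\<forall>k. Ck k \<psi>) \<and>
     compact (closure {p. \<psi> p \<noteq> 0}) \<and> closure {p. \<psi> p \<noteq> 0} \<subseteq> \<Omega>"

definition grad_x :: "(real \<times> (real ^ 'd) \<Rightarrow> real) \<Rightarrow> real \<Rightarrow> real ^ 'd \<Rightarrow> real ^ 'd" where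
  "grad_x \<psi> t x = (\<chi> i. frechet_derivative (\<lambda>y. \<psi> (t, y)) (at x) (axis i 1))"

text \<open>The continuity equation on \<open>(0,\<infinity>) \<times> \<real>\<^sup>d\<close> in the sense of distributions. Integrability is
  demanded explicitly, since the Bochner integral of a non-integrable function is 0 by convention.\<close>

definition continuity_equation ::
    "(real \<Rightarrow> (real ^ 'd) measure) \<Rightarrow> (real \<Rightarrow> real ^ 'd \<Rightarrow> real ^ 'd) \<Rightarrow> bool" where
  "continuity_equation \<mu> v \<longleftrightarrow>
     (\<forall>\<psi>. test_function ({0<..} \<times> UNIV) \<psi> \<longrightarrow>
       (let h = (\<lambda>t x. deriv (\<lambda>s. \<psi> (s, x)) t + v t x \<bullet> grad_x \<psi> t x) in
         (AE t in lborel. 0 < t \<longrightarrow> integrable (\<mu> t) (h t)) \<and>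
         set_integrable lborel {0<..} (\<lambda>t. \<integral>x. h t x \<partial>\<mu> t) \<and>
         (LBINT t:{0<..}. (\<integral>x. h t x \<partial>\<mu> t)) = 0))"

text \<open>\<open>cond_exp_given M S Z Y z\<close> is \<open>E[Y | Z = z]\<close>: a measurable \<open>g\<close> with \<open>g(Z) = E[Y | \<sigma>(Z)]\<close>
  almost surely. Such a \<open>g\<close> is unique up to null sets of the law of \<open>Z\<close>, so only statements for
  almost every \<open>z\<close> are meaningful.\<close>

definition cond_exp_given ::
    "'w measure \<Rightarrow> 'b measure \<Rightarrow> ('w \<Rightarrow> 'b) \<Rightarrow> ('w \<Rightarrow> real) \<Rightarrow> 'b \<Rightarrow> real" where
  "cond_exp_given M S Z Y = (SOME g. g \<in> borel_measurable S \<and>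
     (AE \<omega> in M. g (Z \<omega>) = real_cond_exp M (vimage_algebra (space M) Z S) Y \<omega>))"

end

theory Submission imports Defs begin

text \<open>Let \<open>T\<close> be the time up to \<open>t\<close> during which the Poisson path is even, so that
  \<open>K(t) = B c (2T - t)\<close> and \<open>K'(t) = B c (-1)^N(t)\<close>. The independence of increments turns
  \<open>E[T^i; N(t) = n]\<close> into an iterated beta integral; its closed form shows that on \<open>N(t) = n \<ge> 1\<close>
  the ratio \<open>T/t\<close> is beta distributed. Summing over even and over odd \<open>n\<close> produces
  the Bessel series. Since \<open>B\<close> is symmetric, \<open>E[K'(t) | K(t)] = v\<^sub>t(K(t))\<close> reduces, after the
  reflection \<open>u \<mapsto> t - u\<close>, to a pointwise identity between the two densities.
  The continuity equation follows by taking expectations in the fundamental theorem of calculus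
  along the paths and replacing \<open>K'\<close> by its conditional expectation, componentwise.\<close>

section \<open>Bessel series and beta integrals\<close>

text \<open>Arrival times and conditional laws of a Poisson process never appear: independent
  increments give only finite-dimensional information, and since the occupation time lies in [0,t],
  its moments on each event N(t) = n already determine its law there. The square root in the
  statement disappears in terms of the occupation time: at y = c (2u - t) one has (\<beta> r / 2)^2
  = a^2 u (t - u), which is the argument of both series below. Only the event N(t) = 0 carries no
  density. There the path sits on the edge of the light cone and moves outward, so the prescribed
  edge values c and -c make its contribution to the identity vanish. For several components the
  obstacle is that independence is assumed for the paths of K, while the velocity is expressed
  through the pairs (N, B) behind them. The velocity is therefore recovered from the path as a right
  derivative along a sequence, a measurable functional of the path, before independence is
  applied.\<close>

definition bessel_J :: "real \<Rightarrow> real" where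
  "bessel_J z = (\<Sum>k. z ^ k / (fact k)\<^sup>2)"

text \<open>Modified Bessel functions in the variable \<open>z = (x/2)^2\<close>:
  \<open>bessel_J z\<close> is \<open>I_0(x)\<close>, and \<open>bessel_G z\<close>, its derivative
  in \<open>z\<close>, is \<open>2 I_1(x) / x\<close>. Both are positive at
  \<open>z = 0\<close>.\<close>

definition bessel_G :: "real \<Rightarrow> real" where
  "bessel_G z = (\<Sum>k. z ^ k / (fact k * fact (Suc k)))"

lemma summable_bessel_J: "summable (\<lambda>k. (z::real) ^ k / (fact k)\<^sup>2)"
proof (rule summable_comparison_test')
  show "summable (\<lambda>k. \<bar>z\<bar> ^ k / fact k)"
    using summable_exp[of "\<bar>z\<bar>"] by (simp add: field_simps)
  show "norm (z ^ k / (fact k)\<^sup>2) \<le> \<bar>z\<bar> ^ k / fact k" if "k \<ge> 0" for k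
  proof -
    have "(1::real) \<le> fact k" by (simp add: fact_ge_1)
    then have "(fact k :: real) \<le> (fact k)\<^sup>2"
      by (simp add: power2_eq_square)
    then show ?thesis
      by (simp add: abs_mult power_abs abs_divide frac_le)
  qed
qed

lemma DERIV_bessel_J: "(bessel_J has_real_derivative bessel_G z) (at z)"
proof -
  have "((\<lambda>x. \<Sum>k. inverse ((fact k)\<^sup>2) * x ^ k) has_field_derivative
      (\<Sum>k. diffs (\<lambda>k. inverse ((fact k)\<^sup>2)) k * z ^ k)) (at z)"
    by (rule termdiffs_strong_converges_everywhere)
      (use summable_bessel_J in \<open>simp add: field_simps\<close>)
  moreover have "diffs (\<lambda>k. inverse ((fact k)\<^sup>2)) k = inverse (fact k * fact (Suc k) :: real)" for k
    by (simp add: diffs_def power2_eq_square divide_simps del: of_nat_Suc)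
  ultimately show ?thesis
    unfolding bessel_J_def[abs_def] bessel_G_def[abs_def] by (simp add: field_simps)
qed

lemma summable_bessel_G: "summable (\<lambda>k. (z::real) ^ k / (fact k * fact (Suc k)))"
proof (rule summable_comparison_test')
  show "summable (\<lambda>k. \<bar>z\<bar> ^ k / fact k)"
    using summable_exp[of "\<bar>z\<bar>"] by (simp add: field_simps)
  show "norm (z ^ k / (fact k * fact (Suc k))) \<le> \<bar>z\<bar> ^ k / fact k" if "k \<ge> 0" for k
  proof -
    have "(1::real) \<le> fact (Suc k)" by (rule fact_ge_1)
    then have "(fact k :: real) \<le> fact k * fact (Suc k)"
      by simp
    then show ?thesis
      by (simp add: abs_mult power_abs abs_divide frac_le del: fact_Suc)
  qed
qed

lemma bessel_J_pos: "z \<ge> 0 \<Longrightarrow> bessel_J z > 0"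
  unfolding bessel_J_def
  by (rule suminf_pos2[OF summable_bessel_J, where i = 0]) auto

lemma bessel_G_pos: "z \<ge> 0 \<Longrightarrow> bessel_G z > 0"
  unfolding bessel_G_def
  by (rule suminf_pos2[OF summable_bessel_G, where i = 0]) auto

lemma borel_measurable_bessel_J [measurable]: "bessel_J \<in> borel_measurable borel"
  unfolding bessel_J_def[abs_def] by measurable

lemma borel_measurable_bessel_G [measurable]: "bessel_G \<in> borel_measurable borel"
  unfolding bessel_G_def[abs_def] by measurable

lemma bessel_I0_eq: "bessel_I0 x = bessel_J ((x / 2)\<^sup>2)"
  unfolding bessel_I0_def bessel_J_def by (simp add: power_mult)

lemma deriv_bessel_I0: "deriv bessel_I0 x = x / 2 * bessel_G ((x / 2)\<^sup>2)"
proof -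
  have "((\<lambda>x. bessel_J ((x / 2)\<^sup>2)) has_real_derivative bessel_G ((x / 2)\<^sup>2) * (x / 2)) (at x)"
    by (rule DERIV_chain2[OF DERIV_bessel_J]) (auto intro!: derivative_eq_intros simp: power2_eq_square)
  then show ?thesis
    by (intro DERIV_imp_deriv) (simp add: bessel_I0_eq[abs_def] mult.commute)
qed

text \<open>The beta function at integer arguments, scaled to [0,t]. Integration by parts trades one
  power of \<open>t - s\<close> for one power of \<open>s\<close>; since this raises
  \<open>m\<close>, the induction on \<open>n\<close> keeps \<open>m\<close> arbitrary. The boundary
  terms vanish because both exponents are successors.\<close>

lemma has_integral_beta:
  fixes t :: real
  assumes "t \<ge> 0"
  shows "((\<lambda>s. s ^ m * (t - s) ^ n) has_integral (fact m * fact n / fact (m + n + 1) * t ^ (m + n + 1))) {0..t}"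
proof (induction n arbitrary: m)
  case 0
  have "((\<lambda>s. s ^ Suc m / (real m + 1)) has_real_derivative x ^ m) (at x within {0..t})" for x
    by (auto intro!: derivative_eq_intros simp del: power_Suc simp: add.commute)
  then have "((\<lambda>s. s ^ m) has_integral (t ^ Suc m / (real m+1) - 0 ^ Suc m / (real m+1))) {0..t}"
    by (intro fundamental_theorem_of_calculus)
       (use assms in \<open>auto simp: has_real_derivative_iff_has_vector_derivative[symmetric] simp del: power_Suc\<close>)
  moreover have "t ^ Suc m / (real m+1) - 0 ^ Suc m / (real m+1) = fact m * fact 0 / fact (m + 0 + 1) * t ^ (m + 0 + 1)"
    by (simp add: divide_simps)
  ultimately show ?case by (simp add: add.commute)
next
  case (Suc n)
  have "((\<lambda>s. s ^ Suc m * (t - s) ^ Suc n) has_real_derivative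
      (real m + 1) * x ^ m * (t - x) ^ Suc n - (real n + 1) * x ^ Suc m * (t - x) ^ n) (at x within {0..t})" for x
    by (rule derivative_eq_intros refl | simp del: power_Suc add: algebra_simps)+
  then have "((\<lambda>s. (real m+1) * s ^ m * (t - s) ^ Suc n - (real n+1) * s ^ Suc m * (t-s)^n) has_integral
     (t ^ Suc m * (t-t)^Suc n - 0 ^ Suc m * (t-0)^Suc n)) {0..t}"
    by (intro fundamental_theorem_of_calculus)
       (use assms in \<open>auto simp: has_real_derivative_iff_has_vector_derivative[symmetric] simp del: power_Suc\<close>)
  from has_integral_add[OF this has_integral_mult_right[OF Suc.IH[of "Suc m"], of "real n + 1"]]
  have "((\<lambda>s. (real m+1) * (s ^ m * (t - s) ^ Suc n)) has_integral
     ((real n+1) * (fact (Suc m) * fact n / fact (Suc m + n + 1) * t ^ (Suc m + n + 1)))) {0..t}"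
    by (simp add: algebra_simps)
  from has_integral_mult_right[OF this, of "1 / (real m + 1)"]
  have "((\<lambda>s. (s ^ m * (t - s) ^ Suc n)) has_integral
     (1 / (real m + 1) * ((real n+1) * (fact (Suc m) * fact n / fact (Suc m + n + 1) * t ^ (Suc m + n + 1))))) {0..t}"
    using of_nat_0_less_iff[of "Suc m", where 'a = real]
    by (auto elim!: has_integral_eq[rotated] simp del: power_Suc fact_Suc)
  also have "1 / (real m + 1) * ((real n+1) * (fact (Suc m) * fact n / fact (Suc m + n + 1) * t ^ (Suc m + n + 1)))
     = fact m * fact (Suc n) / fact (m + Suc n + 1) * t ^ (m + Suc n + 1)"
    using of_nat_0_less_iff[of "Suc m", where 'a = real]
    by (simp add: divide_simps add.commute del: power_Suc)
  finally show ?case .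
qed

text \<open>The hockey-stick identity for rising factorials. With \<open>l\<close> half of an even
  count, it performs the step from the moment of order \<open>j\<close> to that of order
  \<open>Suc j\<close>.\<close>

lemma sum_pochhammer:
  "(\<Sum>l\<le>k. real (Suc j) * pochhammer (real l + 1) j) = pochhammer (real k + 1) (Suc j)"
proof (induction k)
  case 0
  show ?case by (simp add: pochhammer_fact[symmetric])
next
  case (Suc k)
  have "pochhammer (real (Suc k) + 1) (Suc j) =
      real (Suc j) * pochhammer (real (Suc k) + 1) j + (real k + 1) * pochhammer (real (Suc k) + 1) j"
    by (simp add: pochhammer_rec' algebra_simps)
  also have "(real k + 1) * pochhammer (real (Suc k) + 1) j = pochhammer (real k + 1) (Suc j)"
    by (simp add: pochhammer_rec add.commute)
  finally show ?case using Suc by simp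
qed

section \<open>Counting paths\<close>

definition even_time :: "(real \<Rightarrow> nat) \<Rightarrow> real \<Rightarrow> real" where
  "even_time p t = integral {0..t} (\<lambda>s. of_bool (even (p s)))"

locale counting_path =
  fixes p :: "real \<Rightarrow> nat"
  assumes mono: "mono_on {0..} p"
    and right_cont: "t \<ge> 0 \<Longrightarrow> continuous (at_right t) p"
begin

text \<open>Encoded as failure of local constancy. Time 0 is left out because nothing is known about
  \<open>p\<close> at negative times.\<close>

definition jumps :: "real set" where
  "jumps = {t. t > 0 \<and> \<not> (\<exists>\<delta>>0. \<forall>s. \<bar>s - t\<bar> < \<delta> \<longrightarrow> p s = p t)}"

lemma monoD: "0 \<le> s \<Longrightarrow> s \<le> t \<Longrightarrow> p s \<le> p t"
  using mono by (auto simp: mono_on_def)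

lemma right_const:
  assumes "t \<ge> 0"
  obtains \<delta> where "\<delta> > 0" "\<And>s. t \<le> s \<Longrightarrow> s < t + \<delta> \<Longrightarrow> p s = p t"
proof -
  have "(p \<longlongrightarrow> p t) (at_right t)"
    using right_cont[OF assms] by (simp add: continuous_within)
  then have "eventually (\<lambda>s. p s = p t) (at_right t)"
    by (simp add: tendsto_discrete)
  then obtain b where "b > t" "\<And>s. t < s \<Longrightarrow> s < b \<Longrightarrow> p s = p t"
    unfolding eventually_at_right_field by auto
  then show ?thesis
    using that[of "b - t"] by (force simp: order_le_less)
qed

text \<open>Before \<open>t\<close> a nondecreasing path takes only finitely many values, all at
  most \<open>p t\<close>; from a point where the largest is attained it cannot change any more
  until \<open>t\<close>.\<close>

lemma left_const:
  assumes "t > 0"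
  obtains \<delta> q where "\<delta> > 0" "\<delta> \<le> t" "\<And>s. t - \<delta> < s \<Longrightarrow> s < t \<Longrightarrow> p s = q"
proof -
  have fin: "finite (p ` {0..<t})"
    by (rule finite_subset[of _ "{..p t}"]) (auto intro: monoD)
  have ne: "p ` {0..<t} \<noteq> {}" using assms by auto
  obtain s0 where s0: "0 \<le> s0" "s0 < t" "p s0 = Max (p ` {0..<t})"
    using Max_in[OF fin ne] by (auto simp: image_iff)
  show ?thesis
  proof (rule that[of "t - s0"])
    fix s assume s: "t - (t - s0) < s" "s < t"
    then have "p s \<le> p s0" using s0 fin by (auto intro!: Max_ge)
    moreover have "p s0 \<le> p s" using s s0 by (intro monoD) auto
    ultimately show "p s = p s0" by simp
  qed (use s0 in auto)
qed

text \<open>Distinct jump times have distinct values: if \<open>p s = p u\<close> with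
  \<open>s < u\<close>, the path is constant from \<open>s\<close> to \<open>u\<close> and, by
  right-continuity, a little beyond, so \<open>u\<close> is no jump. Hence \<open>p\<close> injects
  the jumps up to \<open>t\<close> into the numbers up to \<open>p t\<close>.\<close>

lemma finite_jumps: "finite (jumps \<inter> {..t})"
proof -
  have strict: "p s < p u" if "s < u" "s \<in> jumps" "u \<in> jumps" for s u
  proof (rule ccontr)
    assume "\<not> p s < p u"
    have su: "0 < s" "0 < u" using that by (auto simp: jumps_def)
    then have eq: "p s = p u" using monoD[of s u] that \<open>\<not> p s < p u\<close> by auto
    obtain d where d: "d > 0" "\<And>v. u \<le> v \<Longrightarrow> v < u + d \<Longrightarrow> p v = p u"
      using right_const[of u] su by auto
    have *: "p v = p u" if "\<bar>v - u\<bar> < min d (u - s)" for v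
    proof (cases "v \<ge> u")
      case True then show ?thesis using that by (intro d(2)) auto
    next
      case False
      then have "p v \<le> p u" "p s \<le> p v" using monoD[of v u] monoD[of s v] that su by auto
      then show ?thesis using eq by simp
    qed
    have "min d (u - s) > 0" using d(1) \<open>s < u\<close> by simp
    with * have "\<exists>\<delta>>0. \<forall>v. \<bar>v - u\<bar> < \<delta> \<longrightarrow> p v = p u"
      by blast
    then show False using \<open>u \<in> jumps\<close> by (auto simp: jumps_def)
  qed
  have "inj_on p (jumps \<inter> {..t})"
  proof (rule linorder_inj_onI)
    fix s u assume "s < u" "s \<in> jumps \<inter> {..t}" "u \<in> jumps \<inter> {..t}"
    then have "p s < p u" by (intro strict) auto
    then show "p s \<noteq> p u" by simp
  qed linarith
  moreover have "p ` (jumps \<inter> {..t}) \<subseteq> {..p t}"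
    by (auto simp: jumps_def intro!: monoD)
  ultimately show ?thesis
    using finite_imageD[of p "jumps \<inter> {..t}"] finite_subset[of _ "{..p t}"] by simp
qed

text \<open>Clamping the time at 0 makes the path monotone on the whole line, hence Borel.\<close>

lemma measurable_path: "(\<lambda>s. p (max 0 s)) \<in> borel \<rightarrow>\<^sub>M count_space UNIV"
proof -
  have "(\<lambda>s. real (p (max 0 s))) \<in> borel_measurable borel"
    by (rule borel_measurable_mono) (auto simp: mono_def intro!: monoD)
  then have "(\<lambda>s. nat \<lfloor>real (p (max 0 s))\<rfloor>) \<in> borel \<rightarrow>\<^sub>M count_space UNIV"
    by measurable
  then show ?thesis by simp
qed

lemma set_integrable_path:
  fixes f :: "nat \<Rightarrow> real"
  assumes "\<And>n. \<bar>f n\<bar> \<le> C" "0 \<le> a"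
  shows "set_integrable lborel {a..b} (\<lambda>s. f (p s))"
proof -
  have "set_integrable lborel {a..b} (\<lambda>s. f (p (max 0 s)))"
    unfolding set_integrable_def
  proof (rule integrableI_bounded_set[where A = "{a..b}" and B = C])
    show "(\<lambda>x. indicat_real {a..b} x *\<^sub>R f (p (max 0 x))) \<in> borel_measurable lborel"
      using measurable_path by measurable
    show "emeasure lborel {a..b} < \<infinity>" by (cases "a \<le> b") auto
  qed (use assms in \<open>auto simp: indicator_def\<close>)
  also have "?this \<longleftrightarrow> ?thesis"
    by (rule set_integrable_cong) (use assms in auto)
  finally show ?thesis .
qed

lemma integrable_path:
  fixes f :: "nat \<Rightarrow> real"
  assumes "\<And>n. \<bar>f n\<bar> \<le> C" "0 \<le> a"
  shows "(\<lambda>s. f (p s)) integrable_on {a..b}"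
  using set_borel_integral_eq_integral(1)[OF set_integrable_path[where f = f, OF assms]] by simp

lemma integrable_even: "0 \<le> a \<Longrightarrow> (\<lambda>s. of_bool (even (p s)) :: real) integrable_on {a..b}"
  by (rule integrable_path[where C = 1]) auto

lemma integral_alternating:
  assumes "t \<ge> 0"
  shows "integral {0..t} (\<lambda>s. (- 1) ^ p s :: real) = 2 * even_time p t - t"
proof -
  have "integral {0..t} (\<lambda>s. (- 1) ^ p s :: real) = integral {0..t} (\<lambda>s. 2 * of_bool (even (p s)) - 1)"
    by (rule integral_cong) (auto simp: uminus_power_if)
  also have "\<dots> = 2 * even_time p t - t"
    using assms by (subst integral_diff)
      (auto simp: even_time_def intro!: integrable_on_mult_right integrable_even)
  finally show ?thesis .
qed

lemma even_time_diff:
  assumes "0 \<le> s" "s \<le> t"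
  shows "even_time p t - even_time p s = integral {s..t} (\<lambda>s. of_bool (even (p s)))"
  unfolding even_time_def
  using Henstock_Kurzweil_Integration.integral_combine[OF assms integrable_even] by simp

text \<open>Constancy is asked for on the open interval only, so that the lemma also applies just
  before a jump, where \<open>p t\<close> differs from the value on the left.\<close>

lemma even_time_diff_const:
  assumes "0 \<le> s" "s \<le> t" "\<And>u. s < u \<Longrightarrow> u < t \<Longrightarrow> p u = q"
  shows "even_time p t - even_time p s = (t - s) * of_bool (even q)"
proof -
  have "integral {s..t} (\<lambda>u. of_bool (even (p u)) :: real) = integral {s..t} (\<lambda>_. of_bool (even q))"
    by (rule integral_spike[where S = "{s,t}"]) (use assms in auto)
  then show ?thesis using even_time_diff[OF assms(1,2)] assms(2) by simp
qed

lemma even_time_0 [simp]: "even_time p 0 = 0"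
  by (simp add: even_time_def)

lemma even_time_diff_bounds:
  assumes "0 \<le> s" "s \<le> t"
  shows "0 \<le> even_time p t - even_time p s" "even_time p t - even_time p s \<le> t - s"
proof -
  show "0 \<le> even_time p t - even_time p s"
    unfolding even_time_diff[OF assms] using assms by (intro integral_nonneg integrable_even) auto
  have "even_time p t - even_time p s \<le> integral {s..t} (\<lambda>_. 1)"
    unfolding even_time_diff[OF assms] using assms by (intro integral_le integrable_even) auto
  then show "even_time p t - even_time p s \<le> t - s" using assms by simp
qed

lemma even_time_bounds:
  assumes "0 \<le> t"
  shows "0 \<le> even_time p t" "even_time p t \<le> t"
  using even_time_diff_bounds[of 0 t] assms by auto

lemma even_time_continuous: "continuous_on {0..t} (even_time p)"
  unfolding even_time_def[abs_def] by (rule indefinite_integral_continuous_1[OF integrable_even]) simp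

lemma even_time_deriv_right:
  assumes "0 \<le> t"
  shows "(even_time p has_real_derivative of_bool (even (p t))) (at_right t)"
proof -
  obtain d where d: "d > 0" "\<And>s. t \<le> s \<Longrightarrow> s < t + d \<Longrightarrow> p s = p t"
    using right_const[OF assms] by blast
  have "eventually (\<lambda>s. (even_time p s - even_time p t) / (s - t) = of_bool (even (p t))) (at_right t)"
    unfolding eventually_at_right_field
  proof (intro exI[of _ "t + d"] conjI allI impI)
    fix s assume s: "t < s" "s < t + d"
    then have "even_time p s - even_time p t = (s - t) * of_bool (even (p t))"
      using assms by (intro even_time_diff_const d(2)) auto
    then show "(even_time p s - even_time p t) / (s - t) = of_bool (even (p t))"
      using s by (simp add: field_simps)
  qed (use d in auto)
  then show ?thesis
    unfolding has_field_derivative_iff by (rule tendsto_eventually)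
qed

text \<open>The left limit \<open>q\<close> is exposed even at jump times: measurability of
  \<open>deriv\<close> will need left derivatives on every path, not just on almost every
  one.\<close>

lemma even_time_deriv_left:
  assumes "0 < t"
  obtains q where "(even_time p has_real_derivative of_bool (even q)) (at_left t)"
    and "t \<notin> jumps \<Longrightarrow> q = p t"
proof -
  obtain d q where d: "d > 0" "d \<le> t" "\<And>s. t - d < s \<Longrightarrow> s < t \<Longrightarrow> p s = q"
    using left_const[OF assms] by blast
  have "eventually (\<lambda>s. (even_time p s - even_time p t) / (s - t) = of_bool (even q)) (at_left t)"
    unfolding eventually_at_left_field
  proof (intro exI[of _ "t - d"] conjI allI impI)
    fix s assume s: "s < t" "t - d < s"
    then have "even_time p t - even_time p s = (t - s) * of_bool (even q)"
      using assms d(1,2) by (intro even_time_diff_const d(3)) auto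
    then show "(even_time p s - even_time p t) / (s - t) = of_bool (even q)"
      using s by (simp add: field_simps)
  qed (use d in auto)
  then have "(even_time p has_real_derivative of_bool (even q)) (at_left t)"
    unfolding has_field_derivative_iff by (rule tendsto_eventually)
  moreover have "q = p t" if nj: "t \<notin> jumps"
  proof -
    from nj assms obtain e where e: "e > 0" "\<And>s. \<bar>s - t\<bar> < e \<Longrightarrow> p s = p t"
      by (auto simp: jumps_def)
    let ?s = "t - min d e / 2"
    have "p ?s = q" using d(1,2) e(1) by (intro d(3)) (auto simp: min_def field_simps)
    moreover have "p ?s = p t" using d(1,2) e(1) by (intro e(2)) (auto simp: min_def field_simps)
    ultimately show ?thesis by simp
  qed
  ultimately show ?thesis using that by blast
qed

lemma even_time_deriv:
  assumes "0 < t" "t \<notin> jumps"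
  shows "(even_time p has_real_derivative of_bool (even (p t))) (at t)"
proof -
  obtain q where "(even_time p has_real_derivative of_bool (even q)) (at_left t)" "q = p t"
    using even_time_deriv_left[OF assms(1)] assms(2) by blast
  then show ?thesis
    using even_time_deriv_right[of t] assms
    by (auto simp: has_field_derivative_iff filterlim_at_split)
qed

text \<open>The occupation time is continuous, and off the finitely many jumps its derivative is the
  parity indicator, so the fundamental theorem of calculus applies to its powers.\<close>

lemma even_time_power:
  assumes "0 \<le> t"
  shows "((\<lambda>s. real (Suc i) * even_time p s ^ i * of_bool (even (p s))) has_integral even_time p t ^ Suc i) {0..t}"
proof -
  have "((\<lambda>s. real (Suc i) * even_time p s ^ i * of_bool (even (p s))) has_integral
     even_time p t ^ Suc i - even_time p 0 ^ Suc i) {0..t}"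
  proof (rule fundamental_theorem_of_calculus_interior_strong[OF finite_jumps[of t] assms])
    fix x assume x: "x \<in> {0<..<t} - jumps \<inter> {..t}"
    then have "(even_time p has_real_derivative of_bool (even (p x))) (at x)"
      by (intro even_time_deriv) auto
    from DERIV_power[OF this, of "Suc i"]
    show "((\<lambda>s. even_time p s ^ Suc i) has_vector_derivative
        real (Suc i) * even_time p x ^ i * of_bool (even (p x))) (at x)"
      by (simp add: has_real_derivative_iff_has_vector_derivative[symmetric] mult_ac del: power_Suc of_nat_Suc)
  next
    show "continuous_on {0..t} (\<lambda>s. even_time p s ^ Suc i)"
      by (intro continuous_intros even_time_continuous)
  qed
  then show ?thesis by simp
qed

end

section \<open>Measurability of the occupation time\<close>

text \<open>Right-continuity yields joint measurability: the grid time \<open>u n t\<close> of mesh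
  \<open>1 / (n + 1)\<close> lies strictly after \<open>max 0 t\<close> and tends to it, so the
  sampled value is eventually the exact one. The clamp avoids negative times, at which
  \<open>N\<close> is unconstrained.\<close>

lemma measurable_counting_paths:
  assumes N: "\<And>t. t \<ge> 0 \<Longrightarrow> N t \<in> M \<rightarrow>\<^sub>M count_space UNIV"
    and path: "\<And>\<omega>. \<omega> \<in> space M \<Longrightarrow> counting_path (\<lambda>t. N t \<omega>)"
  shows "(\<lambda>(t, \<omega>). N (max 0 t) \<omega>) \<in> borel \<Otimes>\<^sub>M M \<rightarrow>\<^sub>M count_space UNIV"
proof -
  define g where "g n t = nat \<lfloor>max 0 t * real (Suc n)\<rfloor>" for n and t :: real
  define u where "u n t = real (Suc (g n t)) / real (Suc n)" for n and t :: real
  have u_bounds: "max 0 t < u n t" "u n t \<le> max 0 t + 1 / real (Suc n)" for n t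
  proof -
    have "0 \<le> \<lfloor>max 0 t * real (Suc n)\<rfloor>" by simp
    then have "real (g n t) = of_int \<lfloor>max 0 t * real (Suc n)\<rfloor>" by (simp add: g_def)
    then have "real (g n t) \<le> max 0 t * real (Suc n)" "max 0 t * real (Suc n) < real (g n t) + 1"
      by linarith+
    have "m < (G + 1) / k \<and> (G + 1) / k \<le> m + 1 / k" if "G \<le> m * k" "m * k < G + 1" "k > 0" for G m k :: real
      using that by (auto simp: field_simps)
    note * = this[of "real (g n t)" "max 0 t" "real (Suc n)"]
    have "max 0 t < u n t \<and> u n t \<le> max 0 t + 1 / real (Suc n)"
      unfolding u_def of_nat_Suc[of "g n t"] add.commute[of 1 "real (g n t)"]
      using \<open>real (g n t) \<le> _\<close> \<open>_ < real (g n t) + 1\<close> by (intro *) auto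
    then show "max 0 t < u n t" "u n t \<le> max 0 t + 1 / real (Suc n)"
      by auto
  qed
  have [measurable]: "g n \<in> borel \<rightarrow>\<^sub>M count_space UNIV" for n
    unfolding g_def by measurable
  have "(\<lambda>(t, \<omega>). real (N (max 0 t) \<omega>)) \<in> borel_measurable (borel \<Otimes>\<^sub>M M)"
  proof (rule borel_measurable_LIMSEQ_real)
    fix x assume "x \<in> space (borel \<Otimes>\<^sub>M M :: (real \<times> _) measure)"
    then obtain t \<omega> where x: "x = (t, \<omega>)" "\<omega> \<in> space M" by (auto simp: space_pair_measure)
    interpret counting_path "\<lambda>t. N t \<omega>" using path x by auto
    obtain d where d: "d > 0" "\<And>s. max 0 t \<le> s \<Longrightarrow> s < max 0 t + d \<Longrightarrow> N s \<omega> = N (max 0 t) \<omega>"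
      using right_const[of "max 0 t"] by auto
    obtain n0 where n0: "1 / real (Suc n0) < d"
      using d(1) nat_approx_posE by blast
    have "eventually (\<lambda>n. N (u n t) \<omega> = N (max 0 t) \<omega>) sequentially"
      using eventually_ge_at_top[of n0]
    proof eventually_elim
      case (elim n)
      have "1 / real (Suc n) \<le> 1 / real (Suc n0)" using elim by (intro divide_left_mono) auto
      then show ?case using u_bounds[where t = t and n = n] n0 by (intro d(2)) auto
    qed
    then show "(\<lambda>n. case x of (t, \<omega>) \<Rightarrow> real (N (u n t) \<omega>))
        \<longlonglongrightarrow> (case x of (t, \<omega>) \<Rightarrow> real (N (max 0 t) \<omega>))"
      unfolding x by (auto intro!: tendsto_eventually elim!: eventually_mono)
  next
    fix n
    have "(\<lambda>x. N (real (Suc (g n (fst x))) / real (Suc n)) (snd x)) \<in> borel \<Otimes>\<^sub>M M \<rightarrow>\<^sub>M count_space UNIV"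
    proof (rule measurable_compose_countable'[where I = UNIV and g = "\<lambda>x. g n (fst x)"])
      fix i show "(\<lambda>x. N (real (Suc i) / real (Suc n)) (snd x)) \<in> borel \<Otimes>\<^sub>M M \<rightarrow>\<^sub>M count_space UNIV"
        by (rule measurable_compose[OF measurable_snd N]) simp
    qed auto
    then have "(\<lambda>x. real (N (u n (fst x)) (snd x))) \<in> borel_measurable (borel \<Otimes>\<^sub>M M)"
      unfolding u_def by (rule measurable_compose) simp
    then show "(\<lambda>(t, \<omega>). real (N (u n t) \<omega>)) \<in> borel_measurable (borel \<Otimes>\<^sub>M M)"
      by (simp add: case_prod_beta')
  qed
  then have "(\<lambda>x. nat \<lfloor>case x of (t, \<omega>) \<Rightarrow> real (N (max 0 t) \<omega>)\<rfloor>) \<in> borel \<Otimes>\<^sub>M M \<rightarrow>\<^sub>M count_space UNIV"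
    by measurable
  then show ?thesis by (simp add: case_prod_beta')
qed

lemma measurable_even_time_pair:
  assumes N: "\<And>t. t \<ge> 0 \<Longrightarrow> N t \<in> M \<rightarrow>\<^sub>M count_space UNIV"
    and path: "\<And>\<omega>. \<omega> \<in> space M \<Longrightarrow> counting_path (\<lambda>t. N t \<omega>)"
  shows "(\<lambda>(t, \<omega>). even_time (\<lambda>s. N s \<omega>) (max 0 t)) \<in> borel_measurable (borel \<Otimes>\<^sub>M M)"
proof -
  note [measurable] = measurable_counting_paths[OF N path]
  have "(\<lambda>(s, \<omega>). of_bool (even (N (max 0 s) \<omega>)) :: real) \<in> borel_measurable (borel \<Otimes>\<^sub>M M)"
    using measurable_compose[OF measurable_counting_paths[OF N path], of "\<lambda>n. of_bool (even n) :: real" borel]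
    by (simp add: case_prod_beta')
  then have "(\<lambda>x. of_bool (even (N (max 0 (fst x)) (snd x))) :: real) \<in> borel_measurable (borel \<Otimes>\<^sub>M M)"
    by (simp add: case_prod_beta')
  moreover have "(\<lambda>(x, s). (s, snd x)) \<in> (borel \<Otimes>\<^sub>M M) \<Otimes>\<^sub>M lborel \<rightarrow>\<^sub>M borel \<Otimes>\<^sub>M M"
    by measurable
  ultimately have "(\<lambda>(x, s). of_bool (even (N (max 0 s) (snd x))) :: real) \<in> borel_measurable ((borel \<Otimes>\<^sub>M M) \<Otimes>\<^sub>M lborel)"
    using measurable_compose[of "\<lambda>(x, s). (s, snd x)"] by (fastforce simp: case_prod_beta')
  moreover have "(\<lambda>(x, s :: real). indicator {0..max 0 (fst x)} s :: real)
      \<in> borel_measurable ((borel \<Otimes>\<^sub>M M) \<Otimes>\<^sub>M lborel)"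
    unfolding case_prod_beta' indicator_def atLeastAtMost_iff by measurable
  ultimately have "(\<lambda>(x, s). indicator {0..max 0 (fst x)} s * of_bool (even (N (max 0 s) (snd x))) :: real)
      \<in> borel_measurable ((borel \<Otimes>\<^sub>M M) \<Otimes>\<^sub>M lborel)"
    unfolding case_prod_beta' by (intro borel_measurable_times)
  then have "(\<lambda>x. LBINT s. indicator {0..max 0 (fst x)} s * of_bool (even (N (max 0 s) (snd x))) :: real)
      \<in> borel_measurable (borel \<Otimes>\<^sub>M M)"
    by (rule lborel.borel_measurable_lebesgue_integral)
  also have "?this \<longleftrightarrow> ?thesis"
  proof (rule measurable_cong)
    fix x assume "x \<in> space (borel \<Otimes>\<^sub>M M :: (real \<times> _) measure)"
    then obtain t \<omega> where x: "x = (t, \<omega>)" "\<omega> \<in> space M" by (auto simp: space_pair_measure)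
    interpret counting_path "\<lambda>t. N t \<omega>" using path x by auto
    have "(LBINT s:{0..max 0 t}. of_bool (even (N s \<omega>)) :: real) = even_time (\<lambda>s. N s \<omega>) (max 0 t)"
      unfolding even_time_def
      by (rule set_borel_integral_eq_integral(2)) (rule set_integrable_path[where C = 1], auto)
    then show "(LBINT s. indicator {0..max 0 (fst x)} s * of_bool (even (N (max 0 s) (snd x))) :: real) =
       (case x of (t, \<omega>) \<Rightarrow> even_time (\<lambda>s. N s \<omega>) (max 0 t))"
      unfolding x set_lebesgue_integral_def
      by (auto simp: indicator_def intro!: Bochner_Integration.integral_cong elim: trans[rotated])
  qed
  finally show ?thesis .
qed

text \<open>Stated for an arbitrary measure space on purpose: applied to the sigma-algebra generated
  by the Poisson path, it shows that the occupation time is a functional of that path and hence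
  independent of the sign \<open>B\<close>.\<close>

lemma measurable_even_time:
  assumes N: "\<And>t. t \<ge> 0 \<Longrightarrow> N t \<in> M \<rightarrow>\<^sub>M count_space UNIV"
    and path: "\<And>\<omega>. \<omega> \<in> space M \<Longrightarrow> counting_path (\<lambda>t. N t \<omega>)"
    and "t \<ge> 0"
  shows "(\<lambda>\<omega>. even_time (\<lambda>s. N s \<omega>) t) \<in> borel_measurable M"
  using measurable_compose[OF measurable_Pair1' measurable_even_time_pair[OF N path], of t] \<open>t \<ge> 0\<close>
  by simp

text \<open>The bound is asked for on the time strip only, because powers of the occupation time
  grow with \<open>s\<close>.\<close>

lemma (in prob_space) Fubini_bounded:
  fixes f :: "real \<Rightarrow> 'a \<Rightarrow> real"
  assumes meas: "(\<lambda>(s, \<omega>). f s \<omega>) \<in> borel_measurable (borel \<Otimes>\<^sub>M M)"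
    and bdd: "\<And>s \<omega>. \<alpha> \<le> s \<Longrightarrow> s \<le> \<beta> \<Longrightarrow> \<omega> \<in> space M \<Longrightarrow> \<bar>f s \<omega>\<bar> \<le> C"
  shows "(\<integral>\<omega>. (LBINT s:{\<alpha>..\<beta>}. f s \<omega>) \<partial>M) = (LBINT s:{\<alpha>..\<beta>}. (\<integral>\<omega>. f s \<omega> \<partial>M))"
    and "set_integrable lborel {\<alpha>..\<beta>} (\<lambda>s. \<integral>\<omega>. f s \<omega> \<partial>M)"
proof -
  interpret P: pair_sigma_finite lborel M ..
  have [measurable]: "(\<lambda>(s, \<omega>). f s \<omega>) \<in> borel_measurable (lborel \<Otimes>\<^sub>M M)"
    using meas by simp
  have int: "integrable (lborel \<Otimes>\<^sub>M M) (\<lambda>(s, \<omega>). indicator {\<alpha>..\<beta>} s *\<^sub>R f s \<omega>)"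
  proof (rule integrableI_bounded_set[where A = "{\<alpha>..\<beta>} \<times> space M" and B = C])
    have "emeasure (lborel \<Otimes>\<^sub>M M) ({\<alpha>..\<beta>} \<times> space M) = emeasure lborel {\<alpha>..\<beta>} * emeasure M (space M)"
      by (rule emeasure_pair_measure_Times) auto
    also have "\<dots> < \<infinity>" by (cases "\<alpha> \<le> \<beta>") (auto simp: emeasure_space_1)
    finally show "emeasure (lborel \<Otimes>\<^sub>M M) ({\<alpha>..\<beta>} \<times> space M) < \<infinity>" .
    show "(\<lambda>(s, \<omega>). indicator {\<alpha>..\<beta>} s *\<^sub>R f s \<omega>) \<in> borel_measurable (lborel \<Otimes>\<^sub>M M)"
      by measurable
  qed (auto simp: space_pair_measure indicator_def intro!: AE_I2 bdd)
  show "(\<integral>\<omega>. (LBINT s:{\<alpha>..\<beta>}. f s \<omega>) \<partial>M) = (LBINT s:{\<alpha>..\<beta>}. (\<integral>\<omega>. f s \<omega> \<partial>M))"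
    unfolding set_lebesgue_integral_def using P.Fubini_integral[OF int] by simp
  show "set_integrable lborel {\<alpha>..\<beta>} (\<lambda>s. \<integral>\<omega>. f s \<omega> \<partial>M)"
    unfolding set_integrable_def using P.integrable_fst[OF int] by simp
qed

lemma LBINT_eq_has_integral:
  fixes f :: "real \<Rightarrow> real"
  assumes "(f has_integral I) {a..b}" "continuous_on {a..b} f"
  shows "(LBINT s:{a..b}. f s) = I"
  using set_borel_integral_eq_integral(2)[OF borel_integrable_atLeastAtMost'[OF assms(2)]] assms(1)
  by (simp add: integral_unique)

section \<open>Closed form of the moments of the occupation time on N(t) = n\<close>

definition poisson_weight :: "real \<Rightarrow> nat \<Rightarrow> real" where
  "poisson_weight x k = x ^ k / fact k * exp (- x)"

text \<open>\<open>0 ^ 0 = 1\<close> makes rate 0 the point mass at 0, so that coinciding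
  observation times obey the same formula.\<close>

lemma poisson_weight_0: "poisson_weight 0 k = of_bool (k = 0)"
  by (cases k) (auto simp: poisson_weight_def)

text \<open>The Poisson weight of \<open>n\<close> times the conditional moment. Of the
  \<open>n + 1\<close> exchangeable spacings between jumps, \<open>n div 2 + 1\<close> have an even
  index, so the fraction of time spent at even counts follows the beta law with parameters
  \<open>n div 2 + 1\<close> and \<open>n - n div 2\<close>. Its moment of order \<open>i\<close>
  has the denominator \<open>pochhammer (n + 1) i\<close>, which together with \<open>fact n\<close>
  gives \<open>fact (n + i)\<close>. For \<open>n = 0\<close> the formula describes the constant
  \<open>t\<close>.\<close>

definition even_time_moment :: "real \<Rightarrow> nat \<Rightarrow> nat \<Rightarrow> real \<Rightarrow> real" where
  "even_time_moment a i n t =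
     exp (- (a * t)) * a ^ n * t ^ (n + i) * pochhammer (real (n div 2) + 1) i / fact (n + i)"

lemma even_time_moment_0: "even_time_moment a 0 n t = poisson_weight (a * t) n"
  by (simp add: even_time_moment_def poisson_weight_def power_mult_distrib)

text \<open>The path is split at time \<open>s\<close>, with an even count \<open>m\<close> there
  and \<open>n - m\<close> jumps afterwards. The exponentials combine to
  \<open>exp (- (a * t))\<close>, and each summand is a beta integral whose factorials cancel those
  in \<open>?c m\<close>. With \<open>m = 2 l\<close> only rising factorials remain, summed by
  \<open>sum_pochhammer\<close>.\<close>

lemma even_time_moment_Suc:
  assumes "0 \<le> t"
  shows "(LBINT s:{0..t}. real (Suc i) *
       (\<Sum>m | m \<le> n \<and> even m. even_time_moment a i m s * poisson_weight (a * (t - s)) (n - m)))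
     = even_time_moment a (Suc i) n t"
proof -
  let ?S = "{m. m \<le> n \<and> even m}"
  let ?c = "\<lambda>m. exp (- (a * t)) * a ^ n * pochhammer (real (m div 2) + 1) i / (fact (m + i) * fact (n - m)) :: real"
  have eq: "even_time_moment a i m s * poisson_weight (a * (t - s)) (n - m) = ?c m * (s ^ (m + i) * (t - s) ^ (n - m))"
    if "m \<in> ?S" for m s
  proof -
    have "exp (- (a * s)) * exp (- (a * (t - s))) = exp (- (a * t))"
      by (simp add: exp_add[symmetric] algebra_simps)
    moreover have "a ^ m * a ^ (n - m) = a ^ n" using that by (simp add: power_add[symmetric])
    ultimately show ?thesis
      by (simp add: even_time_moment_def poisson_weight_def power_mult_distrib mult_ac)
  qed
  have fin: "finite ?S" by simp
  have int: "((\<lambda>s. real (Suc i) * (\<Sum>m\<in>?S. ?c m * (s ^ (m + i) * (t - s) ^ (n - m)))) has_integral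
     real (Suc i) * (\<Sum>m\<in>?S. ?c m * (fact (m + i) * fact (n - m) / fact (m + i + (n - m) + 1) * t ^ (m + i + (n - m) + 1)))) {0..t}"
    by (intro has_integral_mult_right has_integral_sum fin has_integral_beta assms)
  have "(LBINT s:{0..t}. real (Suc i) *
       (\<Sum>m\<in>?S. even_time_moment a i m s * poisson_weight (a * (t - s)) (n - m)))
     = (LBINT s:{0..t}. real (Suc i) * (\<Sum>m\<in>?S. ?c m * (s ^ (m + i) * (t - s) ^ (n - m))))"
    by (simp only: sum.cong[OF refl eq])
  also have "\<dots> = real (Suc i) * (\<Sum>m\<in>?S. ?c m * (fact (m + i) * fact (n - m) / fact (m + i + (n - m) + 1) * t ^ (m + i + (n - m) + 1)))"
    by (intro LBINT_eq_has_integral int continuous_intros)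
  also have "\<dots> = exp (- (a * t)) * a ^ n * t ^ (n + Suc i) / fact (n + Suc i) *
      (\<Sum>m\<in>?S. real (Suc i) * pochhammer (real (m div 2) + 1) i)"
    unfolding sum_distrib_left
    by (intro sum.cong refl) (simp add: divide_simps add.commute[of n i] del: fact_Suc power_Suc)
  also have "(\<Sum>m\<in>?S. real (Suc i) * pochhammer (real (m div 2) + 1) i) =
      (\<Sum>l\<le>n div 2. real (Suc i) * pochhammer (real l + 1) i)"
    by (rule sum.reindex_bij_witness[where i = "\<lambda>l. 2 * l" and j = "\<lambda>m. m div 2"]) auto
  also have "\<dots> = pochhammer (real (n div 2) + 1) (Suc i)"
    by (rule sum_pochhammer)
  finally show ?thesis by (simp add: even_time_moment_def)
qed

section \<open>Moments of the occupation time of a Poisson process\<close>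

locale poisson_paths = prob_space M for M :: "'w measure" +
  fixes a :: real and N :: "real \<Rightarrow> 'w \<Rightarrow> nat"
  assumes a_pos: "a > 0" and poisson: "poisson_process M a N"
begin

lemma N_measurable: "t \<ge> 0 \<Longrightarrow> N t \<in> M \<rightarrow>\<^sub>M count_space UNIV"
  using poisson by (auto simp: poisson_process_def)

lemma counting_path: "\<omega> \<in> space M \<Longrightarrow> counting_path (\<lambda>t. N t \<omega>)"
  using poisson by (auto simp: poisson_process_def counting_path_def)

lemma N_0: "\<omega> \<in> space M \<Longrightarrow> N 0 \<omega> = 0"
  using poisson by (auto simp: poisson_process_def)

lemma N_mono: "\<omega> \<in> space M \<Longrightarrow> 0 \<le> s \<Longrightarrow> s \<le> t \<Longrightarrow> N s \<omega> \<le> N t \<omega>"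
  using counting_path.monoD[OF counting_path] by simp

abbreviation "E t \<omega> \<equiv> even_time (\<lambda>s. N s \<omega>) t"

lemmas N_pair = measurable_counting_paths[of N M, OF N_measurable counting_path]
lemmas E_pair = measurable_even_time_pair[of N M, OF N_measurable counting_path]
lemmas E_measurable = measurable_even_time[of N M, OF N_measurable counting_path]

lemma E_bounds: "\<omega> \<in> space M \<Longrightarrow> 0 \<le> t \<Longrightarrow> 0 \<le> E t \<omega> \<and> E t \<omega> \<le> t"
  using counting_path.even_time_bounds[OF counting_path] by simp

lemma increment_measurable:
  "0 \<le> s \<Longrightarrow> 0 \<le> t \<Longrightarrow> (\<lambda>\<omega>. N t \<omega> - N s \<omega>) \<in> M \<rightarrow>\<^sub>M count_space UNIV"
  by (rule measurable_compose_countable'[where I = UNIV and g = "N s" and f = "\<lambda>i \<omega>. N t \<omega> - i"])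
     (auto intro: N_measurable measurable_compose[OF N_measurable])

lemma expectation_increment:
  assumes "0 \<le> s" "s \<le> t"
  shows "expectation (\<lambda>\<omega>. of_bool (N t \<omega> - N s \<omega> = k)) = poisson_weight (a * (t - s)) k"
proof (cases "s = t")
  case True
  then show ?thesis by (simp add: poisson_weight_0 prob_space)
next
  case False
  with assms have "s < t" by simp
  with assms poisson have *: "distr M (count_space UNIV) (\<lambda>\<omega>. N t \<omega> - N s \<omega>) = measure_pmf (poisson_pmf (a * (t - s)))"
    by (auto simp: poisson_process_def)
  have [measurable]: "(\<lambda>\<omega>. N t \<omega> - N s \<omega>) \<in> M \<rightarrow>\<^sub>M count_space UNIV"
    using assms by (intro increment_measurable) auto
  have "expectation (\<lambda>\<omega>. of_bool (N t \<omega> - N s \<omega> = k)) =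
      (\<integral>n. indicat_real {k} n \<partial>distr M (count_space UNIV) (\<lambda>\<omega>. N t \<omega> - N s \<omega>))"
    by (subst integral_distr) (auto simp: indicator_def of_bool_def)
  also have "\<dots> = pmf (poisson_pmf (a * (t - s))) k"
    unfolding * by (simp add: pmf.rep_eq)
  also have "\<dots> = poisson_weight (a * (t - s)) k"
    using a_pos \<open>s < t\<close> by (simp add: poisson_weight_def)
  finally show ?thesis .
qed

lemma expectation_increments:
  assumes "mono \<tau>" "0 \<le> \<tau> 0"
  shows "expectation (\<lambda>\<omega>. \<Prod>j<n. of_bool (N (\<tau> (Suc j)) \<omega> - N (\<tau> j) \<omega> = q j)) =
     (\<Prod>j<n. poisson_weight (a * (\<tau> (Suc j) - \<tau> j)) (q j))"
proof -
  have \<tau>: "0 \<le> \<tau> j" for j using assms monoD[OF assms(1), of 0 j] by auto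
  have "indep_vars (\<lambda>_. count_space UNIV) (\<lambda>j \<omega>. N (\<tau> (Suc j)) \<omega> - N (\<tau> j) \<omega>) {..<n}"
    using poisson assms by (auto simp: poisson_process_def)
  then have indep: "indep_vars (\<lambda>_. borel) (\<lambda>j \<omega>. of_bool (N (\<tau> (Suc j)) \<omega> - N (\<tau> j) \<omega> = q j) :: real) {..<n}"
    by (rule indep_vars_compose2) auto
  have "expectation (\<lambda>\<omega>. \<Prod>j<n. of_bool (N (\<tau> (Suc j)) \<omega> - N (\<tau> j) \<omega> = q j)) =
     (\<Prod>j<n. expectation (\<lambda>\<omega>. of_bool (N (\<tau> (Suc j)) \<omega> - N (\<tau> j) \<omega> = q j) :: real))"
  proof (intro indep_vars_lebesgue_integral indep)
    fix j
    have "(\<lambda>\<omega>. of_bool (N (\<tau> (Suc j)) \<omega> - N (\<tau> j) \<omega> = q j) :: real) \<in> borel_measurable M"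
      by (rule measurable_compose[OF increment_measurable[OF \<tau> \<tau>]]) simp
    then show "integrable M (\<lambda>\<omega>. of_bool (N (\<tau> (Suc j)) \<omega> - N (\<tau> j) \<omega> = q j) :: real)"
      by (intro integrable_const_bound[where B = 1]) auto
  qed auto
  also have "\<dots> = (\<Prod>j<n. poisson_weight (a * (\<tau> (Suc j) - \<tau> j)) (q j))"
    using \<tau> assms(1) by (intro prod.cong expectation_increment) (auto simp: mono_def)
  finally show ?thesis .
qed

text \<open>Carrying the later increments along makes the claim inductive: by
  \<open>E(t)^(i+1) = (i+1) \<integral>\<^sub>0\<^sup>t E(s)^i 1[N(s) even] ds\<close>
  the exponent drops by one at the price of an extra observation time \<open>s\<close>.\<close>

lemma expectation_even_time_power_increments:
  assumes "mono \<tau>" "0 \<le> \<tau> 0"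
  shows "expectation (\<lambda>\<omega>. E (\<tau> 0) \<omega> ^ i * of_bool (N (\<tau> 0) \<omega> = m) *
       (\<Prod>j<n. of_bool (N (\<tau> (Suc j)) \<omega> - N (\<tau> j) \<omega> = q j))) =
     even_time_moment a i m (\<tau> 0) * (\<Prod>j<n. poisson_weight (a * (\<tau> (Suc j) - \<tau> j)) (q j))"
  using assms
proof (induction i arbitrary: \<tau> m n q)
  case 0
  \<comment> \<open>Prepending time 0, where \<open>N\<close> vanishes, turns the condition
    \<open>N (\<tau> 0) \<omega> = m\<close> into one more increment.\<close>
  let ?\<tau> = "case_nat 0 \<tau>" and ?q = "case_nat m q"
  have "mono ?\<tau>"
    unfolding mono_iff_le_Suc using 0 by (auto split: nat.split simp: mono_iff_le_Suc)
  then have "expectation (\<lambda>\<omega>. \<Prod>j<Suc n. of_bool (N (?\<tau> (Suc j)) \<omega> - N (?\<tau> j) \<omega> = ?q j)) =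
     (\<Prod>j<Suc n. poisson_weight (a * (?\<tau> (Suc j) - ?\<tau> j)) (?q j))"
    by (intro expectation_increments) auto
  also have "\<dots> = even_time_moment a 0 m (\<tau> 0) * (\<Prod>j<n. poisson_weight (a * (\<tau> (Suc j) - \<tau> j)) (q j))"
    by (simp add: prod.lessThan_Suc_shift even_time_moment_0 del: prod.lessThan_Suc)
  also have "expectation (\<lambda>\<omega>. \<Prod>j<Suc n. of_bool (N (?\<tau> (Suc j)) \<omega> - N (?\<tau> j) \<omega> = ?q j)) =
    expectation (\<lambda>\<omega>. E (\<tau> 0) \<omega> ^ 0 * of_bool (N (\<tau> 0) \<omega> = m) *
       (\<Prod>j<n. of_bool (N (\<tau> (Suc j)) \<omega> - N (\<tau> j) \<omega> = q j)))"
    by (intro Bochner_Integration.integral_cong refl)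
       (simp add: prod.lessThan_Suc_shift N_0 del: prod.lessThan_Suc)
  finally show ?case .
next
  case (Suc i)
  let ?t = "\<tau> 0"
  define R where "R \<omega> = (\<Prod>j<n. of_bool (N (\<tau> (Suc j)) \<omega> - N (\<tau> j) \<omega> = q j) :: real)" for \<omega>
  define W where "W = (\<Prod>j<n. poisson_weight (a * (\<tau> (Suc j) - \<tau> j)) (q j))"
  have \<tau>: "0 \<le> \<tau> j" for j using Suc.prems monoD[OF Suc.prems(1), of 0 j] by auto
  have R_meas [measurable]: "R \<in> borel_measurable M"
    unfolding R_def
    by (intro borel_measurable_prod measurable_compose[OF increment_measurable[OF \<tau> \<tau>]]) simp
  have R_bound: "\<bar>R \<omega>\<bar> \<le> 1" for \<omega>
    unfolding R_def abs_prod by (intro prod_le_1) auto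
  have pred_meas [measurable]: "(\<lambda>\<omega>. of_bool (P (N s \<omega>)) :: real) \<in> borel_measurable M" if "0 \<le> s" for s and P :: "nat \<Rightarrow> bool"
    by (rule measurable_compose[OF N_measurable[OF that]]) simp
  \<comment> \<open>The integrand of the power formula, with time clamped at 0 for joint
    measurability; the final count and the later increments ride along as factors constant in
    \<open>s\<close>.\<close>
  define f where "f s \<omega> = real (Suc i) * E (max 0 s) \<omega> ^ i * of_bool (even (N (max 0 s) \<omega>)) *
      (of_bool (N ?t \<omega> = m) * R \<omega>)" for s \<omega>
  have "(\<lambda>x. of_bool (even (N (max 0 (fst x)) (snd x))) :: real) \<in> borel_measurable (borel \<Otimes>\<^sub>M M)"
    using measurable_compose[OF N_pair, of "\<lambda>n. of_bool (even n) :: real" borel] by (simp add: case_prod_beta')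
  moreover have "(\<lambda>x. E (max 0 (fst x)) (snd x)) \<in> borel_measurable (borel \<Otimes>\<^sub>M M)"
    using E_pair by (simp add: case_prod_beta')
  moreover have "(\<lambda>x. of_bool (N ?t (snd x) = m) :: real) \<in> borel_measurable (borel \<Otimes>\<^sub>M M)"
    by (rule measurable_compose[OF measurable_snd pred_meas[OF \<tau>, of "\<lambda>n. n = m"]])
  ultimately have f_meas: "(\<lambda>(s, \<omega>). f s \<omega>) \<in> borel_measurable (borel \<Otimes>\<^sub>M M)"
    unfolding f_def case_prod_beta' by (intro borel_measurable_times borel_measurable_const
      borel_measurable_power measurable_compose[OF measurable_snd R_meas])
  have f_bound: "\<bar>f s \<omega>\<bar> \<le> real (Suc i) * ?t ^ i" if "0 \<le> s" "s \<le> ?t" "\<omega> \<in> space M" for s \<omega>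
  proof -
    have "\<bar>E s \<omega>\<bar> ^ i \<le> ?t ^ i"
      using E_bounds[OF that(3,1)] that by (intro power_mono) auto
    then have "\<bar>real (Suc i) * E (max 0 s) \<omega> ^ i\<bar> \<le> real (Suc i) * ?t ^ i"
      using that by (simp add: abs_mult power_abs mult_left_mono del: of_nat_Suc)
    moreover have "\<bar>of_bool (even (N (max 0 s) \<omega>)) * (of_bool (N ?t \<omega> = m) * R \<omega>)\<bar> \<le> 1"
      using R_bound[of \<omega>] by auto
    ultimately have "\<bar>real (Suc i) * E (max 0 s) \<omega> ^ i\<bar> * \<bar>of_bool (even (N (max 0 s) \<omega>)) * (of_bool (N ?t \<omega> = m) * R \<omega>)\<bar>
      \<le> (real (Suc i) * ?t ^ i) * 1"
      using \<tau>[of 0] by (intro mult_mono) auto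
    then show ?thesis by (simp add: f_def abs_mult mult_ac)
  qed
  have pathwise: "E ?t \<omega> ^ Suc i * of_bool (N ?t \<omega> = m) * R \<omega> = (LBINT s:{0..?t}. f s \<omega>)" if \<omega>: "\<omega> \<in> space M" for \<omega>
  proof -
    interpret counting_path "\<lambda>t. N t \<omega>" by (rule counting_path[OF \<omega>])
    let ?h = "\<lambda>s. real (Suc i) * E s \<omega> ^ i * of_bool (even (N s \<omega>))"
    have "set_integrable lborel {0..?t} (\<lambda>s. f s \<omega>)"
      unfolding set_integrable_def
    proof (rule integrableI_bounded_set[where A = "{0..?t}" and B = "real (Suc i) * ?t ^ i"])
      have "(\<lambda>s. f s \<omega>) \<in> borel_measurable borel"
        using measurable_compose[OF measurable_Pair2' f_meas, of \<omega>] \<omega> by simp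
      then show "(\<lambda>s. indicat_real {0..?t} s *\<^sub>R f s \<omega>) \<in> borel_measurable lborel" by measurable
    qed (use \<tau>[of 0] \<omega> f_bound in \<open>auto simp: indicator_def\<close>)
    from set_borel_integral_eq_integral(2)[OF this]
    have "(LBINT s:{0..?t}. f s \<omega>) = integral {0..?t} (\<lambda>s. f s \<omega>)" .
    also have "\<dots> = integral {0..?t} (\<lambda>s. ?h s * (of_bool (N ?t \<omega> = m) * R \<omega>))"
      by (rule integral_cong) (auto simp: f_def)
    also have "\<dots> = E ?t \<omega> ^ Suc i * (of_bool (N ?t \<omega> = m) * R \<omega>)"
      by (intro integral_unique has_integral_mult_left even_time_power \<tau>)
    finally show ?thesis by (simp add: mult_ac)
  qed
  have inner: "expectation (f s) = real (Suc i) *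
       (\<Sum>l | l \<le> m \<and> even l. even_time_moment a i l s * poisson_weight (a * (?t - s)) (m - l)) * W"
    if s: "0 \<le> s" "s \<le> ?t" for s
  proof -
    let ?S = "{l. l \<le> m \<and> even l}"
    \<comment> \<open>The time \<open>s\<close> becomes the first observation: the count
      \<open>m\<close> at the old first time splits into a count \<open>l\<close> at
      \<open>s\<close> and an increment \<open>m - l\<close>, which the induction hypothesis takes
      as one more increment.\<close>
    let ?\<tau> = "case_nat s \<tau>"
    define F where "F l \<omega> = E (?\<tau> 0) \<omega> ^ i * of_bool (N (?\<tau> 0) \<omega> = l) *
       (\<Prod>j<Suc n. of_bool (N (?\<tau> (Suc j)) \<omega> - N (?\<tau> j) \<omega> = case_nat (m - l) q j) :: real)" for l \<omega>
    have mono': "mono ?\<tau>"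
      unfolding mono_iff_le_Suc using Suc.prems s by (auto split: nat.split simp: mono_iff_le_Suc)
    have F_eq: "F l \<omega> = E s \<omega> ^ i * of_bool (N s \<omega> = l) * of_bool (N ?t \<omega> - N s \<omega> = m - l) * R \<omega>" for l \<omega>
      by (simp add: F_def R_def prod.lessThan_Suc_shift del: prod.lessThan_Suc)
    have F_int: "integrable M (F l)" for l
    proof (rule integrable_const_bound[where B = "?t ^ i"])
      show "F l \<in> borel_measurable M"
        unfolding F_eq[abs_def]
        by (intro borel_measurable_times borel_measurable_power E_measurable pred_meas R_meas s
            measurable_compose[OF increment_measurable[OF s(1) \<tau>]]) simp_all
      have "\<bar>F l \<omega>\<bar> \<le> ?t ^ i" if "\<omega> \<in> space M" for \<omega>
      proof -
        have "\<bar>E s \<omega>\<bar> ^ i \<le> ?t ^ i"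
          using E_bounds[OF that s(1)] s by (intro power_mono) auto
        moreover have "\<bar>of_bool (N s \<omega> = l) * of_bool (N ?t \<omega> - N s \<omega> = m - l) * R \<omega>\<bar> \<le> 1"
          using R_bound[of \<omega>] by auto
        ultimately have "\<bar>E s \<omega>\<bar> ^ i * \<bar>of_bool (N s \<omega> = l) * of_bool (N ?t \<omega> - N s \<omega> = m - l) * R \<omega>\<bar> \<le> ?t ^ i * 1"
          using \<tau>[of 0] by (intro mult_mono) auto
        then show ?thesis by (simp add: F_eq abs_mult power_abs mult_ac)
      qed
      then show "AE \<omega> in M. norm (F l \<omega>) \<le> ?t ^ i" by auto
    qed
    have "expectation (f s) = expectation (\<lambda>\<omega>. real (Suc i) * (\<Sum>l\<in>?S. F l \<omega>))"
    proof (intro Bochner_Integration.integral_cong refl)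
      fix \<omega> assume \<omega>: "\<omega> \<in> space M"
      have le: "N s \<omega> \<le> N ?t \<omega>" using N_mono[OF \<omega> s] .
      have "(\<Sum>l\<in>?S. F l \<omega>) = (\<Sum>l\<in>?S. if l = N s \<omega> then E s \<omega> ^ i * of_bool (N ?t \<omega> - l = m - l) * R \<omega> else 0)"
        by (intro sum.cong refl) (auto simp: F_eq)
      also have "\<dots> = of_bool (N s \<omega> \<in> ?S) * (E s \<omega> ^ i * of_bool (N ?t \<omega> - N s \<omega> = m - N s \<omega>) * R \<omega>)"
        by (rule trans[OF sum.delta]) auto
      \<comment> \<open>As \<open>N s \<omega> \<le> N ?t \<omega>\<close>, equality of the
        truncated differences together with \<open>N s \<omega> \<le> m\<close> means
        \<open>N ?t \<omega> = m\<close>.\<close>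
      also have "\<dots> = of_bool (even (N s \<omega>)) * of_bool (N ?t \<omega> = m) * (E s \<omega> ^ i * R \<omega>)"
        using le by auto
      finally show "f s \<omega> = real (Suc i) * (\<Sum>l\<in>?S. F l \<omega>)"
        using s by (simp add: f_def mult_ac)
    qed
    also have "\<dots> = real (Suc i) * (\<Sum>l\<in>?S. expectation (F l))"
      using F_int by simp
    also have "(\<Sum>l\<in>?S. expectation (F l)) = (\<Sum>l\<in>?S. even_time_moment a i l s * poisson_weight (a * (?t - s)) (m - l) * W)"
    proof (intro sum.cong refl)
      fix l
      show "expectation (F l) = even_time_moment a i l s * poisson_weight (a * (?t - s)) (m - l) * W"
        unfolding F_def using Suc.IH[OF mono', of l "case_nat (m - l) q" "Suc n"] s
        by (simp add: prod.lessThan_Suc_shift W_def mult_ac del: prod.lessThan_Suc)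
    qed
    finally show ?thesis unfolding sum_distrib_right[symmetric] by (simp add: mult.assoc del: of_nat_Suc)
  qed
  have "expectation (\<lambda>\<omega>. E ?t \<omega> ^ Suc i * of_bool (N ?t \<omega> = m) * R \<omega>) = expectation (\<lambda>\<omega>. LBINT s:{0..?t}. f s \<omega>)"
    by (intro Bochner_Integration.integral_cong refl pathwise)
  also have "\<dots> = (LBINT s:{0..?t}. expectation (f s))"
    by (rule Fubini_bounded(1)[OF f_meas f_bound])
  also have "\<dots> = (LBINT s:{0..?t}. real (Suc i) *
       (\<Sum>l | l \<le> m \<and> even l. even_time_moment a i l s * poisson_weight (a * (?t - s)) (m - l)) * W)"
    by (intro set_lebesgue_integral_cong) (auto simp: inner simp del: of_nat_Suc)
  also have "\<dots> = even_time_moment a (Suc i) m ?t * W"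
    using even_time_moment_Suc[OF \<tau>[of 0], where i = i and n = m and a = a] by simp
  finally show ?case unfolding R_def W_def .
qed

lemma expectation_even_time_power:
  assumes "0 \<le> t"
  shows "expectation (\<lambda>\<omega>. E t \<omega> ^ i * of_bool (N t \<omega> = n)) = even_time_moment a i n t"
  using expectation_even_time_power_increments[where \<tau> = "\<lambda>_. t" and n = 0] assms by (simp add: mono_def)

end

section \<open>Law of the occupation time\<close>

text \<open>On bounded support the Taylor polynomials of the two characteristic functions, which
  depend only on the common moments, have errors of order \<open>(|t| C)^n / n!\<close>. The
  characteristic functions therefore coincide, and Levy uniqueness applies.\<close>

lemma real_distribution_eqI_moments:
  assumes "real_distribution M1" "real_distribution M2"
    and bdd: "AE x in M1. \<bar>x\<bar> \<le> C" "AE x in M2. \<bar>x\<bar> \<le> C"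
    and moments: "\<And>k. (\<integral>x. x ^ k \<partial>M1) = (\<integral>x. x ^ k \<partial>M2)"
  shows "M1 = M2"
proof (rule Levy_uniqueness[OF assms(1,2)], rule ext)
  fix t :: real
  define p where "p n = (\<Sum>k\<le>n. ((\<i> * t) ^ k / fact k) * complex_of_real (\<integral>x. x ^ k \<partial>M1))" for n
  have bound: "cmod (char M t - p n) \<le> 2 * \<bar>t\<bar> ^ n / fact n * C ^ n"
    if "real_distribution M" "AE x in M. \<bar>x\<bar> \<le> C" and eq: "\<And>k. (\<integral>x. x ^ k \<partial>M) = (\<integral>x. x ^ k \<partial>M1)" for M n
  proof -
    interpret real_distribution M by fact
    have pow: "AE x in M. \<bar>x\<bar> ^ k \<le> C ^ k" for k
      using that(2) by eventually_elim (simp add: power_mono)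
    have int: "integrable M (\<lambda>x. x ^ k)" for k
      by (rule integrable_const_bound[where B = "C ^ k"]) (use pow[of k] in \<open>auto simp: power_abs\<close>)
    have "expectation (\<lambda>x. \<bar>x\<bar> ^ n) \<le> expectation (\<lambda>_. C ^ n)"
      using integrable_abs[OF int[of n]] pow[of n]
      by (intro integral_mono_AE) (auto simp: power_abs)
    then have "expectation (\<lambda>x. \<bar>x\<bar> ^ n) \<le> C ^ n" using prob_space by simp
    moreover have "cmod (char M t - p n) \<le> 2 * \<bar>t\<bar> ^ n / fact n * expectation (\<lambda>x. \<bar>x\<bar> ^ n)"
      using char_approx1[of n t] int unfolding p_def eq by simp
    ultimately show ?thesis
      by (elim order_trans) (intro mult_left_mono, auto)
  qed
  have "cmod (char M1 t - char M2 t) \<le> 4 * ((\<bar>t\<bar> * C) ^ n / fact n)" for n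
  proof -
    have "cmod (char M1 t - char M2 t) \<le> cmod (char M1 t - p n) + cmod (char M2 t - p n)"
      by (metis norm_triangle_ineq4 diff_diff_eq2 diff_add_cancel)
    also have "\<dots> \<le> 2 * \<bar>t\<bar> ^ n / fact n * C ^ n + 2 * \<bar>t\<bar> ^ n / fact n * C ^ n"
      by (intro add_mono bound assms refl) (simp add: moments)
    finally show ?thesis by (simp add: power_mult_distrib mult.commute)
  qed
  moreover have "(\<lambda>n. 4 * ((\<bar>t\<bar> * C) ^ n / fact n)) \<longlonglongrightarrow> 4 * 0"
    by (intro tendsto_intros summable_LIMSEQ_zero) (use summable_exp[of "\<bar>t\<bar> * C"] in \<open>simp add: field_simps\<close>)
  ultimately have "cmod (char M1 t - char M2 t) \<le> 0"
    by (intro LIMSEQ_le_const[where X = "\<lambda>n. 4 * ((\<bar>t\<bar> * C) ^ n / fact n)"]) auto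
  then show "char M1 t = char M2 t" by simp
qed

text \<open>Works with the law of \<open>X\<close> on the event \<open>B\<close> as an unnormalised
  finite measure instead of conditioning on \<open>B\<close>; the finiteness of this measure yields
  the integrability of \<open>h * f\<close>.\<close>

lemma (in prob_space) expectation_eq_density:
  fixes X :: "'a \<Rightarrow> real" and f h :: "real \<Rightarrow> real"
  assumes [measurable]: "X \<in> borel_measurable M" "B \<in> sets M" "h \<in> borel_measurable borel" "f \<in> borel_measurable borel"
    and h: "\<And>u. 0 \<le> h u" and f: "\<And>u. \<bar>f u\<bar> \<le> C"
    and law: "\<And>A. A \<in> sets borel \<Longrightarrow>
      (\<integral>\<^sup>+\<omega>. indicator A (X \<omega>) * indicator B \<omega> \<partial>M) = (\<integral>\<^sup>+u. indicator A u * ennreal (h u) \<partial>lborel)"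
  shows "integrable lborel (\<lambda>u. h u * f u)"
    and "expectation (\<lambda>\<omega>. f (X \<omega>) * indicator B \<omega>) = (LBINT u. h u * f u)"
proof -
  define \<mu> where "\<mu> = distr (density M (indicator B)) borel X"
  have [simp]: "sets \<mu> = sets borel" "space \<mu> = UNIV" by (simp_all add: \<mu>_def)
  have \<mu>: "\<mu> = density lborel (\<lambda>u. ennreal (h u))"
  proof (rule measure_eqI)
    fix A assume "A \<in> sets \<mu>"
    then have [measurable]: "A \<in> sets borel" by simp
    have "emeasure \<mu> A = (\<integral>\<^sup>+\<omega>. indicator A (X \<omega>) * indicator B \<omega> \<partial>M)"
      unfolding \<mu>_def
      by (subst emeasure_distr) (auto simp: emeasure_density intro!: nn_integral_cong split: split_indicator)
    also have "\<dots> = emeasure (density lborel (\<lambda>u. ennreal (h u))) A"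
      unfolding law[OF \<open>A \<in> sets borel\<close>]
      by (subst emeasure_density) (auto intro!: nn_integral_cong simp: mult.commute)
    finally show "emeasure \<mu> A = emeasure (density lborel (\<lambda>u. ennreal (h u))) A" .
  qed simp
  have "emeasure \<mu> UNIV = emeasure M B"
    unfolding \<mu>_def by (subst emeasure_distr) (auto simp: emeasure_density)
  then interpret \<mu>: finite_measure \<mu>
    by (intro finite_measureI) (simp add: emeasure_eq_measure)
  have "f \<in> borel_measurable \<mu>" by (simp add: \<mu>_def)
  then have "integrable \<mu> f"
    by (intro \<mu>.integrable_const_bound[where B = C]) (use f in auto)
  then show "integrable lborel (\<lambda>u. h u * f u)"
    unfolding \<mu> using h by (subst (asm) integrable_density) auto
  have "(\<integral>u. f u \<partial>\<mu>) = (\<integral>\<omega>. f (X \<omega>) \<partial>density M (indicator B))"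
    unfolding \<mu>_def by (rule integral_distr) auto
  also have "density M (indicator B) = density M (\<lambda>\<omega>. ennreal (indicator B \<omega>))"
    by (intro arg_cong[where f = "density M"]) (auto simp: indicator_def)
  also have "(\<integral>\<omega>. f (X \<omega>) \<partial>density M (\<lambda>\<omega>. ennreal (indicator B \<omega>))) = expectation (\<lambda>\<omega>. indicator B \<omega> *\<^sub>R f (X \<omega>))"
    by (rule integral_density) auto
  finally show "expectation (\<lambda>\<omega>. f (X \<omega>) * indicator B \<omega>) = (LBINT u. h u * f u)"
    unfolding \<mu> using h by (subst (asm) integral_density) (auto simp: mult.commute)
qed

text \<open>The Poisson weight of \<open>n\<close> times the density of the beta law with parameters
  \<open>n div 2 + 1\<close> and \<open>n - n div 2\<close>, scaled to [0,t]. It is meant for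
  \<open>n > 0\<close>: without a jump the occupation time is the constant \<open>t\<close>.\<close>

definition even_time_density :: "real \<Rightarrow> real \<Rightarrow> nat \<Rightarrow> real \<Rightarrow> real" where
  "even_time_density a t n u = exp (- (a * t)) * a ^ n *
     (u ^ (n div 2) * (t - u) ^ (n - 1 - n div 2)) / (fact (n div 2) * fact (n - 1 - n div 2))"

lemma has_integral_even_time_density:
  assumes "0 \<le> t" "0 < n"
  shows "((\<lambda>u. u ^ i * even_time_density a t n u) has_integral even_time_moment a i n t) {0..t}"
proof -
  let ?k = "n div 2" and ?l = "n - 1 - n div 2"
  have n: "?k + ?l + 1 = n" using assms(2) by (cases "even n") (auto elim!: evenE oddE)
  have "fact (?k + i) = fact ?k * pochhammer (real ?k + 1) i"
    using pochhammer_product'[of "1 :: real" ?k i] by (simp only: pochhammer_fact add.commute[of 1])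
  moreover have "((\<lambda>u. exp (- (a * t)) * a ^ n / (fact ?k * fact ?l) * (u ^ (?k + i) * (t - u) ^ ?l)) has_integral
     exp (- (a * t)) * a ^ n / (fact ?k * fact ?l) * (fact (?k + i) * fact ?l / fact (?k + i + ?l + 1) * t ^ (?k + i + ?l + 1))) {0..t}"
    by (intro has_integral_mult_right has_integral_beta assms)
  moreover have "?k + i + ?l + 1 = n + i" using n by simp
  ultimately show ?thesis
    by (simp add: even_time_moment_def even_time_density_def power_add mult_ac add.commute[of n i])
qed

lemma measurable_even_time_density [measurable]: "even_time_density a t n \<in> borel_measurable borel"
  unfolding even_time_density_def[abs_def] by measurable

context poisson_paths
begin

lemma event_N [measurable]: "0 \<le> t \<Longrightarrow> {\<omega> \<in> space M. P (N t \<omega>)} \<in> events"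
  using measurable_sets[OF N_measurable, of t "{n. P n}"] by (simp add: vimage_def Int_def conj_commute)

lemma prob_N: "0 \<le> t \<Longrightarrow> prob {\<omega> \<in> space M. N t \<omega> = n} = poisson_weight (a * t) n"
proof -
  assume t: "0 \<le> t"
  have "prob {\<omega> \<in> space M. N t \<omega> = n} = expectation (indicator {\<omega> \<in> space M. N t \<omega> = n})"
    using event_N[OF t, of "\<lambda>k. k = n"] by simp
  also have "\<dots> = expectation (\<lambda>\<omega>. E t \<omega> ^ 0 * of_bool (N t \<omega> = n))"
    by (intro Bochner_Integration.integral_cong) (auto simp: indicator_def)
  finally show ?thesis
    unfolding expectation_even_time_power[OF t] by (simp add: even_time_moment_0)
qed

text \<open>Moments determine probability laws, so both sides are normalised by \<open>w\<close>,
  the probability of the event, before they are compared. Nonnegative integrals let the later sum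
  over \<open>n\<close> go through without integrability conditions.\<close>

lemma nn_integral_even_time:
  assumes t: "0 < t" and n: "0 < n" and A [measurable]: "A \<in> sets borel"
  shows "(\<integral>\<^sup>+\<omega>. indicator A (E t \<omega>) * indicator {\<omega> \<in> space M. N t \<omega> = n} \<omega> \<partial>M) =
    (\<integral>\<^sup>+u. indicator A u * (indicator {0..t} u * ennreal (even_time_density a t n u)) \<partial>lborel)"
proof -
  let ?B = "{\<omega> \<in> space M. N t \<omega> = n}"
  define w where "w = poisson_weight (a * t) n"
  have w: "w > 0" using t a_pos by (simp add: w_def poisson_weight_def)
  have [measurable]: "E t \<in> borel_measurable M" using t by (intro E_measurable) auto
  have [measurable]: "?B \<in> events" using t by (intro event_N) auto
  have prob_B: "emeasure M ?B = ennreal w" using t by (simp add: emeasure_eq_measure prob_N w_def)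
  define M1 where "M1 = distr (uniform_measure M ?B) borel (E t)"
  define d where "d u = indicator {0..t} u * even_time_density a t n u / w" for u
  have d_meas [measurable]: "d \<in> borel_measurable borel" unfolding d_def by measurable
  have d_nonneg: "0 \<le> d u" for u
    using a_pos w by (auto simp: d_def even_time_density_def indicator_def)
  define M2 where "M2 = density lborel (\<lambda>u. ennreal (d u))"
  interpret U: prob_space "uniform_measure M ?B"
    by (rule prob_space_uniform_measure) (use w in \<open>auto simp: prob_B\<close>)
  have int: "has_bochner_integral lborel (\<lambda>u. d u * u ^ i) (even_time_moment a i n t / w)" for i
  proof -
    have c: "continuous_on {0..t} (\<lambda>u. u ^ i * even_time_density a t n u)"
      unfolding even_time_density_def by (intro continuous_intros) auto
    have "has_bochner_integral lborel (\<lambda>u. indicator {0..t} u *\<^sub>R (u ^ i * even_time_density a t n u)) (even_time_moment a i n t)"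
      using LBINT_eq_has_integral[OF has_integral_even_time_density[OF less_imp_le[OF t] n] c] borel_integrable_atLeastAtMost'[OF c]
      unfolding set_integrable_def set_lebesgue_integral_def by (simp add: has_bochner_integral_iff)
    from has_bochner_integral_divide_zero[OF this, of w] show ?thesis
      by (simp add: d_def mult_ac)
  qed
  have "real_distribution M1"
    unfolding M1_def by (rule U.real_distribution_distr) simp
  moreover have "real_distribution M2"
  proof -
    have "emeasure M2 UNIV = (\<integral>\<^sup>+u. ennreal (d u) \<partial>lborel)"
      unfolding M2_def by (subst emeasure_density) auto
    also have "\<dots> = ennreal (even_time_moment a 0 n t / w)"
      using int[of 0] d_nonneg by (intro nn_integral_eq_integral[THEN trans]) (auto simp: has_bochner_integral_iff)
    also have "\<dots> = 1" using w by (simp add: even_time_moment_0 w_def)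
    finally show ?thesis
      by (intro real_distribution.intro prob_spaceI real_distribution_axioms.intro) (auto simp: M2_def)
  qed
  moreover have "AE x in M1. \<bar>x\<bar> \<le> t"
  proof -
    have "AE \<omega> in uniform_measure M ?B. \<bar>E t \<omega>\<bar> \<le> t"
    proof (rule AE_I2)
      fix \<omega> assume "\<omega> \<in> space (uniform_measure M ?B)"
      then show "\<bar>E t \<omega>\<bar> \<le> t" using E_bounds[of \<omega> t] t by auto
    qed
    then show ?thesis unfolding M1_def by (subst AE_distr_iff) auto
  qed
  moreover have "AE x in M2. \<bar>x\<bar> \<le> t"
    unfolding M2_def by (subst AE_density) (auto simp: d_def indicator_def)
  moreover have "(\<integral>x. x ^ i \<partial>M1) = (\<integral>x. x ^ i \<partial>M2)" for i
  proof -
    have "(\<integral>x. x ^ i \<partial>M1) = (\<integral>\<omega>. E t \<omega> ^ i \<partial>uniform_measure M ?B)"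
      unfolding M1_def by (subst integral_distr) auto
    also have "uniform_measure M ?B = density M (\<lambda>\<omega>. ennreal (indicator ?B \<omega> / w))"
      unfolding uniform_measure_def prob_B
      by (intro density_cong) (use w divide_ennreal[of 1 w] in \<open>auto simp: indicator_def\<close>)
    also have "(\<integral>\<omega>. E t \<omega> ^ i \<partial>density M (\<lambda>\<omega>. ennreal (indicator ?B \<omega> / w))) = expectation (\<lambda>\<omega>. (indicator ?B \<omega> / w) *\<^sub>R E t \<omega> ^ i)"
      using w by (subst integral_density) auto
    also have "\<dots> = expectation (\<lambda>\<omega>. E t \<omega> ^ i * of_bool (N t \<omega> = n) / w)"
      by (intro Bochner_Integration.integral_cong) (auto simp: indicator_def)
    also have "\<dots> = even_time_moment a i n t / w"
      using expectation_even_time_power[of t i n] t by simp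
    also have "\<dots> = (\<integral>x. x ^ i \<partial>M2)"
      unfolding M2_def using int[of i] d_nonneg by (subst integral_density) (auto simp: has_bochner_integral_iff)
    finally show ?thesis .
  qed
  ultimately have eq: "M1 = M2" by (rule real_distribution_eqI_moments)
  have "(\<integral>\<^sup>+\<omega>. indicator A (E t \<omega>) * indicator ?B \<omega> \<partial>M) / ennreal w = (\<integral>\<^sup>+u. indicator A u \<partial>M1)"
    unfolding M1_def by (subst nn_integral_distr) (auto simp: nn_integral_uniform_measure prob_B)
  also have "\<dots> = (\<integral>\<^sup>+u. ennreal (d u) * indicator A u \<partial>lborel)"
    unfolding eq M2_def by (subst nn_integral_density) auto
  finally have *: "(\<integral>\<^sup>+\<omega>. indicator A (E t \<omega>) * indicator ?B \<omega> \<partial>M) / ennreal w = (\<integral>\<^sup>+u. ennreal (d u) * indicator A u \<partial>lborel)" .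
  have "x = ennreal w * (x / ennreal w)" for x :: ennreal
    using w mult_divide_eq_ennreal[of "ennreal w" x] by (simp add: ennreal_times_divide mult.commute)
  from this[of "\<integral>\<^sup>+\<omega>. indicator A (E t \<omega>) * indicator ?B \<omega> \<partial>M"]
  have "(\<integral>\<^sup>+\<omega>. indicator A (E t \<omega>) * indicator ?B \<omega> \<partial>M) = ennreal w * (\<integral>\<^sup>+u. ennreal (d u) * indicator A u \<partial>lborel)"
    unfolding * .
  also have "\<dots> = (\<integral>\<^sup>+u. ennreal w * (ennreal (d u) * indicator A u) \<partial>lborel)"
    by (subst nn_integral_cmult) auto
  also have "\<dots> = (\<integral>\<^sup>+u. indicator A u * (indicator {0..t} u * ennreal (even_time_density a t n u)) \<partial>lborel)"
    using w d_nonneg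
    by (intro nn_integral_cong) (auto simp: d_def ennreal_mult'[symmetric] split: split_indicator)
  finally show ?thesis .
qed

text \<open>\<open>\<nu>\<close> will enumerate the positive even counts or the odd ones, whose
  contributions add up by monotone convergence. The count 0 has to be avoided, since it carries an
  atom.\<close>

lemma nn_integral_even_time_suminf:
  assumes t: "0 < t" and \<nu>: "inj \<nu>" "\<And>k. 0 < \<nu> k" and A [measurable]: "A \<in> sets borel"
    and D: "\<And>u. 0 \<le> u \<Longrightarrow> u \<le> t \<Longrightarrow> (\<lambda>k. even_time_density a t (\<nu> k) u) sums D u"
  shows "(\<integral>\<^sup>+\<omega>. indicator A (E t \<omega>) * indicator {\<omega> \<in> space M. N t \<omega> \<in> range \<nu>} \<omega> \<partial>M) =
    (\<integral>\<^sup>+u. indicator A u * ennreal (indicator {0..t} u * D u) \<partial>lborel)"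
proof -
  have [measurable]: "E t \<in> borel_measurable M" using t by (intro E_measurable) auto
  have [measurable]: "{\<omega> \<in> space M. N t \<omega> = n} \<in> events" for n using t by (intro event_N) auto
  have ind: "indicator {\<omega> \<in> space M. N t \<omega> \<in> range \<nu>} \<omega> = (\<Sum>k. indicator {\<omega> \<in> space M. N t \<omega> = \<nu> k} \<omega> :: ennreal)"
    if "\<omega> \<in> space M" for \<omega>
  proof (cases "N t \<omega> \<in> range \<nu>")
    case True
    then obtain k0 where k0: "N t \<omega> = \<nu> k0" by auto
    have "(\<lambda>k. indicator {\<omega> \<in> space M. N t \<omega> = \<nu> k} \<omega> :: ennreal) = (\<lambda>k. if k = k0 then 1 else 0)"
      using that k0 \<nu>(1) by (auto simp: indicator_def inj_def fun_eq_iff)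
    then show ?thesis using True that sums_unique[OF sums_single[of k0 "\<lambda>_. 1 :: ennreal"]] by simp
  next
    case False
    then have "(\<lambda>k. indicator {\<omega> \<in> space M. N t \<omega> = \<nu> k} \<omega> :: ennreal) = (\<lambda>k. 0)"
      by (auto simp: indicator_def fun_eq_iff)
    then show ?thesis using False by simp
  qed
  have "(\<integral>\<^sup>+\<omega>. indicator A (E t \<omega>) * indicator {\<omega> \<in> space M. N t \<omega> \<in> range \<nu>} \<omega> \<partial>M) =
      (\<integral>\<^sup>+\<omega>. (\<Sum>k. indicator A (E t \<omega>) * indicator {\<omega> \<in> space M. N t \<omega> = \<nu> k} \<omega>) \<partial>M)"
    by (intro nn_integral_cong) (simp add: ind)
  also have "\<dots> = (\<Sum>k. \<integral>\<^sup>+\<omega>. indicator A (E t \<omega>) * indicator {\<omega> \<in> space M. N t \<omega> = \<nu> k} \<omega> \<partial>M)"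
    by (intro nn_integral_suminf) measurable
  also have "\<dots> = (\<Sum>k. \<integral>\<^sup>+u. indicator A u * (indicator {0..t} u * ennreal (even_time_density a t (\<nu> k) u)) \<partial>lborel)"
    using t \<nu> by (simp add: nn_integral_even_time)
  also have "\<dots> = (\<integral>\<^sup>+u. (\<Sum>k. indicator A u * (indicator {0..t} u * ennreal (even_time_density a t (\<nu> k) u))) \<partial>lborel)"
    by (intro nn_integral_suminf[symmetric]) measurable
  also have "\<dots> = (\<integral>\<^sup>+u. indicator A u * ennreal (indicator {0..t} u * D u) \<partial>lborel)"
  proof (intro nn_integral_cong)
    fix u
    show "(\<Sum>k. indicator A u * (indicator {0..t} u * ennreal (even_time_density a t (\<nu> k) u))) = indicator A u * ennreal (indicator {0..t} u * D u)"
    proof (cases "0 \<le> u \<and> u \<le> t")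
      case True
      then have "(\<Sum>k. ennreal (even_time_density a t (\<nu> k) u)) = ennreal (D u)"
        using D[of u] a_pos
        by (subst suminf_ennreal2) (auto simp: even_time_density_def sums_iff)
      then show ?thesis using True by simp
    qed (auto simp: indicator_def)
  qed
  finally show ?thesis .
qed

end

section \<open>The velocity identity in one dimension\<close>

text \<open>A version centred at 0 with the value 0 outside the light cone. It is Borel and bounded
  by \<open>c\<close> whatever \<open>g\<close> is, and it agrees with the given velocity on the
  closed cone, where the process stays almost surely.\<close>

abbreviation vel :: "real \<Rightarrow> real \<Rightarrow> real \<Rightarrow> real \<Rightarrow> real" where
  "vel a c t y \<equiv> kac_velocity a c (\<lambda>_ _. 0) 0 t y"

lemma kac_velocity_eq_vel: "\<bar>x - x0\<bar> \<le> c * t \<Longrightarrow> kac_velocity a c g x0 t x = vel a c t (x - x0)"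
  by (auto simp: kac_velocity_def Let_def abs_if split: if_splits)

lemma borel_measurable_vel [measurable]: "vel a c t \<in> borel_measurable borel"
  unfolding kac_velocity_def[abs_def] Let_def deriv_bessel_I0 bessel_I0_eq kac_radius_def
  by measurable

text \<open>With \<open>x = \<beta> r\<close>, the factor \<open>r\<close> in front of
  \<open>I_0(x) / I_0'(x)\<close> cancels the factor \<open>x / 2\<close> contained in
  \<open>I_0'(x)\<close>. What remains is \<open>2 * bessel_J z / (a * bessel_G z)\<close>, free of
  square roots.\<close>

lemma vel_eq:
  assumes "0 < a" "0 < c" "\<bar>y\<bar> < c * t"
  defines "z \<equiv> a\<^sup>2 * (c\<^sup>2 * t\<^sup>2 - y\<^sup>2) / (4 * c\<^sup>2)"
  shows "vel a c t y = y * (a * bessel_G z) / (t * (a * bessel_G z) + 2 * bessel_J z)"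
proof -
  define r where "r = kac_radius c t y"
  have "\<bar>y\<bar>\<^sup>2 < (c * t)\<^sup>2" using assms(3) by (intro power_strict_mono) auto
  then have pos: "0 < c\<^sup>2 * t\<^sup>2 - y\<^sup>2" by (simp add: power_mult_distrib)
  then have r: "r > 0" "r\<^sup>2 = c\<^sup>2 * t\<^sup>2 - y\<^sup>2" by (simp_all add: r_def kac_radius_def)
  have z: "(a / c * r / 2)\<^sup>2 = z"
    unfolding z_def r(2)[symmetric] by (simp add: power_mult_distrib power_divide)
  have G: "bessel_G z > 0" using pos by (intro bessel_G_pos) (simp add: z_def)
  have J: "bessel_J z > 0" using pos by (intro bessel_J_pos) (simp add: z_def)
  have t: "t > 0" using assms by (metis abs_ge_zero order_le_less_trans zero_less_mult_pos)
  have "vel a c t y = y * inverse (t + r / c * (bessel_J z / (a / c * r / 2 * bessel_G z)))"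
    using assms(3) unfolding kac_velocity_def Let_def bessel_I0_eq deriv_bessel_I0 diff_0_right r_def[symmetric] z
    by (auto simp: abs_less_iff)
  also have "r / c * (bessel_J z / (a / c * r / 2 * bessel_G z)) = 2 * bessel_J z / (a * bessel_G z)"
    using r(1) assms by (simp add: field_simps)
  also have "y * inverse (t + 2 * bessel_J z / (a * bessel_G z)) = y * (a * bessel_G z) / (t * (a * bessel_G z) + 2 * bessel_J z)"
  proof -
    define A where "A = a * bessel_G z"
    have "A > 0" using G assms by (simp add: A_def)
    then show ?thesis unfolding A_def[symmetric] using J t
      by (simp add: field_simps)
  qed
  finally show ?thesis .
qed

text \<open>At time 0 the two edges of the cone coincide and oddness fails, whence
  \<open>0 < t\<close>.\<close>

lemma vel_odd: "0 < c \<Longrightarrow> 0 < t \<Longrightarrow> vel a c t (- y) = - vel a c t y"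
  by (auto simp: kac_velocity_def Let_def kac_radius_def mult_eq_0_iff)

text \<open>The positive term \<open>2 * bessel_J z\<close> only enlarges the denominator in
  \<open>vel_eq\<close>, so inside the cone the speed is at most \<open>|y| / t\<close>.\<close>

lemma vel_bound:
  assumes "0 < a" "0 < c"
  shows "\<bar>vel a c t y\<bar> \<le> c"
proof (cases "\<bar>y\<bar> < c * t")
  case True
  define z where "z = a\<^sup>2 * (c\<^sup>2 * t\<^sup>2 - y\<^sup>2) / (4 * c\<^sup>2)"
  have "\<bar>y\<bar>\<^sup>2 < (c * t)\<^sup>2" using True by (intro power_strict_mono) auto
  then have "0 \<le> z" by (simp add: power_mult_distrib z_def)
  then have G: "a * bessel_G z > 0" and J: "bessel_J z > 0" using assms by (auto intro!: mult_pos_pos bessel_G_pos bessel_J_pos)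
  have t: "t > 0" using assms True by (metis abs_ge_zero order_le_less_trans zero_less_mult_pos)
  define D where "D = t * (a * bessel_G z) + 2 * bessel_J z"
  have D: "D > 0" unfolding D_def using J by (intro add_pos_pos mult_pos_pos[OF t G]) auto
  have "\<bar>y\<bar> * (a * bessel_G z) \<le> (c * t) * (a * bessel_G z) + c * (2 * bessel_J z)"
    using True G J assms by (intro add_increasing2 mult_right_mono) auto
  also have "\<dots> = c * D" by (simp add: D_def algebra_simps)
  finally have "\<bar>y\<bar> * (a * bessel_G z) / D \<le> c" using D by (simp add: divide_le_eq)
  moreover have "\<bar>y * (a * bessel_G z) / D\<bar> = \<bar>y\<bar> * (a * bessel_G z) / D"
    using abs_of_pos[OF G] D by (simp add: abs_mult)
  ultimately show ?thesis
    unfolding vel_eq[OF assms True, folded z_def] D_def by simp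
next
  case False
  then show ?thesis using assms by (auto simp: kac_velocity_def abs_less_iff)
qed

section \<open>The one-dimensional process, split by the sign of B and the parity of N\<close>

locale kac_1d = poisson_paths M a N for M :: "'w measure" and a N +
  fixes c :: real and B :: "'w \<Rightarrow> real"
  assumes c_pos: "c > 0"
    and B_meas [measurable]: "B \<in> borel_measurable M"
    and B_plus: "prob {\<omega> \<in> space M. B \<omega> = 1} = 1 / 2"
    and B_minus: "prob {\<omega> \<in> space M. B \<omega> = - 1} = 1 / 2"
    and indep: "indep_set (sets (vimage_algebra (space M) B borel))
          (sets (vimage_algebra (space M) (\<lambda>\<omega>. \<lambda>t\<in>{0..}. N t \<omega>) (PiM {0..} (\<lambda>_. count_space UNIV))))"
begin

abbreviation paths_algebra :: "'w measure" where
  "paths_algebra \<equiv> vimage_algebra (space M) (\<lambda>\<omega>. \<lambda>t\<in>{0..}. N t \<omega>) (PiM {0..} (\<lambda>_. count_space UNIV))"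

definition position :: "real \<Rightarrow> 'w \<Rightarrow> real" where
  "position t \<omega> = B \<omega> * c * (2 * E t \<omega> - t)"

lemma AE_B: "AE \<omega> in M. B \<omega> = 1 \<or> B \<omega> = - 1"
proof -
  have "prob ({\<omega> \<in> space M. B \<omega> = 1} \<union> {\<omega> \<in> space M. B \<omega> = - 1}) = 1"
    by (subst finite_measure_Union) (auto simp: B_plus B_minus)
  then have "AE \<omega> in M. \<omega> \<in> {\<omega> \<in> space M. B \<omega> = 1} \<union> {\<omega> \<in> space M. B \<omega> = - 1}"
    by (intro AE_in_set_eq_1[THEN iffD2]) auto
  then show ?thesis by auto
qed

lemma N_paths_algebra: "t \<ge> 0 \<Longrightarrow> N t \<in> paths_algebra \<rightarrow>\<^sub>M count_space UNIV"
proof -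
  assume t: "t \<ge> 0"
  have "(\<lambda>\<omega>. \<lambda>t\<in>{0..}. N t \<omega>) \<in> paths_algebra \<rightarrow>\<^sub>M PiM {0..} (\<lambda>_. count_space UNIV)"
    by (rule measurable_vimage_algebra1) (auto simp: space_PiM)
  from measurable_compose[OF this measurable_component_singleton[of t]] t
  show ?thesis by simp
qed

text \<open>Measurability with respect to \<open>paths_algebra\<close> says that \<open>F\<close> is
  a functional of the Poisson path alone, hence independent of the sign. Freezing \<open>B\<close>
  at one of its values thus costs a factor 1/2.\<close>

lemma expectation_B_times:
  fixes F :: "'w \<Rightarrow> real"
  assumes F [measurable]: "F \<in> borel_measurable paths_algebra" and bdd: "\<And>\<omega>. \<omega> \<in> space M \<Longrightarrow> \<bar>F \<omega>\<bar> \<le> C"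
    and b: "b = 1 \<or> b = - 1"
  shows "expectation (\<lambda>\<omega>. of_bool (B \<omega> = b) * F \<omega>) = expectation F / 2"
    and "integrable M F" "integrable M (\<lambda>\<omega>. of_bool (B \<omega> = b) * F \<omega>)"
proof -
  let ?Y = "\<lambda>\<omega>. of_bool (B \<omega> = b) :: real"
  have sub: "sets paths_algebra \<subseteq> events" using indep_setD_ev2[OF indep] .
  have F_meas [measurable]: "F \<in> borel_measurable M"
    using F sub by (auto simp: measurable_def)
  have "indep_var borel ?Y borel F"
    unfolding indep_var_eq
  proof (intro conjI indep_setI)
    have Y: "sigma_sets (space M) {?Y -` A \<inter> space M |A. A \<in> sets borel} \<subseteq> sets (vimage_algebra (space M) B borel)"
    proof (rule sets.sigma_sets_subset[of _ "vimage_algebra (space M) B borel", simplified], safe)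
      fix A :: "real set" assume "A \<in> sets borel"
      have "?Y \<in> borel_measurable (vimage_algebra (space M) B borel)"
        by (rule measurable_compose[OF measurable_vimage_algebra1]) auto
      from measurable_sets[OF this \<open>A \<in> sets borel\<close>]
      show "?Y -` A \<inter> space M \<in> sets (vimage_algebra (space M) B borel)" by simp
    qed
    have F': "sigma_sets (space M) {F -` A \<inter> space M |A. A \<in> sets borel} \<subseteq> sets paths_algebra"
    proof (rule sets.sigma_sets_subset[of _ paths_algebra, simplified], safe)
      fix A :: "real set" assume "A \<in> sets borel"
      from measurable_sets[OF F this] show "F -` A \<inter> space M \<in> sets paths_algebra" by simp
    qed
    show "sigma_sets (space M) {?Y -` A \<inter> space M |A. A \<in> sets borel} \<subseteq> events"
      using Y indep_setD_ev1[OF indep] by blast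
    show "sigma_sets (space M) {F -` A \<inter> space M |A. A \<in> sets borel} \<subseteq> events"
      using F' sub by blast
    show "prob (x \<inter> y) = prob x * prob y"
      if "x \<in> sigma_sets (space M) {?Y -` A \<inter> space M |A. A \<in> sets borel}"
        "y \<in> sigma_sets (space M) {F -` A \<inter> space M |A. A \<in> sets borel}" for x y
      using indep_setD[OF indep] Y F' that by blast
  qed simp_all
  moreover have Y_int: "integrable M ?Y" by (rule integrable_const_bound[where B = 1]) auto
  moreover show F_int: "integrable M F" by (rule integrable_const_bound[where B = C]) (use bdd in auto)
  ultimately have "expectation (\<lambda>\<omega>. ?Y \<omega> * F \<omega>) = expectation ?Y * expectation F"
    by (rule indep_var_lebesgue_integral)
  moreover have "expectation ?Y = 1 / 2"
  proof -
    have "expectation ?Y = expectation (indicator {\<omega> \<in> space M. B \<omega> = b})"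
      by (intro Bochner_Integration.integral_cong) (auto simp: indicator_def)
    then show ?thesis using b B_plus B_minus by auto
  qed
  ultimately show "expectation (\<lambda>\<omega>. ?Y \<omega> * F \<omega>) = expectation F / 2" by simp
  show "integrable M (\<lambda>\<omega>. ?Y \<omega> * F \<omega>)"
    by (rule integrable_const_bound[where B = C]) (use bdd order_trans[OF abs_ge_zero bdd] in auto)
qed

lemma even_time_when_N_0: "\<omega> \<in> space M \<Longrightarrow> 0 \<le> t \<Longrightarrow> N t \<omega> = 0 \<Longrightarrow> E t \<omega> = t"
proof -
  assume *: "\<omega> \<in> space M" "0 \<le> t" "N t \<omega> = 0"
  interpret counting_path "\<lambda>t. N t \<omega>" by (rule counting_path) fact
  have "N s \<omega> = 0" if "0 < s" "s < t" for s using monoD[of s t] that * by auto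
  from even_time_diff_const[of 0 t, OF _ _ this] * show ?thesis by simp
qed

text \<open>The sum of \<open>even_time_density\<close> over \<open>n = 2 k + 2\<close>;
  \<open>odd_density\<close> is the one over \<open>n = 2 k + 1\<close>. Odd counts give
  \<open>u\<close> and \<open>t - u\<close> the same exponent \<open>k\<close>, so their density is
  symmetric under \<open>u \<mapsto> t - u\<close>; even counts give the exponents
  \<open>k + 1\<close> and \<open>k\<close>, whence the extra factor \<open>u\<close>. The atom at
  \<open>u = t\<close> from \<open>N(t) = 0\<close> is not included.\<close>

definition even_density :: "real \<Rightarrow> real \<Rightarrow> real" where
  "even_density t u = indicator {0..t} u * (exp (- (a * t)) * a\<^sup>2 * u * bessel_G (a\<^sup>2 * u * (t - u)))"

definition odd_density :: "real \<Rightarrow> real \<Rightarrow> real" where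
  "odd_density t u = indicator {0..t} u * (exp (- (a * t)) * a * bessel_J (a\<^sup>2 * u * (t - u)))"

lemma density_measurable [measurable]:
  "even_density t \<in> borel_measurable borel" "odd_density t \<in> borel_measurable borel"
  unfolding even_density_def odd_density_def by measurable

lemma density_nonneg: "0 \<le> even_density t u" "0 \<le> odd_density t u"
  using a_pos bessel_G_pos[of "a\<^sup>2 * u * (t - u)"] bessel_J_pos[of "a\<^sup>2 * u * (t - u)"]
  by (auto simp: even_density_def odd_density_def indicator_def)

lemma expectation_even:
  fixes f :: "real \<Rightarrow> real"
  assumes t: "0 < t" and f: "f \<in> borel_measurable borel" "\<And>u. \<bar>f u\<bar> \<le> C"
  shows "integrable lborel (\<lambda>u. even_density t u * f u)"
    and "expectation (\<lambda>\<omega>. f (E t \<omega>) * indicator {\<omega> \<in> space M. even (N t \<omega>) \<and> 0 < N t \<omega>} \<omega>) = (LBINT u. even_density t u * f u)"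
proof -
  have E: "E t \<in> borel_measurable M" using t by (intro E_measurable) auto
  have ev: "{\<omega> \<in> space M. even (N t \<omega>) \<and> 0 < N t \<omega>} \<in> events" using t by (intro event_N) auto
  have range: "n \<in> range (\<lambda>k. 2 * k + 2) \<longleftrightarrow> even n \<and> 0 < n" for n :: nat
    by (auto simp: image_iff elim!: evenE intro!: exI[of _ "n div 2 - 1"])
  have D: "(\<lambda>k. even_time_density a t (2 * k + 2) u) sums (exp (- (a * t)) * a\<^sup>2 * u * bessel_G (a\<^sup>2 * u * (t - u)))" for u
  proof -
    have "(\<lambda>k. exp (- (a * t)) * a\<^sup>2 * u * ((a\<^sup>2 * u * (t - u)) ^ k / (fact k * fact (Suc k)))) sums
      (exp (- (a * t)) * a\<^sup>2 * u * bessel_G (a\<^sup>2 * u * (t - u)))"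
      unfolding bessel_G_def by (intro sums_mult summable_sums summable_bessel_G)
    moreover have "even_time_density a t (2 * k + 2) u = exp (- (a * t)) * a\<^sup>2 * u * ((a\<^sup>2 * u * (t - u)) ^ k / (fact k * fact (Suc k)))" for k
      using power_add[of a k k]
      by (simp add: even_time_density_def mult_2_right[symmetric] power_mult_distrib power_add power_mult[symmetric] power2_eq_square mult_ac del: fact_Suc)
    ultimately show ?thesis by simp
  qed
  have law: "(\<integral>\<^sup>+\<omega>. indicator A (E t \<omega>) * indicator {\<omega> \<in> space M. even (N t \<omega>) \<and> 0 < N t \<omega>} \<omega> \<partial>M) =
      (\<integral>\<^sup>+u. indicator A u * ennreal (even_density t u) \<partial>lborel)" if "A \<in> sets borel" for A
    using nn_integral_even_time_suminf[OF t _ _ that D] unfolding range even_density_def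
    by (simp add: inj_def)
  show "integrable lborel (\<lambda>u. even_density t u * f u)"
    "expectation (\<lambda>\<omega>. f (E t \<omega>) * indicator {\<omega> \<in> space M. even (N t \<omega>) \<and> 0 < N t \<omega>} \<omega>) = (LBINT u. even_density t u * f u)"
    using expectation_eq_density[OF E ev density_measurable(1) f(1) density_nonneg(1) f(2) law] by auto
qed

lemma expectation_odd:
  fixes f :: "real \<Rightarrow> real"
  assumes t: "0 < t" and f: "f \<in> borel_measurable borel" "\<And>u. \<bar>f u\<bar> \<le> C"
  shows "integrable lborel (\<lambda>u. odd_density t u * f u)"
    and "expectation (\<lambda>\<omega>. f (E t \<omega>) * indicator {\<omega> \<in> space M. odd (N t \<omega>)} \<omega>) = (LBINT u. odd_density t u * f u)"
proof -
  have E: "E t \<in> borel_measurable M" using t by (intro E_measurable) auto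
  have ev: "{\<omega> \<in> space M. odd (N t \<omega>)} \<in> events" using t by (intro event_N) auto
  have range: "n \<in> range (\<lambda>k. 2 * k + 1) \<longleftrightarrow> odd n" for n :: nat
    by (auto simp: image_iff elim!: oddE)
  have D: "(\<lambda>k. even_time_density a t (2 * k + 1) u) sums (exp (- (a * t)) * a * bessel_J (a\<^sup>2 * u * (t - u)))" for u
  proof -
    have "(\<lambda>k. exp (- (a * t)) * a * ((a\<^sup>2 * u * (t - u)) ^ k / (fact k)\<^sup>2)) sums
      (exp (- (a * t)) * a * bessel_J (a\<^sup>2 * u * (t - u)))"
      unfolding bessel_J_def by (intro sums_mult summable_sums summable_bessel_J)
    moreover have "even_time_density a t (2 * k + 1) u = exp (- (a * t)) * a * ((a\<^sup>2 * u * (t - u)) ^ k / (fact k)\<^sup>2)" for k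
      using power_add[of a k k]
      by (simp add: even_time_density_def mult_2_right[symmetric] power_mult_distrib power_add power_mult[symmetric] power2_eq_square mult_ac)
    ultimately show ?thesis by simp
  qed
  have law: "(\<integral>\<^sup>+\<omega>. indicator A (E t \<omega>) * indicator {\<omega> \<in> space M. odd (N t \<omega>)} \<omega> \<partial>M) =
      (\<integral>\<^sup>+u. indicator A u * ennreal (odd_density t u) \<partial>lborel)" if "A \<in> sets borel" for A
    using nn_integral_even_time_suminf[OF t _ _ that D] unfolding range odd_density_def
    by (simp add: inj_def)
  show "integrable lborel (\<lambda>u. odd_density t u * f u)"
    "expectation (\<lambda>\<omega>. f (E t \<omega>) * indicator {\<omega> \<in> space M. odd (N t \<omega>)} \<omega>) = (LBINT u. odd_density t u * f u)"
    using expectation_eq_density[OF E ev density_measurable(2) f(1) density_nonneg(2) f(2) law] by auto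
qed

text \<open>At the position \<open>c (2 u - t)\<close>, upward motion arises from
  \<open>B = 1\<close> with an even count and occupation time \<open>u\<close>, or from
  \<open>B = - 1\<close> with an odd count and occupation time \<open>t - u\<close>; downward motion
  comes from the two remaining combinations. Since the odd density is symmetric, the identity says
  that the upward density times \<open>c - v\<close> equals the downward density times
  \<open>c + v\<close>, that is, \<open>v\<close> is the mean velocity at this position. It holds
  because the even densities at \<open>u\<close> and \<open>t - u\<close> have a difference
  proportional to \<open>(2 u - t) * bessel_G z\<close> and a sum proportional to
  \<open>t * bessel_G z\<close>, the terms in \<open>vel_eq\<close>.\<close>

lemma density_balance:
  assumes u: "0 < u" "u < t"
  defines "v \<equiv> vel a c t (c * (2 * u - t))"
  shows "even_density t u * (c - v) - even_density t (t - u) * (c + v) = 2 * v * odd_density t u"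
proof -
  define z where "z = a\<^sup>2 * u * (t - u)"
  have z: "a\<^sup>2 * (c\<^sup>2 * t\<^sup>2 - (c * (2 * u - t))\<^sup>2) / (4 * c\<^sup>2) = z"
    using c_pos by (simp add: z_def field_simps power2_eq_square)
  have zt: "a\<^sup>2 * (t - u) * u = z" by (simp add: z_def)
  have "0 \<le> z" using u by (simp add: z_def)
  then have G: "a * bessel_G z > 0" and J: "bessel_J z > 0" using a_pos by (auto intro!: mult_pos_pos bessel_G_pos bessel_J_pos)
  have "\<bar>c * (2 * u - t)\<bar> < c * t" using u c_pos by (auto simp: abs_mult abs_less_iff)
  from vel_eq[OF a_pos c_pos this, unfolded z]
  have v: "v * (t * (a * bessel_G z) + 2 * bessel_J z) = c * (2 * u - t) * (a * bessel_G z)"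
    using nonzero_eq_divide_eq[of "t * (a * bessel_G z) + 2 * bessel_J z" v] add_pos_pos[OF mult_pos_pos[OF _ G, of t], of "2 * bessel_J z"] J u
    unfolding v_def by simp
  have "even_density t u * (c - v) - even_density t (t - u) * (c + v) - 2 * v * odd_density t u =
     exp (- (a * t)) * a * (c * (2 * u - t) * (a * bessel_G z) - v * (t * (a * bessel_G z) + 2 * bessel_J z))"
    using u unfolding even_density_def odd_density_def
    by (simp add: zt z_def[symmetric]) (simp add: algebra_simps power2_eq_square)
  then show ?thesis using v by simp
qed

text \<open>The case \<open>B = 1\<close>. Odd functions suffice because averaging over the two
  signs leaves only the odd part of a test function.\<close>

lemma expectation_symmetrized:
  fixes \<phi> :: "real \<Rightarrow> real"
  assumes t: "0 < t" and \<phi>_meas [measurable]: "\<phi> \<in> borel_measurable borel" and \<phi>: "\<And>y. \<bar>\<phi> y\<bar> \<le> C"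
    and odd: "\<And>y. \<phi> (- y) = - \<phi> y"
  shows "expectation (\<lambda>\<omega>. \<phi> (c * (2 * E t \<omega> - t)) * (c * (- 1) ^ N t \<omega> - vel a c t (c * (2 * E t \<omega> - t)))) = 0"
proof -
  define v where "v u = vel a c t (c * (2 * u - t))" for u
  define x where "x u = \<phi> (c * (2 * u - t))" for u
  have [measurable]: "v \<in> borel_measurable borel" "x \<in> borel_measurable borel"
    unfolding v_def x_def by measurable
  define f where "f u = x u * (c - v u)" for u
  define g where "g u = x u * (- c - v u)" for u
  have [measurable]: "f \<in> borel_measurable borel" "g \<in> borel_measurable borel"
    unfolding f_def g_def by measurable
  have v_bound: "\<bar>v u\<bar> \<le> c" for u unfolding v_def by (rule vel_bound[OF a_pos c_pos])
  have C: "0 \<le> C" using \<phi>[of 0] by linarith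
  have f_bound: "\<bar>f u\<bar> \<le> C * (2 * c)" and g_bound: "\<bar>g u\<bar> \<le> C * (2 * c)" for u
    unfolding f_def g_def x_def abs_mult using v_bound[of u] c_pos C
    by (intro mult_mono \<phi>; auto)+
  have [measurable]: "E t \<in> borel_measurable M" using t by (intro E_measurable) auto
  have ev [measurable]: "{\<omega> \<in> space M. even (N t \<omega>) \<and> 0 < N t \<omega>} \<in> events" "{\<omega> \<in> space M. odd (N t \<omega>)} \<in> events"
    using t by (auto intro!: event_N)
  note even = expectation_even[OF t \<open>f \<in> _\<close> f_bound] and odd' = expectation_odd[OF t \<open>g \<in> _\<close> g_bound]
  define h where "h u = even_density t u * f u + odd_density t u * g u" for u
  have h_int: "integrable lborel h" unfolding h_def using even(1) odd'(1) by simp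
  have "expectation (\<lambda>\<omega>. x (E t \<omega>) * (c * (- 1) ^ N t \<omega> - v (E t \<omega>))) =
    expectation (\<lambda>\<omega>. f (E t \<omega>) * indicator {\<omega> \<in> space M. even (N t \<omega>) \<and> 0 < N t \<omega>} \<omega> +
      g (E t \<omega>) * indicator {\<omega> \<in> space M. odd (N t \<omega>)} \<omega>)"
  proof (intro Bochner_Integration.integral_cong refl)
    fix \<omega> assume \<omega>: "\<omega> \<in> space M"
    \<comment> \<open>Without a jump the occupation time is \<open>t\<close>, where the prescribed
      edge value is the actual velocity. The atom missing from the densities thus contributes
      nothing.\<close>
    have "v t = c" by (simp add: v_def kac_velocity_def)
    then have "v (E t \<omega>) = c" if "N t \<omega> = 0" using even_time_when_N_0[OF \<omega> _ that] t by simp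
    then show "x (E t \<omega>) * (c * (- 1) ^ N t \<omega> - v (E t \<omega>)) =
      f (E t \<omega>) * indicator {\<omega> \<in> space M. even (N t \<omega>) \<and> 0 < N t \<omega>} \<omega> + g (E t \<omega>) * indicator {\<omega> \<in> space M. odd (N t \<omega>)} \<omega>"
      using \<omega> by (cases "N t \<omega> = 0") (auto simp: f_def g_def indicator_def)
  qed
  also have "\<dots> = (LBINT u. h u)"
    unfolding h_def even(2)[symmetric] odd'(2)[symmetric] Bochner_Integration.integral_add[OF even(1) odd'(1)]
    by (intro Bochner_Integration.integral_add integrable_const_bound[where B = "C * (2 * c)"])
       (use f_bound g_bound order_trans[OF abs_ge_zero f_bound] in \<open>auto simp: indicator_def\<close>)
  also have "\<dots> = 0"
  proof -
    \<comment> \<open>\<open>h\<close> need not vanish pointwise, but it is antisymmetric under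
      \<open>u \<mapsto> t - u\<close> off the endpoints: \<open>v\<close> and \<open>x\<close>
      change sign there, and \<open>density_balance\<close> cancels the rest. Its integral therefore
      equals its own negative.\<close>
    have refl: "(LBINT u. h u) = (LBINT u. h (t - u))"
      using lborel_integral_real_affine[of "- 1" h t] by simp
    have refl_int: "integrable lborel (\<lambda>u. h (t - u))"
      using lborel_integrable_real_affine[OF h_int, of "- 1" t] by simp
    have "(LBINT u. h u) + (LBINT u. h (t - u)) = (LBINT u. h u + h (t - u))"
      using h_int refl_int by simp
    also have "\<dots> = (LBINT u::real. 0)"
    proof (rule integral_cong_AE)
      have H: "h u + h (t - u) = 0" if "u \<noteq> 0" "u \<noteq> t" for u
      proof (cases "0 < u \<and> u < t")
        case True
        have arg: "c * (2 * (t - u) - t) = - (c * (2 * u - t))" by (simp add: algebra_simps)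
        have "v (t - u) = - v u" "x (t - u) = - x u"
          unfolding v_def x_def arg by (simp_all add: odd vel_odd c_pos t)
        moreover have "odd_density t (t - u) = odd_density t u"
          using True by (simp add: odd_density_def mult_ac)
        ultimately have "h u + h (t - u) = x u * (even_density t u * (c - v u) - even_density t (t - u) * (c + v u) - 2 * v u * odd_density t u)"
          by (simp add: h_def f_def g_def algebra_simps)
        also have "\<dots> = 0" using density_balance[of u t] True by (simp add: v_def)
        finally show ?thesis .
      next
        case False
        then show ?thesis using that by (auto simp: h_def even_density_def odd_density_def indicator_def)
      qed
      show "AE u in lborel. h u + h (t - u) = 0"
        using AE_lborel_singleton[of 0] AE_lborel_singleton[of t] by eventually_elim (rule H)
    qed (use h_int refl_int in auto)
    finally show ?thesis using refl by simp
  qed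
  finally show ?thesis by (simp add: x_def v_def)
qed

text \<open>Orthogonality to all bounded functions of the position is what characterises the
  conditional expectation. \<open>F b\<close> freezes \<open>B\<close> at \<open>b\<close>; as
  \<open>vel\<close> is odd, \<open>F 1 + F (- 1)\<close> is \<open>\<psi> y - \<psi> (- y)\<close>
  times a factor free of \<open>B\<close>, and the symmetrised identity applies.\<close>

lemma expectation_velocity:
  fixes \<psi> :: "real \<Rightarrow> real"
  assumes t: "0 < t" and \<psi>_meas [measurable]: "\<psi> \<in> borel_measurable borel" and \<psi>: "\<And>y. \<bar>\<psi> y\<bar> \<le> C"
  shows "expectation (\<lambda>\<omega>. \<psi> (position t \<omega>) * (c * B \<omega> * (- 1) ^ N t \<omega> - vel a c t (position t \<omega>))) = 0"
proof -
  let ?y = "\<lambda>\<omega>. c * (2 * E t \<omega> - t)"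
  define F where "F b \<omega> = \<psi> (b * ?y \<omega>) * (b * (c * (- 1) ^ N t \<omega>) - vel a c t (b * ?y \<omega>))" for b \<omega>
  have E_paths: "E t \<in> borel_measurable paths_algebra"
    using t by (intro measurable_even_time N_paths_algebra counting_path) auto
  have sign_paths: "(\<lambda>\<omega>. (- 1) ^ N t \<omega> :: real) \<in> borel_measurable paths_algebra"
    using t by (intro measurable_compose[OF N_paths_algebra]) auto
  have F_meas: "F b \<in> borel_measurable paths_algebra" for b
    unfolding F_def[abs_def] using E_paths sign_paths by measurable
  have C: "0 \<le> C" using \<psi>[of 0] by linarith
  have F_bound: "\<bar>F b \<omega>\<bar> \<le> C * (2 * c)" if "b = 1 \<or> b = - 1" for b \<omega>
  proof -
    have "\<bar>b * (c * (- 1) ^ N t \<omega>) - vel a c t (b * ?y \<omega>)\<bar> \<le> 2 * c"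
      using vel_bound[OF a_pos c_pos, of t "b * ?y \<omega>"] that c_pos
      by (cases "even (N t \<omega>)") (auto simp: abs_le_iff)
    then show ?thesis unfolding F_def abs_mult using C by (intro mult_mono \<psi>) auto
  qed
  note plus = expectation_B_times[OF F_meas F_bound, of 1 1] and minus = expectation_B_times[OF F_meas F_bound, of "- 1" "- 1"]
  have "expectation (\<lambda>\<omega>. \<psi> (position t \<omega>) * (c * B \<omega> * (- 1) ^ N t \<omega> - vel a c t (position t \<omega>))) =
    expectation (\<lambda>\<omega>. of_bool (B \<omega> = 1) * F 1 \<omega> + of_bool (B \<omega> = - 1) * F (- 1) \<omega>)"
  proof (rule integral_cong_AE)
    have [measurable]: "E t \<in> borel_measurable M" using t by (intro E_measurable) auto
    have [measurable]: "(\<lambda>\<omega>. (- 1) ^ N t \<omega> :: real) \<in> borel_measurable M"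
      using t by (intro measurable_compose[OF N_measurable]) auto
    show "(\<lambda>\<omega>. \<psi> (position t \<omega>) * (c * B \<omega> * (- 1) ^ N t \<omega> - vel a c t (position t \<omega>))) \<in> borel_measurable M"
      unfolding position_def by measurable
    show "(\<lambda>\<omega>. of_bool (B \<omega> = 1) * F 1 \<omega> + of_bool (B \<omega> = - 1) * F (- 1) \<omega>) \<in> borel_measurable M"
      using plus(3) minus(3) by (intro borel_measurable_add) auto
    show "AE \<omega> in M. \<psi> (position t \<omega>) * (c * B \<omega> * (- 1) ^ N t \<omega> - vel a c t (position t \<omega>)) =
      of_bool (B \<omega> = 1) * F 1 \<omega> + of_bool (B \<omega> = - 1) * F (- 1) \<omega>"
      using AE_B by eventually_elim (auto simp: F_def position_def)
  qed
  also have "\<dots> = (expectation (F 1) + expectation (F (- 1))) / 2"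
    using plus minus by (simp add: add_divide_distrib)
  also have "expectation (F 1) + expectation (F (- 1)) = expectation (\<lambda>\<omega>. F 1 \<omega> + F (- 1) \<omega>)"
    using plus(2) minus(2) by simp
  also have "\<dots> = expectation (\<lambda>\<omega>. (\<lambda>y. \<psi> y - \<psi> (- y)) (c * (2 * E t \<omega> - t)) * (c * (- 1) ^ N t \<omega> - vel a c t (c * (2 * E t \<omega> - t))))"
    using vel_odd[OF c_pos t, of a]
    by (intro Bochner_Integration.integral_cong refl) (simp only: F_def mult_1 mult_minus1, simp add: algebra_simps)
  also have "\<dots> = 0"
  proof (rule expectation_symmetrized[OF t])
    fix y show "\<bar>\<psi> y - \<psi> (- y)\<bar> \<le> 2 * C" using \<psi>[of y] \<psi>[of "- y"] by linarith
  qed auto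
  finally show ?thesis by simp
qed

end

section \<open>Conditional expectation of the velocity\<close>

text \<open>One-sided derivatives along fixed sequences read only countably many coordinates of the
  path, which makes them measurable. The sequence of \<open>left_diff\<close> starts at time 0 and
  so stays among nonnegative times.\<close>

definition right_diff :: "real \<Rightarrow> (real \<Rightarrow> real) \<Rightarrow> real" where
  "right_diff t k = lim (\<lambda>n. (k (t + 1 / real (Suc n)) - k t) / (t + 1 / real (Suc n) - t))"

definition left_diff :: "real \<Rightarrow> (real \<Rightarrow> real) \<Rightarrow> real" where
  "left_diff t k = lim (\<lambda>n. (k (t - t / real (Suc n)) - k t) / (t - t / real (Suc n) - t))"

lemma right_diff_eq:
  assumes "(k has_real_derivative D) (at_right t)"
  shows "right_diff t k = D"
proof -
  have "filterlim (\<lambda>n. t + 1 / real (Suc n)) (at_right t) sequentially"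
    unfolding filterlim_at
  proof
    have "(\<lambda>n. t + 1 / real (Suc n)) \<longlonglongrightarrow> t + 0"
      by (intro tendsto_intros LIMSEQ_Suc[OF lim_1_over_n])
    then show "(\<lambda>n. t + 1 / real (Suc n)) \<longlonglongrightarrow> t" by simp
  qed auto
  from filterlim_compose[OF assms[unfolded has_field_derivative_iff] this]
  show ?thesis unfolding right_diff_def by (rule limI)
qed

lemma left_diff_eq:
  assumes "(k has_real_derivative D) (at_left t)" "0 < t"
  shows "left_diff t k = D"
proof -
  have "filterlim (\<lambda>n. t - t / real (Suc n)) (at_left t) sequentially"
    unfolding filterlim_at
  proof
    have "(\<lambda>n. t - t * (1 / real (Suc n))) \<longlonglongrightarrow> t - t * 0"
      by (intro tendsto_intros LIMSEQ_Suc[OF lim_1_over_n])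
    then show "(\<lambda>n. t - t / real (Suc n)) \<longlonglongrightarrow> t" by simp
  qed (use assms(2) in auto)
  from filterlim_compose[OF assms(1)[unfolded has_field_derivative_iff] this]
  show ?thesis unfolding left_diff_def by (rule limI)
qed

text \<open>\<open>deriv\<close> is an unspecified constant at points of non-differentiability.\<close>

lemma deriv_eq_one_sided:
  fixes k :: "real \<Rightarrow> real"
  assumes "(k has_real_derivative D1) (at_right t)" "(k has_real_derivative D2) (at_left t)"
  shows "deriv k t = (if D1 = D2 then D1 else (SOME D. False))"
proof (cases "D1 = D2")
  case True
  then have "(k has_real_derivative D1) (at t)"
    using assms by (auto simp: has_field_derivative_iff filterlim_at_split)
  then show ?thesis using True by (simp add: DERIV_imp_deriv)
next
  case False
  have "\<not> (k has_real_derivative D) (at t)" for D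
  proof
    assume D: "(k has_real_derivative D) (at t)"
    have "D = D1" "D = D2"
      using tendsto_unique[OF _ D[THEN has_field_derivative_at_within, unfolded has_field_derivative_iff]
          assms(1)[unfolded has_field_derivative_iff]]
        tendsto_unique[OF _ D[THEN has_field_derivative_at_within, unfolded has_field_derivative_iff]
          assms(2)[unfolded has_field_derivative_iff]] by auto
    then show False using False by simp
  qed
  then show ?thesis using False by (simp add: deriv_def)
qed

context kac_1d
begin

lemma position_measurable [measurable]: "0 \<le> t \<Longrightarrow> position t \<in> borel_measurable M"
  unfolding position_def[abs_def] using E_measurable[of t] by measurable

lemma N_sign_measurable [measurable]: "0 \<le> t \<Longrightarrow> (\<lambda>\<omega>. (- 1) ^ N t \<omega> :: real) \<in> borel_measurable M"
  by (rule measurable_compose[OF N_measurable]) auto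

lemma position_0: "position 0 \<omega> = 0"
  by (simp add: position_def even_time_def)

lemma AE_position_bound: "0 \<le> t \<Longrightarrow> AE \<omega> in M. \<bar>position t \<omega>\<bar> \<le> c * t"
  using AE_B AE_space
proof eventually_elim
  case (elim \<omega>)
  then have "\<bar>2 * E t \<omega> - t\<bar> \<le> t" using E_bounds[of \<omega> t] by (auto simp: abs_le_iff)
  then show ?case using elim c_pos by (auto simp: position_def abs_mult)
qed

lemma position_deriv_right:
  assumes "\<omega> \<in> space M" "0 \<le> t"
  shows "((\<lambda>s. position s \<omega>) has_real_derivative c * B \<omega> * (- 1) ^ N t \<omega>) (at_right t)"
  unfolding position_def
  by (rule derivative_eq_intros counting_path.even_time_deriv_right[OF counting_path] assms refl)+
     (simp add: uminus_power_if)

lemma position_deriv_left: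
  assumes "\<omega> \<in> space M" "0 < t"
  obtains q where "((\<lambda>s. position s \<omega>) has_real_derivative c * B \<omega> * (- 1) ^ q) (at_left t)"
    and "t \<notin> counting_path.jumps (\<lambda>s. N s \<omega>) \<Longrightarrow> q = N t \<omega>"
proof -
  interpret counting_path "\<lambda>s. N s \<omega>" by (rule counting_path) fact
  obtain q where q: "((\<lambda>s. E s \<omega>) has_real_derivative of_bool (even q)) (at_left t)" "t \<notin> jumps \<Longrightarrow> q = N t \<omega>"
    using even_time_deriv_left[OF assms(2)] by blast
  have "((\<lambda>s. position s \<omega>) has_real_derivative c * B \<omega> * (- 1) ^ q) (at_left t)"
    unfolding position_def
    by (rule derivative_eq_intros q(1) refl)+ (simp add: uminus_power_if)
  then show ?thesis using q(2) that by blast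
qed

text \<open>A jump at \<open>t\<close> forces a nonzero increment between \<open>s k\<close> and
  \<open>t\<close> for every \<open>k\<close>. Such an increment has probability
  \<open>1 - exp (- (a * (t - s k)))\<close>, and \<open>s k\<close> tends to
  \<open>t\<close>.\<close>

lemma AE_no_jump:
  assumes t: "0 < t"
  shows "AE \<omega> in M. t \<notin> counting_path.jumps (\<lambda>s. N s \<omega>)"
proof -
  define s where "s k = t - t / real (Suc k)" for k
  have s: "0 \<le> s k" "s k < t" for k using t by (auto simp: s_def field_simps)
  define A where "A k = {\<omega> \<in> space M. N t \<omega> - N (s k) \<omega> \<noteq> 0}" for k
  have A [measurable]: "A k \<in> events" for k
    using measurable_sets[OF increment_measurable[OF s(1)[of k] less_imp_le[OF t]], of "- {0}"]
    by (simp add: A_def vimage_def Int_def conj_commute)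
  have prob_A: "prob (A k) = 1 - exp (- (a * (t - s k)))" for k
  proof -
    have "1 - prob (A k) = prob (space M - A k)" by (rule prob_compl[symmetric]) simp
    also have "\<dots> = expectation (indicator (space M - A k))" by simp
    also have "\<dots> = expectation (\<lambda>\<omega>. of_bool (N t \<omega> - N (s k) \<omega> = 0))"
      by (intro Bochner_Integration.integral_cong) (auto simp: A_def indicator_def)
    also have "\<dots> = exp (- (a * (t - s k)))"
      using s[of k] by (subst expectation_increment) (auto simp: poisson_weight_def)
    finally show ?thesis by simp
  qed
  have "prob (\<Inter>k. A k) \<le> 0"
  proof (rule LIMSEQ_le_const)
    have "(\<lambda>n. 1 - exp (- (a * (t * (1 / real (Suc n)))))) \<longlonglongrightarrow> 1 - exp (- (a * (t * 0)))"
      by (intro tendsto_intros LIMSEQ_Suc[OF lim_1_over_n])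
    then show "(\<lambda>k. prob (A k)) \<longlonglongrightarrow> 0" by (simp add: prob_A s_def)
    show "\<exists>N. \<forall>n\<ge>N. prob (\<Inter>k. A k) \<le> prob (A n)"
      by (intro exI allI impI finite_measure_mono) auto
  qed
  then have "AE \<omega> in M. \<omega> \<notin> (\<Inter>k. A k)"
    by (intro AE_not_in null_setsI) (auto simp: emeasure_eq_measure measure_le_0_iff)
  then show ?thesis using AE_space
  proof eventually_elim
    case (elim \<omega>)
    interpret counting_path "\<lambda>s. N s \<omega>" by (rule counting_path) fact
    obtain k where "\<omega> \<notin> A k" using elim by auto
    then have eq: "N (s k) \<omega> = N t \<omega>" using monoD[of "s k" t] s[of k] elim by (auto simp: A_def)
    obtain d where d: "d > 0" "\<And>u. t \<le> u \<Longrightarrow> u < t + d \<Longrightarrow> N u \<omega> = N t \<omega>"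
      using right_const[of t] t by auto
    have "N u \<omega> = N t \<omega>" if "\<bar>u - t\<bar> < min d (t - s k)" for u
    proof (cases "t \<le> u")
      case True then show ?thesis using that by (intro d(2)) auto
    next
      case False
      then show ?thesis using monoD[of "s k" u] monoD[of u t] that s[of k] eq by auto
    qed
    moreover have "min d (t - s k) > 0" using d(1) s[of k] by simp
    ultimately show ?case unfolding jumps_def by blast
  qed
qed

section \<open>Derivative and conditional expectation of the shifted process\<close>

context
  fixes X :: "real \<Rightarrow> 'w \<Rightarrow> real" and x0 :: real
  assumes X: "\<And>t \<omega>. 0 \<le> t \<Longrightarrow> \<omega> \<in> space M \<Longrightarrow> X t \<omega> = x0 + position t \<omega>"
begin

lemma X_measurable [measurable]: "0 \<le> t \<Longrightarrow> X t \<in> borel_measurable M"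
  using position_measurable[of t] by (subst measurable_cong[OF X]) auto

lemma X_deriv_right:
  assumes "\<omega> \<in> space M" "0 \<le> t"
  shows "((\<lambda>s. X s \<omega>) has_real_derivative c * B \<omega> * (- 1) ^ N t \<omega>) (at_right t)"
proof (rule has_field_derivative_cong_eventually[THEN iffD2])
  show "((\<lambda>s. x0 + position s \<omega>) has_real_derivative c * B \<omega> * (- 1) ^ N t \<omega>) (at_right t)"
    by (rule derivative_eq_intros position_deriv_right assms refl)+ simp
  show "eventually (\<lambda>s. X s \<omega> = x0 + position s \<omega>) (at_right t)"
    unfolding eventually_at_filter using assms X by simp
qed (use assms X in auto)

lemma right_diff_X:
  assumes "\<omega> \<in> space M" "0 \<le> t"
  shows "right_diff t (\<lambda>s. X s \<omega>) = c * B \<omega> * (- 1) ^ N t \<omega>"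
  by (rule right_diff_eq[OF X_deriv_right[OF assms]])

lemma X_deriv_left:
  assumes "\<omega> \<in> space M" "0 < t"
  obtains q where "((\<lambda>s. X s \<omega>) has_real_derivative c * B \<omega> * (- 1) ^ q) (at_left t)"
    and "t \<notin> counting_path.jumps (\<lambda>s. N s \<omega>) \<Longrightarrow> q = N t \<omega>"
proof -
  obtain q where q: "((\<lambda>s. position s \<omega>) has_real_derivative c * B \<omega> * (- 1) ^ q) (at_left t)"
    "t \<notin> counting_path.jumps (\<lambda>s. N s \<omega>) \<Longrightarrow> q = N t \<omega>"
    using position_deriv_left[OF assms] by blast
  have "((\<lambda>s. X s \<omega>) has_real_derivative c * B \<omega> * (- 1) ^ q) (at_left t)"
  proof (rule has_field_derivative_cong_eventually[THEN iffD2])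
    show "((\<lambda>s. x0 + position s \<omega>) has_real_derivative c * B \<omega> * (- 1) ^ q) (at_left t)"
      by (rule derivative_eq_intros q(1) refl)+ simp
    show "eventually (\<lambda>s. X s \<omega> = x0 + position s \<omega>) (at_left t)"
      unfolding eventually_at_left_field using assms X by (intro exI[of _ 0]) auto
  qed (use assms X in auto)
  then show ?thesis using q(2) that by blast
qed

lemma X_deriv:
  assumes "\<omega> \<in> space M" "0 < t" "t \<notin> counting_path.jumps (\<lambda>s. N s \<omega>)"
  shows "((\<lambda>s. X s \<omega>) has_real_derivative c * B \<omega> * (- 1) ^ N t \<omega>) (at t)"
proof -
  obtain q where "((\<lambda>s. X s \<omega>) has_real_derivative c * B \<omega> * (- 1) ^ q) (at_left t)" "q = N t \<omega>"
    using X_deriv_left[OF assms(1,2)] assms(3) by blast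
  then show ?thesis using X_deriv_right[of \<omega> t] assms
    by (auto simp: has_field_derivative_iff filterlim_at_split)
qed

text \<open>Every path has both one-sided derivatives at \<open>t\<close>, so \<open>deriv\<close>
  is their common value or, where they differ, one fixed constant. This gives measurability on the
  whole space rather than up to a null set.\<close>

lemma deriv_X_measurable:
  assumes t: "0 < t"
  shows "(\<lambda>\<omega>. deriv (\<lambda>s. X s \<omega>) t) \<in> borel_measurable M"
proof -
  let ?R = "\<lambda>\<omega>. right_diff t (\<lambda>s. X s \<omega>)" and ?L = "\<lambda>\<omega>. left_diff t (\<lambda>s. X s \<omega>)"
  have *: "0 \<le> t + 1 / real (Suc n)" "0 \<le> t - t / real (Suc n)" for n
    using t by (auto simp: field_simps)
  have [measurable]: "?R \<in> borel_measurable M" "?L \<in> borel_measurable M"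
    unfolding right_diff_def left_diff_def
    by (intro borel_measurable_lim_metric borel_measurable_divide borel_measurable_diff
        borel_measurable_const X_measurable * less_imp_le[OF t])+
  have "(\<lambda>\<omega>. if ?R \<omega> = ?L \<omega> then ?R \<omega> else (SOME D. False)) \<in> borel_measurable M"
    by measurable
  also have "?this \<longleftrightarrow> ?thesis"
  proof (rule measurable_cong)
    fix \<omega> assume \<omega>: "\<omega> \<in> space M"
    obtain q where q: "((\<lambda>s. X s \<omega>) has_real_derivative c * B \<omega> * (- 1) ^ q) (at_left t)"
      using X_deriv_left[OF \<omega> t] by blast
    have r: "((\<lambda>s. X s \<omega>) has_real_derivative c * B \<omega> * (- 1) ^ N t \<omega>) (at_right t)"
      using X_deriv_right[OF \<omega>] t by simp
    show "(if ?R \<omega> = ?L \<omega> then ?R \<omega> else (SOME D. False)) = deriv (\<lambda>s. X s \<omega>) t"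
      unfolding deriv_eq_one_sided[OF r q] right_diff_eq[OF r] left_diff_eq[OF q t] ..
  qed
  finally show ?thesis .
qed

lemma AE_deriv_X:
  assumes t: "0 < t"
  shows "AE \<omega> in M. deriv (\<lambda>s. X s \<omega>) t = c * B \<omega> * (- 1) ^ N t \<omega>"
  using AE_no_jump[OF t] AE_space
  by eventually_elim (intro DERIV_imp_deriv X_deriv t)

text \<open>\<open>X 0\<close> is the constant \<open>x0\<close>, so events generated by the pair
  are events of \<open>X t\<close> alone, described by a section of \<open>S\<close>. On these,
  \<open>expectation_velocity\<close> supplies the averaging property of the conditional
  expectation.\<close>

lemma kac_velocity_eq_cond_exp:
  assumes t: "0 < t"
  shows "AE x in distr M borel (X t). kac_velocity a c g x0 t x =
    cond_exp_given M borel (\<lambda>\<omega>. (X t \<omega>, X 0 \<omega>)) (\<lambda>\<omega>. deriv (\<lambda>s. X s \<omega>) t) (x, x0)"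
proof -
  let ?Z = "\<lambda>\<omega>. (X t \<omega>, X 0 \<omega>)" and ?Y = "\<lambda>\<omega>. deriv (\<lambda>s. X s \<omega>) t"
  let ?F = "vimage_algebra (space M) ?Z (borel :: (real \<times> real) measure)"
  let ?V = "\<lambda>\<omega>. vel a c t (fst (?Z \<omega>) - x0)"
  have X0: "X 0 \<omega> = x0" if "\<omega> \<in> space M" for \<omega> using X[of 0 \<omega>] that by (simp add: position_0)
  have [measurable]: "X t \<in> borel_measurable M" "X 0 \<in> borel_measurable M" "position t \<in> borel_measurable M"
    using t by (auto intro: X_measurable position_measurable)
  have Z [measurable]: "?Z \<in> borel_measurable M" by measurable
  have Z_F: "?Z \<in> borel_measurable ?F" by (rule measurable_vimage_algebra1) simp
  have sub: "subalgebra M ?F"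
    unfolding subalgebra_def using Z by (auto simp: sets_vimage_algebra2 measurable_sets)
  interpret finite_measure_subalgebra M ?F
    by unfold_locales (rule sub)
  have Y_meas [measurable]: "?Y \<in> borel_measurable M" by (rule deriv_X_measurable[OF t])
  have Y_int: "integrable M ?Y"
  proof (rule integrable_const_bound[where B = c])
    show "AE \<omega> in M. norm (?Y \<omega>) \<le> c"
      using AE_deriv_X[OF t] AE_B
      by eventually_elim (use c_pos in \<open>auto simp: abs_mult power_abs\<close>)
  qed simp
  have V_int: "integrable M ?V"
    by (rule integrable_const_bound[where B = c]) (use vel_bound[OF a_pos c_pos] in auto)
  have [measurable]: "(fst :: real \<times> real \<Rightarrow> real) \<in> borel_measurable borel"
    by (intro borel_measurable_continuous_onI continuous_intros)
  have V_F: "?V \<in> borel_measurable ?F"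
    using measurable_compose[OF Z_F, of "\<lambda>z. vel a c t (fst z - x0)" borel] by simp
  have "AE \<omega> in M. real_cond_exp M ?F ?Y \<omega> = ?V \<omega>"
  proof (rule real_cond_exp_charact[OF _ Y_int V_int V_F])
    fix A assume "A \<in> sets ?F"
    then obtain S where S [measurable]: "S \<in> sets borel" and A: "A = ?Z -` S \<inter> space M"
      by (auto simp: sets_vimage_algebra2)
    let ?\<psi> = "\<lambda>y. indicator S (x0 + y, x0) :: real"
    have [measurable]: "(\<lambda>\<omega>. (- 1) ^ N t \<omega> :: real) \<in> borel_measurable M" using t by (intro N_sign_measurable) auto
    have \<psi>: "?\<psi> \<in> borel_measurable borel"
      by (rule measurable_compose[of "\<lambda>y. (x0 + y, x0)" _ borel, OF borel_measurable_Pair borel_measurable_indicator]) (use S in auto)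
    have \<psi>_pos: "(\<lambda>\<omega>. ?\<psi> (position t \<omega>)) \<in> borel_measurable M" by (rule measurable_compose[OF \<open>position t \<in> _\<close> \<psi>])
    have [measurable]: "A \<in> events" unfolding A using measurable_sets[OF Z S] .
    have "expectation (\<lambda>\<omega>. indicator A \<omega> *\<^sub>R ?Y \<omega> - indicator A \<omega> *\<^sub>R ?V \<omega>) =
      expectation (\<lambda>\<omega>. ?\<psi> (position t \<omega>) * (c * B \<omega> * (- 1) ^ N t \<omega> - vel a c t (position t \<omega>)))"
    proof (rule integral_cong_AE)
      show "(\<lambda>\<omega>. ?\<psi> (position t \<omega>) * (c * B \<omega> * (- 1) ^ N t \<omega> - vel a c t (position t \<omega>))) \<in> borel_measurable M"
        by (rule borel_measurable_times[OF \<psi>_pos]) measurable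
      show "AE \<omega> in M. indicator A \<omega> *\<^sub>R ?Y \<omega> - indicator A \<omega> *\<^sub>R ?V \<omega> =
         ?\<psi> (position t \<omega>) * (c * B \<omega> * (- 1) ^ N t \<omega> - vel a c t (position t \<omega>))"
        using AE_deriv_X[OF t] AE_space
        by eventually_elim (use t in \<open>auto simp: A X X0 position_0 indicator_def\<close>)
    qed simp
    also have "\<dots> = 0"
      by (rule expectation_velocity[OF t \<psi>, where C = 1]) (auto simp: indicator_def)
    also have "expectation (\<lambda>\<omega>. indicator A \<omega> *\<^sub>R ?Y \<omega> - indicator A \<omega> *\<^sub>R ?V \<omega>) =
      expectation (\<lambda>\<omega>. indicator A \<omega> *\<^sub>R ?Y \<omega>) - expectation (\<lambda>\<omega>. indicator A \<omega> *\<^sub>R ?V \<omega>)"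
      using Y_int V_int by (intro Bochner_Integration.integral_diff integrable_mult_indicator) auto
    finally show "(\<integral>x\<in>A. ?Y x \<partial>M) = (\<integral>x\<in>A. ?V x \<partial>M)"
      by (simp add: set_lebesgue_integral_def)
  qed
  note V_eq = this
  define G where "G = cond_exp_given M borel ?Z ?Y"
  have "(\<lambda>z :: real \<times> real. vel a c t (fst z - x0)) \<in> borel_measurable borel" by measurable
  moreover have "AE \<omega> in M. ?V \<omega> = real_cond_exp M ?F ?Y \<omega>" using V_eq by eventually_elim simp
  \<comment> \<open>\<open>cond_exp_given\<close> is defined by choice; \<open>vel\<close> witnesses
    that a version exists, so the chosen \<open>G\<close> is one as well.\<close>
  ultimately have "\<exists>h. h \<in> borel_measurable borel \<and> (AE \<omega> in M. h (?Z \<omega>) = real_cond_exp M ?F ?Y \<omega>)"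
    by blast
  from someI_ex[OF this, folded cond_exp_given_def, folded G_def]
  have G: "G \<in> borel_measurable borel" and G_eq: "AE \<omega> in M. G (?Z \<omega>) = real_cond_exp M ?F ?Y \<omega>"
    by blast+
  have G' [measurable]: "(\<lambda>x. G (x, x0)) \<in> borel_measurable borel"
    by (rule measurable_compose[OF _ G]) (intro borel_measurable_Pair; simp)
  \<comment> \<open>The bound on the position is carried over to the law of \<open>X t\<close>: on
    the closed cone the arbitrary values supplied by \<open>g\<close> do not occur.\<close>
  have "AE \<omega> in M. G (X t \<omega>, x0) = vel a c t (X t \<omega> - x0) \<and> \<bar>X t \<omega> - x0\<bar> \<le> c * t"
    using G_eq V_eq AE_position_bound[OF less_imp_le[OF t]] AE_space
  proof eventually_elim
    case (elim \<omega>)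
    then show ?case using t by (simp add: X0 X position_0)
  qed
  then have "AE x in distr M borel (X t). G (x, x0) = vel a c t (x - x0) \<and> \<bar>x - x0\<bar> \<le> c * t"
    by (subst AE_distr_iff) measurable
  then show ?thesis
  proof eventually_elim
    case (elim x)
    then show ?case using kac_velocity_eq_vel[of x x0 c t a g] by (simp add: G_def)
  qed
qed

end

end

section \<open>Independent components\<close>

lemma right_diff_measurable:
  assumes "0 \<le> t"
  shows "right_diff t \<in> borel_measurable (PiM {0..} (\<lambda>_. borel))"
proof -
  have "(\<lambda>p. p s) \<in> borel_measurable (PiM {0..} (\<lambda>_. borel :: real measure))" if "0 \<le> s" for s :: real
    using measurable_component_singleton[of s "{0..}" "\<lambda>_. borel :: real measure"] that by simp
  then show ?thesis
    unfolding right_diff_def[abs_def] using assms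
    by (intro borel_measurable_lim_metric borel_measurable_divide borel_measurable_diff borel_measurable_const) auto
qed

lemma sum_axis: "(\<Sum>i\<in>UNIV. (x $ i) *\<^sub>R axis i 1) = (x :: real ^ 'd)"
  using basis_expansion[of x] by (simp add: scalar_mult_eq_scaleR)

section \<open>Calculus of test functions\<close>

lemma test_functionD:
  fixes \<psi> :: "real \<times> (real ^ 'd) \<Rightarrow> real"
  assumes "test_function ({0<..} \<times> UNIV) \<psi>"
  defines "D \<equiv> \<lambda>p. frechet_derivative \<psi> (at p)"
  shows test_function_has_derivative: "(\<psi> has_derivative D p) (at p)"
    and test_function_continuous: "continuous_on UNIV \<psi>" "continuous_on UNIV (\<lambda>p. D p h)"
    and test_function_time_derivative: "deriv (\<lambda>s. \<psi> (s, x)) t = D (t, x) (1, 0)"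
    and test_function_grad: "grad_x \<psi> t x $ i = D (t, x) (0, axis i 1)"
    and test_function_bounded: "\<exists>C. \<forall>p. \<bar>D p h\<bar> \<le> C"
    and test_function_support: "\<exists>\<alpha> \<beta>. 0 < \<alpha> \<and> \<alpha> \<le> \<beta> \<and>
       (\<forall>t x. t \<le> \<alpha> \<or> \<beta> \<le> t \<longrightarrow> \<psi> (t, x) = 0 \<and> D (t, x) = (\<lambda>_. 0))"
proof -
  define S where "S = closure {p. \<psi> p \<noteq> 0}"
  have S: "compact S" "S \<subseteq> {0<..} \<times> UNIV"
    using assms by (auto simp: test_function_def S_def)
  have "Ck 0 \<psi>" "Ck (Suc 0) \<psi>" using assms(1) unfolding test_function_def by blast+
  then have "continuous_on UNIV \<psi>" "\<forall>h. continuous_on UNIV (\<lambda>p. frechet_derivative \<psi> (at p) h)"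
    unfolding Ck.simps by blast+
  then show "continuous_on UNIV \<psi>" and cont: "continuous_on UNIV (\<lambda>p. D p h)" for h
    unfolding D_def by blast+
  have "\<psi> differentiable (at p)" for p using \<open>Ck (Suc 0) \<psi>\<close> unfolding Ck.simps by blast
  then show der: "(\<psi> has_derivative D p) (at p)" for p
    by (simp add: D_def frechet_derivative_works)
  then interpret D: bounded_linear "D p" for p by (rule has_derivative_bounded_linear)
  show "deriv (\<lambda>s. \<psi> (s, x)) t = D (t, x) (1, 0)"
  proof (rule DERIV_imp_deriv)
    have "((\<lambda>s. \<psi> (s, x)) has_derivative (\<lambda>h. D (t, x) (h, 0))) (at t)"
      by (rule has_derivative_compose[of "\<lambda>s. (s, x)" "\<lambda>h. (h, 0)" t UNIV \<psi>, OF _ der])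
         (auto intro!: derivative_eq_intros)
    moreover have "(\<lambda>h. D (t, x) (h, 0)) = (*) (D (t, x) (1, 0))"
    proof
      fix h
      show "D (t, x) (h, 0) = D (t, x) (1, 0) * h"
        using D.scaleR[of "(t, x)" h "(1, 0)"] by (simp add: mult.commute)
    qed
    ultimately show "((\<lambda>s. \<psi> (s, x)) has_real_derivative D (t, x) (1, 0)) (at t)"
      by (simp only: has_field_derivative_def)
  qed
  show "grad_x \<psi> t x $ i = D (t, x) (0, axis i 1)"
  proof -
    have "((\<lambda>y. \<psi> (t, y)) has_derivative (\<lambda>h. D (t, x) (0, h))) (at x)"
      by (rule has_derivative_compose[of "\<lambda>y. (t, y)" "\<lambda>h. (0, h)" x UNIV \<psi>, OF _ der])
         (auto intro!: derivative_eq_intros)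
    from frechet_derivative_at[OF this, symmetric] show ?thesis by (simp add: grad_x_def)
  qed
  have zero: "\<psi> p = 0" "D p = (\<lambda>_. 0)" if "p \<notin> S" for p
  proof -
    have "open (- S)" using S(1) by (simp add: compact_imp_closed open_Compl)
    have z: "\<psi> q = 0" if "q \<in> - S" for q
      using that closure_subset[of "{p. \<psi> p \<noteq> 0}"] by (auto simp: S_def)
    then show "\<psi> p = 0" using that by simp
    have "(\<psi> has_derivative (\<lambda>_. 0)) (at p)"
      by (rule has_derivative_transform_within_open[OF has_derivative_const \<open>open (- S)\<close>]) (use that z in auto)
    with der show "D p = (\<lambda>_. 0)" by (rule has_derivative_unique)
  qed
  show "\<exists>C. \<forall>p. \<bar>D p h\<bar> \<le> C"
  proof -
    have "compact ((\<lambda>p. D p h) ` S)"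
      by (intro compact_continuous_image continuous_on_subset[OF cont] S) auto
    then obtain C where C: "\<And>p. p \<in> S \<Longrightarrow> \<bar>D p h\<bar> \<le> C"
      using compact_imp_bounded[of "(\<lambda>p. D p h) ` S"] by (auto simp: bounded_iff)
    have "\<bar>D p h\<bar> \<le> max C 0" for p
      using C[of p] zero(2)[of p] by (cases "p \<in> S") auto
    then show ?thesis by blast
  qed
  show "\<exists>\<alpha> \<beta>. 0 < \<alpha> \<and> \<alpha> \<le> \<beta> \<and> (\<forall>t x. t \<le> \<alpha> \<or> \<beta> \<le> t \<longrightarrow> \<psi> (t, x) = 0 \<and> D (t, x) = (\<lambda>_. 0))"
  proof (cases "S = {}")
    case True
    then show ?thesis using zero by (intro exI[of _ 1]) auto
  next
    case False
    have cpt: "compact (fst ` S)" by (intro compact_continuous_image S continuous_intros)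
    obtain l where l: "l \<in> fst ` S" "\<And>t. t \<in> fst ` S \<Longrightarrow> l \<le> t"
      using compact_attains_inf[OF cpt] False by auto
    obtain u where u: "u \<in> fst ` S" "\<And>t. t \<in> fst ` S \<Longrightarrow> t \<le> u"
      using compact_attains_sup[OF cpt] False by auto
    have "0 < l" using l(1) S(2) by auto
    moreover have "l \<le> u" using l(1) u(2) by auto
    \<comment> \<open>Half the first time and one unit past the last keep the lower end positive and
      make the function and its derivative vanish at both ends themselves.\<close>
    moreover have "(t, x) \<notin> S" if "t \<le> l / 2 \<or> u + 1 \<le> t" for t x
      using that l(2)[of t] u(2)[of t] \<open>0 < l\<close> by force
    ultimately show ?thesis
      using zero by (intro exI[of _ "l / 2"] exI[of _ "u + 1"]) auto
  qed
qed

section \<open>The process with independent components\<close>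

locale kac_nd = prob_space M for M :: "'w measure" +
  fixes a c :: real and N :: "'d::finite \<Rightarrow> real \<Rightarrow> 'w \<Rightarrow> nat" and B :: "'d \<Rightarrow> 'w \<Rightarrow> real"
    and K :: "real \<Rightarrow> 'w \<Rightarrow> real ^ 'd" and x0 :: "real ^ 'd"
  assumes kac: "kac_1d M a (N i) c (B i)"
    and K: "0 \<le> t \<Longrightarrow> \<omega> \<in> space M \<Longrightarrow> K t \<omega> $ i = kac_1d.position (N i) c (B i) t \<omega>"
    and indep: "indep_vars (\<lambda>_. PiM {0..} (\<lambda>_. borel)) (\<lambda>i \<omega>. \<lambda>t\<in>{0..}. K t \<omega> $ i) UNIV"
begin

definition path :: "'d \<Rightarrow> 'w \<Rightarrow> real \<Rightarrow> real" where
  "path i \<omega> = (\<lambda>t\<in>{0..}. K t \<omega> $ i)"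

definition X :: "real \<Rightarrow> 'w \<Rightarrow> real ^ 'd" where
  "X t \<omega> = x0 + K t \<omega>"

definition \<sigma> :: "real \<Rightarrow> 'd \<Rightarrow> 'w \<Rightarrow> real" where
  "\<sigma> t i \<omega> = c * B i \<omega> * (- 1) ^ N i t \<omega>"

lemma a_pos: "a > 0" and c_pos: "c > 0"
proof -
  interpret kac_1d M a "N undefined" c "B undefined" by (rule kac)
  show "a > 0" "c > 0" by (rule a_pos c_pos)+
qed

lemma path_measurable: "path i \<in> M \<rightarrow>\<^sub>M PiM {0..} (\<lambda>_. borel)"
  using indep by (simp add: indep_vars_def path_def[abs_def])

lemma X_component: "0 \<le> t \<Longrightarrow> \<omega> \<in> space M \<Longrightarrow> X t \<omega> $ i = x0 $ i + kac_1d.position (N i) c (B i) t \<omega>"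
  by (simp add: X_def K)

lemma K_measurable: "0 \<le> t \<Longrightarrow> (\<lambda>\<omega>. K t \<omega> $ i) \<in> borel_measurable M"
proof -
  assume t: "0 \<le> t"
  interpret kac_1d M a "N i" c "B i" by (rule kac)
  show ?thesis using position_measurable[OF t] K[OF t] by (subst measurable_cong[where g = "position t"]) auto
qed

lemma X_measurable [measurable]: "0 \<le> t \<Longrightarrow> X t \<in> borel_measurable M"
proof -
  assume t: "0 \<le> t"
  have "(\<lambda>\<omega>. x0 + (\<Sum>i\<in>UNIV. (K t \<omega> $ i) *\<^sub>R axis i 1)) \<in> borel_measurable M"
    using K_measurable[OF t] by measurable
  then show ?thesis by (simp add: sum_axis X_def[abs_def])
qed

lemma \<sigma>_measurable [measurable]: "0 \<le> t \<Longrightarrow> \<sigma> t i \<in> borel_measurable M"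
proof -
  assume t: "0 \<le> t"
  interpret kac_1d M a "N i" c "B i" by (rule kac)
  show ?thesis unfolding \<sigma>_def[abs_def] using N_sign_measurable[OF t] by measurable
qed

lemma AE_B_unit: "AE \<omega> in M. \<forall>i. \<bar>B i \<omega>\<bar> = 1"
proof -
  have "AE \<omega> in M. \<forall>i\<in>UNIV. \<bar>B i \<omega>\<bar> = 1"
  proof (rule AE_finite_allI)
    fix i
    interpret kac_1d M a "N i" c "B i" by (rule kac)
    show "AE \<omega> in M. \<bar>B i \<omega>\<bar> = 1" using AE_B by eventually_elim auto
  qed simp
  then show ?thesis by simp
qed

lemma \<sigma>_bound: "\<bar>B i \<omega>\<bar> = 1 \<Longrightarrow> \<bar>\<sigma> t i \<omega>\<bar> = c"
  using c_pos by (simp add: \<sigma>_def abs_mult power_abs)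

text \<open>The indicator of a box is a product over the components, and \<open>H\<close> reads only
  the path of component \<open>i\<close>, so it joins the factor of that component before
  independence splits the expectation.\<close>

lemma expectation_box:
  fixes H :: "(real \<Rightarrow> real) \<Rightarrow> real"
  assumes t: "0 \<le> t" and H: "H \<in> borel_measurable (PiM {0..} (\<lambda>_. borel))" "\<And>p. \<bar>H p\<bar> \<le> C"
  shows "expectation (\<lambda>\<omega>. H (path i \<omega>) * indicator (box l u) (X t \<omega>)) =
    expectation (\<lambda>\<omega>. H (path i \<omega>) * indicator {l $ i<..<u $ i} (X t \<omega> $ i)) *
    (\<Prod>j\<in>UNIV - {i}. expectation (\<lambda>\<omega>. indicator {l $ j<..<u $ j} (X t \<omega> $ j)))"
proof -
  define Y where "Y j p = (if j = i then H p else 1) * indicator {l $ j<..<u $ j} (x0 $ j + p t)" for j and p :: "real \<Rightarrow> real"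
  have "(\<lambda>p. p t) \<in> borel_measurable (PiM {0..} (\<lambda>_. borel :: real measure))"
    using measurable_component_singleton[of t "{0..}" "\<lambda>_. borel :: real measure"] t by simp
  note [measurable] = this H(1)
  have Y_meas: "Y j \<in> borel_measurable (PiM {0..} (\<lambda>_. borel))" for j
  proof -
    have ind: "(\<lambda>p. indicator {l $ j<..<u $ j} (x0 $ j + p t) :: real) \<in> borel_measurable (PiM {0..} (\<lambda>_. borel))"
      by measurable
    show ?thesis
      unfolding Y_def by (cases "j = i") (use borel_measurable_times[OF H(1) ind] ind in auto)
  qed
  have path_t: "path j \<omega> t = K t \<omega> $ j" for j \<omega> using t by (simp add: path_def)
  have Y_path: "Y j (path j \<omega>) = (if j = i then H (path i \<omega>) else 1) * indicator {l $ j<..<u $ j} (X t \<omega> $ j)" for j \<omega>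
    by (simp add: Y_def path_t X_def)
  have C: "0 \<le> C" using H(2)[of undefined] by linarith
  have Y_int: "integrable M (\<lambda>\<omega>. Y j (path j \<omega>))" for j
  proof (rule integrable_const_bound[where B = "max C 1"])
    show "(\<lambda>\<omega>. Y j (path j \<omega>)) \<in> borel_measurable M"
      by (rule measurable_compose[OF path_measurable Y_meas])
    show "AE \<omega> in M. norm (Y j (path j \<omega>)) \<le> max C 1"
      using H(2) C by (intro AE_I2) (auto simp: Y_def indicator_def intro: max.coboundedI1)
  qed
  have "indep_vars (\<lambda>_. borel) (\<lambda>j \<omega>. Y j (path j \<omega>)) UNIV"
    using indep unfolding path_def[symmetric] by (rule indep_vars_compose2) (rule Y_meas)
  from indep_vars_lebesgue_integral[OF finite_class.finite_UNIV this Y_int]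
  have "expectation (\<lambda>\<omega>. \<Prod>j\<in>UNIV. Y j (path j \<omega>)) = (\<Prod>j\<in>UNIV. expectation (\<lambda>\<omega>. Y j (path j \<omega>)))" .
  also have "\<dots> = expectation (\<lambda>\<omega>. Y i (path i \<omega>)) * (\<Prod>j\<in>UNIV - {i}. expectation (\<lambda>\<omega>. Y j (path j \<omega>)))"
    by (rule prod.remove) auto
  also have "(\<lambda>\<omega>. \<Prod>j\<in>UNIV. Y j (path j \<omega>)) = (\<lambda>\<omega>. H (path i \<omega>) * indicator (box l u) (X t \<omega>))"
  proof
    fix \<omega>
    have "(\<Prod>j\<in>UNIV. Y j (path j \<omega>)) = (\<Prod>j\<in>UNIV. if j = i then H (path i \<omega>) else 1) * (\<Prod>j\<in>UNIV. indicator {l $ j<..<u $ j} (X t \<omega> $ j))"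
      unfolding Y_path by (rule prod.distrib)
    also have "(\<Prod>j\<in>UNIV. indicator {l $ j<..<u $ j} (X t \<omega> $ j)) = (indicator (box l u) (X t \<omega>) :: real)"
    proof (cases "X t \<omega> \<in> box l u")
      case True
      then show ?thesis by (auto simp: mem_box_cart intro!: prod.neutral)
    next
      case False
      then obtain j where "X t \<omega> $ j \<notin> {l $ j<..<u $ j}" by (auto simp: mem_box_cart)
      then have "(\<Prod>j\<in>UNIV. indicator {l $ j<..<u $ j} (X t \<omega> $ j)) = (0 :: real)"
        by (intro prod_zero bexI[of _ j]) auto
      then show ?thesis using False by simp
    qed
    finally show "(\<Prod>j\<in>UNIV. Y j (path j \<omega>)) = H (path i \<omega>) * indicator (box l u) (X t \<omega>)" by simp
  qed
  also have "(\<Prod>j\<in>UNIV - {i}. expectation (\<lambda>\<omega>. Y j (path j \<omega>))) = (\<Prod>j\<in>UNIV - {i}. expectation (\<lambda>\<omega>. indicator {l $ j<..<u $ j} (X t \<omega> $ j)))"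
    by (intro prod.cong) (auto simp: Y_path)
  finally show ?thesis by (simp add: Y_path)
qed

text \<open>Weighting by \<open>H True\<close> or \<open>H False\<close> gives two laws of
  \<open>X t\<close>; nonnegativity of \<open>H\<close> makes them measures. They agree on boxes by
  \<open>expectation_box\<close>: the factors of component \<open>i\<close> match by assumption, and
  the other factors do not involve \<open>H\<close>. Boxes form an intersection-stable generator of
  the Borel sets. The boolean index lets one hypothesis cover both functionals.\<close>

lemma expectation_path_functionals_eq:
  fixes H :: "bool \<Rightarrow> (real \<Rightarrow> real) \<Rightarrow> real" and \<Phi> :: "real ^ 'd \<Rightarrow> real"
  assumes t: "0 \<le> t"
    and H: "\<And>k. H k \<in> borel_measurable (PiM {0..} (\<lambda>_. borel))" "\<And>k p. 0 \<le> H k p" "\<And>k p. H k p \<le> C"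
    and eq: "\<And>\<psi> :: real \<Rightarrow> real. \<psi> \<in> borel_measurable borel \<Longrightarrow> (\<And>y. \<bar>\<psi> y\<bar> \<le> 1) \<Longrightarrow>
      expectation (\<lambda>\<omega>. H True (path i \<omega>) * \<psi> (K t \<omega> $ i)) = expectation (\<lambda>\<omega>. H False (path i \<omega>) * \<psi> (K t \<omega> $ i))"
    and \<Phi> [measurable]: "\<Phi> \<in> borel_measurable borel"
  shows "expectation (\<lambda>\<omega>. H True (path i \<omega>) * \<Phi> (X t \<omega>)) = expectation (\<lambda>\<omega>. H False (path i \<omega>) * \<Phi> (X t \<omega>))"
proof -
  have [measurable]: "X t \<in> borel_measurable M" using t by (rule X_measurable)
  have W [measurable]: "(\<lambda>\<omega>. H k (path i \<omega>)) \<in> borel_measurable M" for k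
    by (rule measurable_compose[OF path_measurable H(1)])
  have H_abs: "\<bar>H k p\<bar> \<le> C" for k p using H(2,3)[of k p] by simp
  define \<nu> where "\<nu> k = distr (density M (\<lambda>\<omega>. ennreal (H k (path i \<omega>)))) borel (X t)" for k
  have \<nu>_box: "emeasure (\<nu> k) (box l u) = ennreal (expectation (\<lambda>\<omega>. H k (path i \<omega>) * indicator (box l u) (X t \<omega>)))" for k l u
  proof -
    have "emeasure (\<nu> k) (box l u) = (\<integral>\<^sup>+\<omega>. ennreal (H k (path i \<omega>) * indicator (box l u) (X t \<omega>)) \<partial>M)"
      unfolding \<nu>_def by (subst emeasure_distr)
        (auto simp: emeasure_density ennreal_mult'' intro!: nn_integral_cong split: split_indicator)
    also have "\<dots> = ennreal (expectation (\<lambda>\<omega>. H k (path i \<omega>) * indicator (box l u) (X t \<omega>)))"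
      using H(2) H_abs order_trans[OF abs_ge_zero H_abs]
      by (intro nn_integral_eq_integral integrable_const_bound[where B = C]) (auto simp: indicator_def)
    finally show ?thesis .
  qed
  have "expectation (\<lambda>\<omega>. H True (path i \<omega>) * indicator {l<..<u} (X t \<omega> $ i)) =
    expectation (\<lambda>\<omega>. H False (path i \<omega>) * indicator {l<..<u} (X t \<omega> $ i))" for l u
    using eq[of "\<lambda>y. indicator {l<..<u} (x0 $ i + y)"] by (auto simp: X_def)
  then have box_eq: "emeasure (\<nu> True) (box l u) = emeasure (\<nu> False) (box l u)" for l u
    unfolding \<nu>_box expectation_box[OF t H(1) H_abs] by simp
  have "\<nu> True = \<nu> False"
  proof (rule measure_eqI_generator_eq)
    let ?E = "range (\<lambda>(l, u). box l u :: (real ^ 'd) set)"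
    let ?A = "\<lambda>n::nat. box (- (real n *\<^sub>R One)) (real n *\<^sub>R One) :: (real ^ 'd) set"
    show "Int_stable ?E"
      by (auto simp: Int_stable_def box_Int_box)
    show "?E \<subseteq> Pow UNIV" "sets (\<nu> True) = sigma_sets UNIV ?E" "sets (\<nu> False) = sigma_sets UNIV ?E"
      by (simp_all add: \<nu>_def borel_eq_box)
    show "range ?A \<subseteq> ?E" "(\<Union>i. ?A i) = UNIV"
      unfolding UN_box_eq_UNIV by auto
    show "emeasure (\<nu> True) (?A n) \<noteq> \<infinity>" for n by (simp add: \<nu>_box)
    show "emeasure (\<nu> True) S = emeasure (\<nu> False) S" if "S \<in> ?E" for S using that box_eq by auto
  qed
  moreover have "(\<integral>x. \<Phi> x \<partial>\<nu> k) = expectation (\<lambda>\<omega>. H k (path i \<omega>) * \<Phi> (X t \<omega>))" for k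
  proof -
    have "(\<integral>x. \<Phi> x \<partial>\<nu> k) = (\<integral>\<omega>. \<Phi> (X t \<omega>) \<partial>density M (\<lambda>\<omega>. ennreal (H k (path i \<omega>))))"
      unfolding \<nu>_def by (rule integral_distr) auto
    also have "\<dots> = expectation (\<lambda>\<omega>. H k (path i \<omega>) *\<^sub>R \<Phi> (X t \<omega>))"
      by (rule integral_density) (use H(2) in auto)
    finally show ?thesis by simp
  qed
  ultimately show ?thesis by metis
qed

text \<open>By independence, observing the other components does not change the mean velocity of
  component \<open>i\<close>; hence the test function may depend on the whole vector.\<close>

lemma expectation_velocity_vec:
  fixes \<Phi> :: "real ^ 'd \<Rightarrow> real"
  assumes t: "0 < t" and \<Phi> [measurable]: "\<Phi> \<in> borel_measurable borel" and \<Phi>_bound: "\<And>x. \<bar>\<Phi> x\<bar> \<le> C"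
  shows "expectation (\<lambda>\<omega>. \<sigma> t i \<omega> * \<Phi> (X t \<omega>)) = expectation (\<lambda>\<omega>. vel a c t (K t \<omega> $ i) * \<Phi> (X t \<omega>))"
proof -
  have t': "0 \<le> t" using t by simp
  note [measurable] = X_measurable[OF t'] \<sigma>_measurable[OF t'] K_measurable[OF t']
  interpret kac_1d M a "N i" c "B i" by (rule kac)
  \<comment> \<open>Clamping the right derivative to the interval from \<open>- c\<close> to
    \<open>c\<close> and adding \<open>c\<close> make both functionals bounded and nonnegative on
    arbitrary paths, as needed to treat them as weights. Almost surely the clamp changes
    nothing.\<close>
  define H where "H b p = c + (if b then max (- c) (min c (right_diff t p)) else vel a c t (p t))" for b p
  have pt: "(\<lambda>p. p t) \<in> borel_measurable (PiM {0..} (\<lambda>_. borel :: real measure))"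
    using measurable_component_singleton[of t "{0..}" "\<lambda>_. borel :: real measure"] t by simp
  have H_meas: "H b \<in> borel_measurable (PiM {0..} (\<lambda>_. borel))" for b
    unfolding H_def using right_diff_measurable[OF t'] measurable_compose[OF pt borel_measurable_vel]
    by (cases b) auto
  have H_bounds: "0 \<le> H b p" "H b p \<le> 2 * c" for b p
    using vel_bound[OF a_pos c_pos, of t "p t"] c_pos by (auto simp: H_def abs_le_iff)
  have H_F: "H False (path i \<omega>) = c + vel a c t (K t \<omega> $ i)" for \<omega>
    using t by (simp add: H_def path_def)
  have H_T: "AE \<omega> in M. H True (path i \<omega>) = c + \<sigma> t i \<omega>"
    using AE_B_unit AE_space
  proof eventually_elim
    case (elim \<omega>)
    have "right_diff t (path i \<omega>) = right_diff t (\<lambda>s. K s \<omega> $ i)"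
      using t by (simp add: right_diff_def path_def)
    also have "\<dots> = \<sigma> t i \<omega>"
      using right_diff_X[of "\<lambda>s \<omega>. K s \<omega> $ i" 0 \<omega> t] elim t K by (simp add: \<sigma>_def)
    finally show ?case using \<sigma>_bound[of i \<omega> t] elim by (auto simp: H_def)
  qed
  have C: "0 \<le> C" using \<Phi>_bound[of 0] by linarith
  have W [measurable]: "(\<lambda>\<omega>. H b (path i \<omega>)) \<in> borel_measurable M" for b
    by (rule measurable_compose[OF path_measurable H_meas])
  have \<sigma>_int: "integrable M (\<lambda>\<omega>. \<sigma> t i \<omega> * f \<omega>)" and vel_int: "integrable M (\<lambda>\<omega>. vel a c t (K t \<omega> $ i) * f \<omega>)" and f_int: "integrable M f"
    if [measurable]: "f \<in> borel_measurable M" and f: "\<And>\<omega>. \<bar>f \<omega>\<bar> \<le> C'" for f :: "'w \<Rightarrow> real" and C'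
  proof -
    show "integrable M (\<lambda>\<omega>. \<sigma> t i \<omega> * f \<omega>)"
    proof (rule integrable_const_bound[where B = "c * C'"])
      show "AE \<omega> in M. norm (\<sigma> t i \<omega> * f \<omega>) \<le> c * C'"
        using AE_B_unit by eventually_elim (use f c_pos \<sigma>_bound in \<open>auto simp: abs_mult intro!: mult_mono\<close>)
    qed simp
    show "integrable M (\<lambda>\<omega>. vel a c t (K t \<omega> $ i) * f \<omega>)"
      by (rule integrable_const_bound[where B = "c * C'"])
         (use f c_pos vel_bound[OF a_pos c_pos] in \<open>auto simp: abs_mult intro!: mult_mono\<close>)
    show "integrable M f" by (rule integrable_const_bound[where B = C']) (use f in auto)
  qed
  have T_eq: "expectation (\<lambda>\<omega>. H True (path i \<omega>) * f \<omega>) = expectation (\<lambda>\<omega>. c * f \<omega>) + expectation (\<lambda>\<omega>. \<sigma> t i \<omega> * f \<omega>)"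
    and F_eq: "expectation (\<lambda>\<omega>. H False (path i \<omega>) * f \<omega>) = expectation (\<lambda>\<omega>. c * f \<omega>) + expectation (\<lambda>\<omega>. vel a c t (K t \<omega> $ i) * f \<omega>)"
    if [measurable]: "f \<in> borel_measurable M" and f: "\<And>\<omega>. \<bar>f \<omega>\<bar> \<le> C'" for f :: "'w \<Rightarrow> real" and C'
  proof -
    have "expectation (\<lambda>\<omega>. H True (path i \<omega>) * f \<omega>) = expectation (\<lambda>\<omega>. c * f \<omega> + \<sigma> t i \<omega> * f \<omega>)"
      by (rule integral_cong_AE) (use H_T in \<open>auto simp: algebra_simps elim!: eventually_mono\<close>)
    then show "expectation (\<lambda>\<omega>. H True (path i \<omega>) * f \<omega>) = expectation (\<lambda>\<omega>. c * f \<omega>) + expectation (\<lambda>\<omega>. \<sigma> t i \<omega> * f \<omega>)"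
      using \<sigma>_int[OF that] f_int[OF that] by simp
    show "expectation (\<lambda>\<omega>. H False (path i \<omega>) * f \<omega>) = expectation (\<lambda>\<omega>. c * f \<omega>) + expectation (\<lambda>\<omega>. vel a c t (K t \<omega> $ i) * f \<omega>)"
      unfolding H_F using vel_int[OF that] f_int[OF that] by (simp add: distrib_right)
  qed
  have "expectation (\<lambda>\<omega>. H True (path i \<omega>) * \<Phi> (X t \<omega>)) = expectation (\<lambda>\<omega>. H False (path i \<omega>) * \<Phi> (X t \<omega>))"
  proof (rule expectation_path_functionals_eq[OF t' H_meas H_bounds _ \<Phi>])
    fix \<psi> :: "real \<Rightarrow> real" assume \<psi> [measurable]: "\<psi> \<in> borel_measurable borel" and \<psi>_bound: "\<And>y. \<bar>\<psi> y\<bar> \<le> 1"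
    have m: "(\<lambda>\<omega>. \<psi> (K t \<omega> $ i)) \<in> borel_measurable M" by measurable
    have "0 = expectation (\<lambda>\<omega>. \<psi> (position t \<omega>) * (c * B i \<omega> * (- 1) ^ N i t \<omega> - vel a c t (position t \<omega>)))"
      by (rule expectation_velocity[OF t \<psi> \<psi>_bound, symmetric])
    also have "\<dots> = expectation (\<lambda>\<omega>. \<sigma> t i \<omega> * \<psi> (K t \<omega> $ i) - vel a c t (K t \<omega> $ i) * \<psi> (K t \<omega> $ i))"
      by (intro Bochner_Integration.integral_cong refl) (simp add: K[OF t'] \<sigma>_def algebra_simps)
    also have "\<dots> = expectation (\<lambda>\<omega>. \<sigma> t i \<omega> * \<psi> (K t \<omega> $ i)) - expectation (\<lambda>\<omega>. vel a c t (K t \<omega> $ i) * \<psi> (K t \<omega> $ i))"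
      using \<sigma>_int[OF m \<psi>_bound] vel_int[OF m \<psi>_bound] by simp
    finally show "expectation (\<lambda>\<omega>. H True (path i \<omega>) * \<psi> (K t \<omega> $ i)) = expectation (\<lambda>\<omega>. H False (path i \<omega>) * \<psi> (K t \<omega> $ i))"
      unfolding T_eq[OF m \<psi>_bound] F_eq[OF m \<psi>_bound] by simp
  qed
  moreover have m: "(\<lambda>\<omega>. \<Phi> (X t \<omega>)) \<in> borel_measurable M" by measurable
  ultimately show ?thesis
    unfolding T_eq[OF m \<Phi>_bound] F_eq[OF m \<Phi>_bound] by simp
qed

end

section \<open>The continuity equation\<close>

context kac_nd
begin

lemma K_pair: "(\<lambda>(s, \<omega>). K (max 0 s) \<omega> $ i) \<in> borel_measurable (borel \<Otimes>\<^sub>M M)"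
proof -
  interpret kac_1d M a "N i" c "B i" by (rule kac)
  have "(\<lambda>x. E (max 0 (fst x)) (snd x)) \<in> borel_measurable (borel \<Otimes>\<^sub>M M)"
    using E_pair by (simp add: case_prod_beta')
  then have "(\<lambda>x. B i (snd x) * c * (2 * E (max 0 (fst x)) (snd x) - max 0 (fst x))) \<in> borel_measurable (borel \<Otimes>\<^sub>M M)"
    by measurable
  then show ?thesis
    by (rule measurable_cong[THEN iffD1, rotated]) (auto simp: K position_def space_pair_measure)
qed

lemma X_pair: "(\<lambda>(s, \<omega>). X (max 0 s) \<omega>) \<in> borel_measurable (borel \<Otimes>\<^sub>M M)"
proof -
  have "(\<lambda>x. x0 + (\<Sum>i\<in>UNIV. (K (max 0 (fst x)) (snd x) $ i) *\<^sub>R axis i 1)) \<in> borel_measurable (borel \<Otimes>\<^sub>M M)"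
    using K_pair by (intro borel_measurable_add borel_measurable_sum borel_measurable_scaleR borel_measurable_const)
      (simp add: case_prod_beta')
  then show ?thesis by (simp add: sum_axis X_def case_prod_beta')
qed

lemma \<sigma>_pair: "(\<lambda>(s, \<omega>). \<sigma> (max 0 s) i \<omega>) \<in> borel_measurable (borel \<Otimes>\<^sub>M M)"
proof -
  interpret kac_1d M a "N i" c "B i" by (rule kac)
  have "(\<lambda>x. (- 1) ^ N i (max 0 (fst x)) (snd x) :: real) \<in> borel_measurable (borel \<Otimes>\<^sub>M M)"
    using measurable_compose[OF N_pair, of "\<lambda>n. (- 1) ^ n :: real" borel] by (simp add: case_prod_beta')
  then show ?thesis
    unfolding \<sigma>_def case_prod_beta' by measurable
qed

definition jump_times :: "'w \<Rightarrow> real set" where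
  "jump_times \<omega> = (\<Union>i. counting_path.jumps (\<lambda>s. N i s \<omega>))"

lemma finite_jump_times: "\<omega> \<in> space M \<Longrightarrow> finite (jump_times \<omega> \<inter> {..t})"
proof -
  assume \<omega>: "\<omega> \<in> space M"
  have "finite (counting_path.jumps (\<lambda>s. N i s \<omega>) \<inter> {..t})" for i
  proof -
    interpret kac_1d M a "N i" c "B i" by (rule kac)
    interpret counting_path "\<lambda>s. N i s \<omega>" by (rule counting_path[OF \<omega>])
    show ?thesis by (rule finite_jumps)
  qed
  then have "finite (\<Union>i. counting_path.jumps (\<lambda>s. N i s \<omega>) \<inter> {..t})"
    by (intro finite_UN_I) auto
  also have "(\<Union>i. counting_path.jumps (\<lambda>s. N i s \<omega>) \<inter> {..t}) = jump_times \<omega> \<inter> {..t}"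
    by (auto simp only: jump_times_def)
  finally show ?thesis .
qed

lemma X_has_derivative:
  assumes \<omega>: "\<omega> \<in> space M" and t: "0 < t" "t \<notin> jump_times \<omega>"
  shows "((\<lambda>s. X s \<omega>) has_derivative (\<lambda>h. \<Sum>i\<in>UNIV. (\<sigma> t i \<omega> * h) *\<^sub>R axis i 1)) (at t)"
proof -
  have "((\<lambda>s. X s \<omega> $ i) has_derivative (\<lambda>h. \<sigma> t i \<omega> * h)) (at t)" for i
  proof -
    interpret kac_1d M a "N i" c "B i" by (rule kac)
    have "((\<lambda>s. X s \<omega> $ i) has_real_derivative c * B i \<omega> * (- 1) ^ N i t \<omega>) (at t)"
      using X_deriv[of "\<lambda>s \<omega>. X s \<omega> $ i" "x0 $ i" \<omega> t] X_component \<omega> t by (auto simp: jump_times_def)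
    then show ?thesis by (simp add: has_field_derivative_def \<sigma>_def)
  qed
  then have "((\<lambda>s. \<Sum>i\<in>UNIV. (X s \<omega> $ i) *\<^sub>R (axis i 1 :: real ^ 'd)) has_derivative (\<lambda>h. \<Sum>i\<in>UNIV. (\<sigma> t i \<omega> * h) *\<^sub>R axis i 1)) (at t)"
    by (intro has_derivative_sum has_derivative_scaleR_left)
  then show ?thesis unfolding sum_axis .
qed

lemma X_continuous:
  assumes \<omega>: "\<omega> \<in> space M" and "0 \<le> l"
  shows "continuous_on {l..u} (\<lambda>s. X s \<omega>)"
proof -
  have "continuous_on {l..u} (\<lambda>s. X s \<omega> $ i)" for i
  proof -
    interpret kac_1d M a "N i" c "B i" by (rule kac)
    interpret counting_path "\<lambda>s. N i s \<omega>" by (rule counting_path[OF \<omega>])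
    have "continuous_on {l..u} (\<lambda>s. x0 $ i + position s \<omega>)"
      unfolding position_def using assms(2)
      by (intro continuous_intros continuous_on_subset[OF even_time_continuous[of u]]) auto
    then show ?thesis
      by (rule continuous_on_eq) (use assms X_component in auto)
  qed
  then have "continuous_on {l..u} (\<lambda>s. \<Sum>i\<in>UNIV. (X s \<omega> $ i) *\<^sub>R (axis i 1 :: real ^ 'd))"
    by (intro continuous_on_sum continuous_on_scaleR continuous_on_const)
  then show ?thesis unfolding sum_axis .
qed

section \<open>Test functions along the paths\<close>

context
  fixes \<psi> :: "real \<times> (real ^ 'd) \<Rightarrow> real"
  assumes \<psi>: "test_function ({0<..} \<times> UNIV) \<psi>"
begin

definition D :: "real \<times> (real ^ 'd) \<Rightarrow> real \<times> (real ^ 'd) \<Rightarrow> real" where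
  "D p = frechet_derivative \<psi> (at p)"

definition rate :: "real \<Rightarrow> 'w \<Rightarrow> real" where
  "rate t \<omega> = D (t, X t \<omega>) (1, 0) + (\<Sum>i\<in>UNIV. \<sigma> t i \<omega> * D (t, X t \<omega>) (0, axis i 1))"

lemma D_linear: "bounded_linear (D p)"
  unfolding D_def by (rule has_derivative_bounded_linear[OF test_function_has_derivative[OF \<psi>]])

lemma D_measurable [measurable]: "(\<lambda>p. D p h) \<in> borel_measurable borel"
  unfolding D_def by (rule borel_measurable_continuous_onI[OF test_function_continuous(2)[OF \<psi>]])

lemma D_Pair_measurable [measurable]: "(\<lambda>x. D (t, x) h) \<in> borel_measurable borel"
  by (rule measurable_compose[OF _ D_measurable]) (intro borel_measurable_Pair; simp)

lemma rate_eq_0: "D (t, X t \<omega>) = (\<lambda>_. 0) \<Longrightarrow> rate t \<omega> = 0"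
  by (simp add: rate_def)

lemma test_function_along_path:
  assumes \<omega>: "\<omega> \<in> space M" and t: "0 < t" "t \<notin> jump_times \<omega>"
  shows "((\<lambda>s. \<psi> (s, X s \<omega>)) has_real_derivative rate t \<omega>) (at t)"
proof -
  interpret D: bounded_linear "D (t, X t \<omega>)" by (rule D_linear)
  have "((\<lambda>s. \<psi> (s, X s \<omega>)) has_derivative (\<lambda>h. D (t, X t \<omega>) (h, \<Sum>i\<in>UNIV. (\<sigma> t i \<omega> * h) *\<^sub>R axis i 1))) (at t)"
    unfolding D_def
    by (rule has_derivative_compose[OF has_derivative_Pair[OF has_derivative_ident X_has_derivative[OF assms]] test_function_has_derivative[OF \<psi>]])
  moreover have "(\<lambda>h. D (t, X t \<omega>) (h, \<Sum>i\<in>UNIV. (\<sigma> t i \<omega> * h) *\<^sub>R axis i 1)) = (*) (rate t \<omega>)"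
  proof
    fix h
    have "(h, \<Sum>i\<in>UNIV. (\<sigma> t i \<omega> * h) *\<^sub>R axis i 1) = h *\<^sub>R (1, 0) + (\<Sum>i\<in>UNIV. (\<sigma> t i \<omega> * h) *\<^sub>R (0, axis i 1 :: real ^ 'd))"
      by (simp add: prod_eq_iff fst_sum snd_sum)
    then show "D (t, X t \<omega>) (h, \<Sum>i\<in>UNIV. (\<sigma> t i \<omega> * h) *\<^sub>R axis i 1) = rate t \<omega> * h"
      by (simp only: D.add D.sum D.scaleR rate_def) (simp add: distrib_left sum_distrib_left mult_ac)
  qed
  ultimately show ?thesis by (simp only: has_field_derivative_def)
qed

lemma rate_pair: "(\<lambda>(s, \<omega>). rate (max 0 s) \<omega>) \<in> borel_measurable (borel \<Otimes>\<^sub>M M)"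
proof -
  have X: "(\<lambda>x. X (max 0 (fst x)) (snd x)) \<in> borel_measurable (borel \<Otimes>\<^sub>M M)"
    using X_pair by (simp add: case_prod_beta')
  have "(\<lambda>x. (max 0 (fst x), X (max 0 (fst x)) (snd x))) \<in> borel_measurable (borel \<Otimes>\<^sub>M M)"
    by (rule borel_measurable_Pair[OF _ X]) measurable
  from measurable_compose[OF this D_measurable]
  have "(\<lambda>x. D (max 0 (fst x), X (max 0 (fst x)) (snd x)) h) \<in> borel_measurable (borel \<Otimes>\<^sub>M M)" for h .
  moreover have "(\<lambda>x. \<sigma> (max 0 (fst x)) i (snd x)) \<in> borel_measurable (borel \<Otimes>\<^sub>M M)" for i
    using \<sigma>_pair by (simp add: case_prod_beta')
  ultimately show ?thesis
    unfolding rate_def case_prod_beta'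
    by (intro borel_measurable_add borel_measurable_sum borel_measurable_times)
qed

lemma rate_bounded:
  obtains C where "\<And>t \<omega>. \<forall>i. \<bar>B i \<omega>\<bar> = 1 \<Longrightarrow> \<bar>rate t \<omega>\<bar> \<le> C"
proof -
  obtain C0 where C0: "\<And>p. \<bar>D p (1, 0)\<bar> \<le> C0"
    using test_function_bounded[OF \<psi>, of "(1, 0)"] unfolding D_def by blast
  have "\<exists>C. \<forall>p. \<bar>D p (0, axis i 1)\<bar> \<le> C" for i
    using test_function_bounded[OF \<psi>, of "(0, axis i 1)"] unfolding D_def .
  then obtain C where C: "\<And>i p. \<bar>D p (0, axis i 1)\<bar> \<le> C i" by metis
  show ?thesis
  proof (rule that)
    fix t \<omega> assume B: "\<forall>i. \<bar>B i \<omega>\<bar> = 1"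
    have "\<bar>\<Sum>i\<in>UNIV. \<sigma> t i \<omega> * D (t, X t \<omega>) (0, axis i 1)\<bar> \<le> (\<Sum>i\<in>UNIV. c * C i)"
      by (rule order_trans[OF sum_abs sum_mono]) (use B C c_pos \<sigma>_bound in \<open>auto simp: abs_mult\<close>)
    then show "\<bar>rate t \<omega>\<bar> \<le> C0 + (\<Sum>i\<in>UNIV. c * C i)"
      unfolding rate_def using C0[of "(t, X t \<omega>)"] by linarith
  qed
qed

text \<open>Along almost every path the fundamental theorem, valid across the finitely many jumps,
  evaluates the integral of the rate as the difference of \<open>\<psi>\<close> at the two ends,
  which is 0 by the support condition. Fubini then moves the expectation inside the time
  integral.\<close>

lemma integral_expectation_rate:
  assumes \<alpha>: "0 < \<alpha>" and supp: "\<And>t x. t \<le> \<alpha> \<or> \<beta> \<le> t \<Longrightarrow> \<psi> (t, x) = 0" and "\<alpha> \<le> \<beta>"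
  shows "set_integrable lborel {\<alpha>..\<beta>} (\<lambda>t. expectation (rate t))"
    and "(LBINT t:{\<alpha>..\<beta>}. expectation (rate t)) = 0"
proof -
  define good where "good \<omega> = (\<forall>i. \<bar>B i \<omega>\<bar> = 1)" for \<omega>
  obtain C where C: "\<And>t \<omega>. good \<omega> \<Longrightarrow> \<bar>rate t \<omega>\<bar> \<le> C" unfolding good_def by (rule rate_bounded) blast
  have AE_good: "AE \<omega> in M. good \<omega>" unfolding good_def by (rule AE_B_unit)
  have B_meas [measurable]: "B i \<in> borel_measurable M" for i
  proof -
    interpret kac_1d M a "N i" c "B i" by (rule kac)
    show ?thesis by (rule B_meas)
  qed
  have good_meas: "(\<lambda>\<omega>. of_bool (good \<omega>) :: real) \<in> borel_measurable M" unfolding good_def by measurable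
  \<comment> \<open>\<open>Fubini_bounded\<close> asks for a bound at every \<open>\<omega>\<close>,
    but the rate is controlled only where all \<open>B i \<omega>\<close> have modulus 1; it is cut
    off on the null set where this fails.\<close>
  define f where "f s \<omega> = of_bool (good \<omega>) * rate (max 0 s) \<omega>" for s \<omega>
  have f_meas: "(\<lambda>(s, \<omega>). f s \<omega>) \<in> borel_measurable (borel \<Otimes>\<^sub>M M)"
    unfolding f_def case_prod_beta'
    using rate_pair by (intro borel_measurable_times measurable_compose[OF measurable_snd good_meas]) (simp add: case_prod_beta')
  have f_bound: "\<bar>f s \<omega>\<bar> \<le> max C 0" for s \<omega>
    using C[of \<omega> "max 0 s"] by (cases "good \<omega>") (auto simp: f_def)
  have rate_meas: "rate t \<in> borel_measurable M" if "0 \<le> t" for t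
    using measurable_compose[OF measurable_Pair1' rate_pair, of t] that by simp
  have f_meas1: "f t \<in> borel_measurable M" for t
    unfolding f_def by (intro borel_measurable_times good_meas rate_meas) simp
  have f_eq: "expectation (f t) = expectation (rate t)" if "\<alpha> \<le> t" for t
  proof (rule integral_cong_AE[OF f_meas1 rate_meas])
    show "AE \<omega> in M. f t \<omega> = rate t \<omega>"
      using AE_good by eventually_elim (use \<alpha> that in \<open>simp add: f_def\<close>)
  qed (use \<alpha> that in auto)
  have cong: "set_integrable lborel {\<alpha>..\<beta>} (\<lambda>t. expectation (f t)) = set_integrable lborel {\<alpha>..\<beta>} (\<lambda>t. expectation (rate t))"
    by (rule set_integrable_cong) (auto simp: f_eq)
  show "set_integrable lborel {\<alpha>..\<beta>} (\<lambda>t. expectation (rate t))"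
    unfolding cong[symmetric] by (rule Fubini_bounded(2)[OF f_meas f_bound])
  have path_0: "(LBINT s:{\<alpha>..\<beta>}. f s \<omega>) = 0" if \<omega>: "\<omega> \<in> space M" for \<omega>
  proof (cases "good \<omega>")
    case True
    have "((\<lambda>s. rate s \<omega>) has_integral \<psi> (\<beta>, X \<beta> \<omega>) - \<psi> (\<alpha>, X \<alpha> \<omega>)) {\<alpha>..\<beta>}"
    proof (rule fundamental_theorem_of_calculus_interior_strong[OF finite_jump_times[OF \<omega>, of \<beta>] \<open>\<alpha> \<le> \<beta>\<close>])
      show "continuous_on {\<alpha>..\<beta>} (\<lambda>s. \<psi> (s, X s \<omega>))"
        by (rule continuous_on_compose2[OF test_function_continuous(1)[OF \<psi>]])
           (use \<alpha> \<omega> in \<open>auto intro!: continuous_intros X_continuous\<close>)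
      fix s assume "s \<in> {\<alpha><..<\<beta>} - jump_times \<omega> \<inter> {..\<beta>}"
      then show "((\<lambda>s. \<psi> (s, X s \<omega>)) has_vector_derivative rate s \<omega>) (at s)"
        using test_function_along_path[OF \<omega>, of s] \<alpha> by (auto simp: has_real_derivative_iff_has_vector_derivative)
    qed
    then have "((\<lambda>s. rate s \<omega>) has_integral 0) {\<alpha>..\<beta>}" by (simp add: supp)
    then have "((\<lambda>s. f s \<omega>) has_integral 0) {\<alpha>..\<beta>}"
      by (rule has_integral_eq[rotated]) (use True \<alpha> in \<open>auto simp: f_def\<close>)
    moreover have "set_integrable lborel {\<alpha>..\<beta>} (\<lambda>s. f s \<omega>)"
      unfolding set_integrable_def
    proof (rule integrableI_bounded_set[where A = "{\<alpha>..\<beta>}" and B = "max C 0"])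
      have "(\<lambda>s. f s \<omega>) \<in> borel_measurable borel"
        using measurable_compose[OF measurable_Pair2' f_meas, of \<omega>] \<omega> by simp
      then show "(\<lambda>s. indicat_real {\<alpha>..\<beta>} s *\<^sub>R f s \<omega>) \<in> borel_measurable lborel" by measurable
    qed (use f_bound \<open>\<alpha> \<le> \<beta>\<close> in \<open>auto simp: indicator_def\<close>)
    ultimately show ?thesis
      using set_borel_integral_eq_integral(2)[of "{\<alpha>..\<beta>}" "\<lambda>s. f s \<omega>"] by (simp add: integral_unique)
  qed (simp add: f_def)
  have "(LBINT t:{\<alpha>..\<beta>}. expectation (rate t)) = (LBINT t:{\<alpha>..\<beta>}. expectation (f t))"
    by (intro set_lebesgue_integral_cong) (auto simp: f_eq)
  also have "\<dots> = expectation (\<lambda>\<omega>. LBINT s:{\<alpha>..\<beta>}. f s \<omega>)"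
    by (rule Fubini_bounded(1)[OF f_meas f_bound, symmetric])
  also have "\<dots> = expectation (\<lambda>\<omega>. 0)"
    by (intro Bochner_Integration.integral_cong refl path_0)
  finally show "(LBINT t:{\<alpha>..\<beta>}. expectation (rate t)) = 0" by simp
qed

text \<open>The passage from the field to the process: almost surely \<open>X t\<close> lies in the
  closed cone, where the field is given by \<open>vel\<close>. Each component is then exchanged for
  the true velocity by \<open>expectation_velocity_vec\<close>, with a partial derivative of
  \<open>\<psi>\<close> as the test function.\<close>

lemma expectation_test_field:
  assumes t: "0 < t" and v_meas: "kac_velocity_field a c g x0 t \<in> borel_measurable borel"
  defines "h \<equiv> \<lambda>x. deriv (\<lambda>s. \<psi> (s, x)) t + kac_velocity_field a c g x0 t x \<bullet> grad_x \<psi> t x"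
  shows "integrable (distr M borel (X t)) h"
    and "(\<integral>x. h x \<partial>distr M borel (X t)) = expectation (rate t)"
proof -
  have t': "0 \<le> t" using t by simp
  note [measurable] = X_measurable[OF t'] K_measurable[OF t'] \<sigma>_measurable[OF t']
  have "(\<lambda>x. kac_velocity_field a c g x0 t x \<bullet> axis i 1) \<in> borel_measurable borel" for i
    using v_meas by measurable
  then have v_i: "(\<lambda>x. kac_velocity a c (g i) (x0 $ i) t (x $ i)) \<in> borel_measurable borel" for i
    by (simp add: kac_velocity_field_def inner_axis)
  have h_eq: "h x = D (t, x) (1, 0) + (\<Sum>i\<in>UNIV. kac_velocity a c (g i) (x0 $ i) t (x $ i) * D (t, x) (0, axis i 1))" for x
    by (simp add: h_def test_function_time_derivative[OF \<psi>] test_function_grad[OF \<psi>] inner_vec_def kac_velocity_field_def D_def)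
  have h_meas [measurable]: "h \<in> borel_measurable borel"
    unfolding h_eq[abs_def] by (intro borel_measurable_add borel_measurable_sum borel_measurable_times v_i D_Pair_measurable)
  let ?V = "\<lambda>i \<omega>. vel a c t (K t \<omega> $ i)"
  let ?T = "\<lambda>\<omega>. D (t, X t \<omega>) (1, 0)" and ?D = "\<lambda>i \<omega>. D (t, X t \<omega>) (0, axis i 1)"
  have D_X [measurable]: "(\<lambda>\<omega>. D (t, X t \<omega>) w) \<in> borel_measurable M" for w
    by (rule measurable_compose[OF X_measurable[OF t'] D_Pair_measurable])
  have D_bound: "\<exists>C. \<forall>p. \<bar>D p w\<bar> \<le> C" for w
    using test_function_bounded[OF \<psi>, of w] unfolding D_def .
  have D_int: "integrable M (\<lambda>\<omega>. D (t, X t \<omega>) w)" for w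
  proof -
    obtain C where C: "\<And>p. \<bar>D p w\<bar> \<le> C" using D_bound by blast
    show ?thesis by (rule integrable_const_bound[where B = C]) (use C in auto)
  qed
  have V_int: "integrable M (\<lambda>\<omega>. ?V i \<omega> * ?D i \<omega>)" for i
  proof -
    obtain C where C: "\<And>p. \<bar>D p (0, axis i 1)\<bar> \<le> C" using D_bound by blast
    show ?thesis
      by (rule integrable_const_bound[where B = "c * C"])
         (use C c_pos vel_bound[OF a_pos c_pos] in \<open>auto simp: abs_mult intro!: mult_mono\<close>)
  qed
  have \<sigma>_int: "integrable M (\<lambda>\<omega>. \<sigma> t i \<omega> * ?D i \<omega>)" for i
  proof -
    obtain C where C: "\<And>p. \<bar>D p (0, axis i 1)\<bar> \<le> C" using D_bound by blast
    show ?thesis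
    proof (rule integrable_const_bound[where B = "c * C"])
      show "AE \<omega> in M. norm (\<sigma> t i \<omega> * ?D i \<omega>) \<le> c * C"
        using AE_B_unit by eventually_elim (use C c_pos \<sigma>_bound in \<open>auto simp: abs_mult intro!: mult_mono\<close>)
    qed measurable
  qed
  have AE_h: "AE \<omega> in M. h (X t \<omega>) = ?T \<omega> + (\<Sum>i\<in>UNIV. ?V i \<omega> * ?D i \<omega>)"
  proof -
    have "AE \<omega> in M. \<forall>i\<in>UNIV. \<bar>K t \<omega> $ i\<bar> \<le> c * t"
    proof (rule AE_finite_allI)
      fix i
      interpret kac_1d M a "N i" c "B i" by (rule kac)
      show "AE \<omega> in M. \<bar>K t \<omega> $ i\<bar> \<le> c * t"
        using AE_position_bound[OF t'] AE_space by eventually_elim (simp add: K[OF t'])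
    qed simp
    then show ?thesis
    proof eventually_elim
      case (elim \<omega>)
      then have "kac_velocity a c (g i) (x0 $ i) t (X t \<omega> $ i) = ?V i \<omega>" for i
        using kac_velocity_eq_vel[of "X t \<omega> $ i" "x0 $ i" c t a "g i"] by (simp add: X_def)
      then show ?case by (simp only: h_eq)
    qed
  qed
  have hX_meas: "(\<lambda>\<omega>. h (X t \<omega>)) \<in> borel_measurable M" by measurable
  have sum_int: "integrable M (\<lambda>\<omega>. ?T \<omega> + (\<Sum>i\<in>UNIV. ?V i \<omega> * ?D i \<omega>))"
    using D_int V_int by (intro Bochner_Integration.integrable_add Bochner_Integration.integrable_sum)
  have "integrable M (\<lambda>\<omega>. h (X t \<omega>))"
    using sum_int AE_h by (subst integrable_cong_AE[OF hX_meas borel_measurable_integrable[OF sum_int]])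
  then show "integrable (distr M borel (X t)) h"
    by (subst integrable_distr_eq) auto
  have "(\<integral>x. h x \<partial>distr M borel (X t)) = expectation (\<lambda>\<omega>. h (X t \<omega>))"
    by (rule integral_distr) auto
  also have "\<dots> = expectation (\<lambda>\<omega>. ?T \<omega> + (\<Sum>i\<in>UNIV. ?V i \<omega> * ?D i \<omega>))"
    by (rule integral_cong_AE[OF hX_meas borel_measurable_integrable[OF sum_int] AE_h])
  also have "\<dots> = expectation ?T + (\<Sum>i\<in>UNIV. expectation (\<lambda>\<omega>. ?V i \<omega> * ?D i \<omega>))"
    using D_int V_int by (simp add: Bochner_Integration.integral_add Bochner_Integration.integral_sum)
  also have "(\<Sum>i\<in>UNIV. expectation (\<lambda>\<omega>. ?V i \<omega> * ?D i \<omega>)) = (\<Sum>i\<in>UNIV. expectation (\<lambda>\<omega>. \<sigma> t i \<omega> * ?D i \<omega>))"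
  proof (rule sum.cong[OF refl])
    fix i
    obtain C where C: "\<And>p. \<bar>D p (0, axis i 1)\<bar> \<le> C" using D_bound by blast
    show "expectation (\<lambda>\<omega>. ?V i \<omega> * ?D i \<omega>) = expectation (\<lambda>\<omega>. \<sigma> t i \<omega> * ?D i \<omega>)"
      by (rule expectation_velocity_vec[OF t D_Pair_measurable C, symmetric])
  qed
  also have "expectation ?T + \<dots> = expectation (rate t)"
    unfolding rate_def[abs_def] using D_int \<sigma>_int by simp
  finally show "(\<integral>x. h x \<partial>distr M borel (X t)) = expectation (rate t)" .
qed

end

lemma continuity_equation_kac:
  assumes v: "\<And>t. 0 < t \<Longrightarrow> kac_velocity_field a c g x0 t \<in> borel_measurable borel"
  shows "continuity_equation (\<lambda>t. distr M borel (X t)) (kac_velocity_field a c g x0)"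
  unfolding continuity_equation_def Let_def
proof (intro allI impI)
  fix \<psi> :: "real \<times> (real ^ 'd) \<Rightarrow> real" assume \<psi>: "test_function ({0<..} \<times> UNIV) \<psi>"
  obtain \<alpha> \<beta> where \<alpha>: "0 < \<alpha>" "\<alpha> \<le> \<beta>"
    and supp: "\<And>t x. t \<le> \<alpha> \<or> \<beta> \<le> t \<Longrightarrow> \<psi> (t, x) = 0 \<and> frechet_derivative \<psi> (at (t, x)) = (\<lambda>_. 0)"
    using test_function_support[OF \<psi>] by blast
  let ?h = "\<lambda>t x. deriv (\<lambda>s. \<psi> (s, x)) t + kac_velocity_field a c g x0 t x \<bullet> grad_x \<psi> t x"
  let ?I = "\<lambda>t. \<integral>x. ?h t x \<partial>distr M borel (X t)"
  \<comment> \<open>Outside the time support the rate vanishes, so the half-line reduces to a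
    compact interval; integrability in \<open>t\<close> is inherited from the expected rate.\<close>
  have I_eq: "indicator {0<..} t *\<^sub>R ?I t = indicator {\<alpha>..\<beta>} t *\<^sub>R expectation (rate \<psi> t)" for t
  proof (cases "0 < t")
    case True
    have "expectation (rate \<psi> t) = 0" if "t \<notin> {\<alpha>..\<beta>}"
    proof -
      have "rate \<psi> t = (\<lambda>_. 0)"
        using that supp by (intro ext rate_eq_0[OF \<psi>]) (auto simp: D_def[OF \<psi>])
      then show ?thesis by simp
    qed
    then show ?thesis
      using True expectation_test_field(2)[OF \<psi> True v[OF True]] by (auto simp: indicator_def)
  qed (use \<alpha> in auto)
  note integral = integral_expectation_rate[OF \<psi> \<alpha>(1) _ \<alpha>(2)]
  show "(AE t in lborel. 0 < t \<longrightarrow> integrable (distr M borel (X t)) (?h t)) \<and>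
    set_integrable lborel {0<..} ?I \<and> (LBINT t:{0<..}. ?I t) = 0"
  proof (intro conjI)
    show "AE t in lborel. 0 < t \<longrightarrow> integrable (distr M borel (X t)) (?h t)"
      by (intro AE_I2 impI expectation_test_field(1)[OF \<psi> _ v]) auto
    show "set_integrable lborel {0<..} ?I"
      using integral(1) supp unfolding set_integrable_def I_eq by blast
    show "(LBINT t:{0<..}. ?I t) = 0"
      using integral(2) supp unfolding set_lebesgue_integral_def I_eq by blast
  qed
qed

end

theorem theorem6p2:
  fixes M :: "'w measure" and a c :: real
    and K :: "real \<Rightarrow> 'w \<Rightarrow> real ^ 'd" and x0 :: "real ^ 'd"
    and g :: "'d \<Rightarrow> real \<Rightarrow> real \<Rightarrow> real"
  assumes "prob_space M" and "a > 0" and "c > 0"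
    and "kac_process_vec M a c K"
    and "(\<lambda>(t, x). kac_velocity_field a c g x0 t x)
           \<in> borel_measurable (restrict_space borel ({0<..} \<times> UNIV))"
  shows "let X = (\<lambda>t \<omega>. x0 + K t \<omega>) in
    continuity_equation (\<lambda>t. distr M borel (X t)) (kac_velocity_field a c g x0) \<and>
    (\<forall>i. \<forall>t>0. AE x in distr M borel (\<lambda>\<omega>. X t \<omega> $ i).
       kac_velocity a c (g i) (x0 $ i) t x =
         cond_exp_given M borel (\<lambda>\<omega>. (X t \<omega> $ i, X 0 \<omega> $ i))
           (\<lambda>\<omega>. deriv (\<lambda>s. X s \<omega> $ i) t) (x, x0 $ i))"
proof -
  interpret prob_space M by fact
  have "\<exists>N B. kac_1d M a N c B \<and>
      (\<forall>t\<ge>0. \<forall>\<omega>\<in>space M. K t \<omega> $ i = kac_1d.position N c B t \<omega>)" for i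
  proof -
    from assms(4) have "kac_process M a c (\<lambda>t \<omega>. K t \<omega> $ i)" by (simp add: kac_process_vec_def)
    then obtain N B where N: "poisson_process M a N" and B: "B \<in> borel_measurable M"
      "measure M {\<omega> \<in> space M. B \<omega> = 1} = 1 / 2" "measure M {\<omega> \<in> space M. B \<omega> = - 1} = 1 / 2"
      "indep_set (sets (vimage_algebra (space M) B borel))
          (sets (vimage_algebra (space M) (\<lambda>\<omega>. \<lambda>t\<in>{0..}. N t \<omega>) (PiM {0..} (\<lambda>_. count_space UNIV))))"
      and K: "\<And>t \<omega>. t \<ge> 0 \<Longrightarrow> \<omega> \<in> space M \<Longrightarrow> K t \<omega> $ i = B \<omega> * c * integral {0..t} (\<lambda>s. (- 1) ^ N s \<omega>)"
      unfolding kac_process_def by blast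
    interpret kac_1d M a N c B
      by (intro kac_1d.intro poisson_paths.intro poisson_paths_axioms.intro kac_1d_axioms.intro assms N B)
    have "K t \<omega> $ i = position t \<omega>" if "t \<ge> 0" "\<omega> \<in> space M" for t \<omega>
      unfolding K[OF that] position_def counting_path.integral_alternating[OF counting_path[OF that(2)] that(1)] ..
    then show ?thesis using kac_1d_axioms by blast
  qed
  \<comment> \<open>The driving Poisson process and sign come separately for each component; choice
    collects them into families.\<close>
  then obtain N B where kac: "\<And>i. kac_1d M a (N i) c (B i)"
    and K: "\<And>i t \<omega>. t \<ge> 0 \<Longrightarrow> \<omega> \<in> space M \<Longrightarrow> K t \<omega> $ i = kac_1d.position (N i) c (B i) t \<omega>"
    by metis
  have "indep_vars (\<lambda>_. PiM {0..} (\<lambda>_. borel)) (\<lambda>i \<omega>. \<lambda>t\<in>{0..}. K t \<omega> $ i) UNIV"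
    using assms(4) unfolding kac_process_vec_def by blast
  then interpret kac_nd M a c N B K x0
    by (intro kac_nd.intro kac_nd_axioms.intro assms kac K)
  \<comment> \<open>Joint measurability is given on positive times only; composing with
    \<open>x \<mapsto> (t, x)\<close> for such a \<open>t\<close> yields the section at that
    time.\<close>
  have v: "kac_velocity_field a c g x0 t \<in> borel_measurable borel" if "0 < t" for t
  proof -
    have "(\<lambda>x. (t, x)) \<in> borel \<rightarrow>\<^sub>M restrict_space borel ({0<..} \<times> (UNIV :: (real ^ 'd) set))"
      by (rule measurable_restrict_space2) (use that in auto)
    from measurable_compose[OF this assms(5)] show ?thesis by simp
  qed
  have "AE x in distr M borel (\<lambda>\<omega>. X t \<omega> $ i). kac_velocity a c (g i) (x0 $ i) t x =
         cond_exp_given M borel (\<lambda>\<omega>. (X t \<omega> $ i, X 0 \<omega> $ i)) (\<lambda>\<omega>. deriv (\<lambda>s. X s \<omega> $ i) t) (x, x0 $ i)"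
    if "0 < t" for i t
    by (rule kac_1d.kac_velocity_eq_cond_exp[OF kac[of i] X_component that])
  with continuity_equation_kac[OF v]
  have "continuity_equation (\<lambda>t. distr M borel (X t)) (kac_velocity_field a c g x0) \<and>
    (\<forall>i. \<forall>t>0. AE x in distr M borel (\<lambda>\<omega>. X t \<omega> $ i).
       kac_velocity a c (g i) (x0 $ i) t x =
         cond_exp_given M borel (\<lambda>\<omega>. (X t \<omega> $ i, X 0 \<omega> $ i))
           (\<lambda>\<omega>. deriv (\<lambda>s. X s \<omega> $ i) t) (x, x0 $ i))"
    by blast
  then show ?thesis unfolding Let_def X_def[abs_def] .
qed

end
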